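(* Assume that $1<p<5$. Then, for any $\mu,q,\lambda>0$, there exists $\bar\omega>0$ such that for every $\omega\ge\bar\omega$ the equation $$-\Delta u +\omega u -\mu u \Delta (u^2)+q \frac{h_{u}^{2}(|x|)}{|x|^{2}} (1 +\mu u^2)u + q \Big( \int_{|x|}^\infty \frac{h_u(s)}{s} \big(2+ \mu u^2(s) \big) u^2(s) \,ds \Big)u =\lambda |u|^{p-1}u \quad \text{in } \mathbb{R}^2,\qquad (\star)$$ where $h_u(s)=\int_0^s r u^2(r)\,dr$, has no nontrivial weak solution $u\in\mathcal{X}$.
   Context: Here $H^1_r(\mathbb{R}^2)=\{u\in H^1(\mathbb{R}^2): u \text{ is radially symmetric}\}$ (real-valued functions), and radial functions are written $u(x)=u(|x|)$. The set $\mathcal{X}:=\{u\in H^1_r(\mathbb{R}^2): u^2\in H^1(\mathbb{R}^2)\}$. For $u\in\mathcal{X}$ and $s\ge 0$, $h_u(s)=\int_0^s r u^2(r)\,dr$. Weak solution: $u\in\mathcal{X}$ is a weak solution of $(\star)$ if for all radially symmetric $\varphi\in C_0^\infty(\mathbb{R}^2)$, $$\int_{\mathbb{R}^2} \Big\{ (1+2 \mu u^2) \nabla u \cdot \nabla \varphi +2 \mu u | \nabla u|^2 \varphi+ \omega u \varphi- \lambda |u|^{p-1}u \varphi +q \frac{h_u^2(|x|)}{|x|^2} (1+ \mu u^2) u\varphi +q \Big( \int_{|x|}^{\infty} \frac{h_u(s)}{s} ( 2+ \mu u^2(s) ) u^2(s)\,ds\Big) u \varphi \Big\} dx =0 .$$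 *)

theory Defs
  imports "HOL-Analysis.Analysis"
begin

type_synonym R2 = "real^2"

section \<open>Test functions\<close>

definition partial_deriv :: "2 \<Rightarrow> (R2 \<Rightarrow> real) \<Rightarrow> R2 \<Rightarrow> real" where
  "partial_deriv i f x = frechet_derivative f (at x) (axis i 1)"

definition grad :: "(R2 \<Rightarrow> real) \<Rightarrow> R2 \<Rightarrow> R2" where
  "grad f x = (\<chi> i. partial_deriv i f x)"

text \<open>\<open>C\<^sup>\<infinity>\<close>: all iterated partial derivatives, including \<open>f\<close> itself (empty list), are
  Frechet differentiable everywhere; in particular they are all continuous.\<close>

definition smooth :: "(R2 \<Rightarrow> real) \<Rightarrow> bool" where
  "smooth f \<longleftrightarrow> (\<forall>is :: 2 list. \<forall>x. foldr partial_deriv is f differentiable (at x))"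

definition test_function :: "(R2 \<Rightarrow> real) \<Rightarrow> bool" where
  "test_function \<phi> \<longleftrightarrow> smooth \<phi> \<and> compact (closure {x. \<phi> x \<noteq> 0})"

section \<open>Sobolev functions\<close>

text \<open>Elements of Lebesgue and Sobolev spaces are represented by Lebesgue measurable functions;
  equality of elements is equality almost everywhere.\<close>

definition locally_integrable :: "(R2 \<Rightarrow> 'b::euclidean_space) \<Rightarrow> bool" where
  "locally_integrable f \<longleftrightarrow> (\<forall>K. compact K \<longrightarrow> set_integrable lebesgue K f)"

definition square_integrable :: "(R2 \<Rightarrow> 'b::euclidean_space) \<Rightarrow> bool" where
  "square_integrable f \<longleftrightarrow>
     f \<in> borel_measurable lebesgue \<and> integrable lebesgue (\<lambda>x. (norm (f x))\<^sup>2)"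

definition has_weak_gradient :: "(R2 \<Rightarrow> real) \<Rightarrow> (R2 \<Rightarrow> R2) \<Rightarrow> bool" where
  "has_weak_gradient u g \<longleftrightarrow> locally_integrable u \<and> locally_integrable g \<and>
     (\<forall>\<phi>. test_function \<phi> \<longrightarrow>
        (\<forall>i. (LINT x|lebesgue. u x * partial_deriv i \<phi> x) = - (LINT x|lebesgue. g x $ i * \<phi> x)))"

text \<open>The weak gradient is unique only up to null sets, so this picks a representative.\<close>

definition weak_gradient :: "(R2 \<Rightarrow> real) \<Rightarrow> R2 \<Rightarrow> R2" where
  "weak_gradient u = (SOME g. has_weak_gradient u g)"

definition H1 :: "(R2 \<Rightarrow> real) set" where
  "H1 = {u. square_integrable u \<and> (\<exists>g. has_weak_gradient u g \<and> square_integrable g)}"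

text \<open>Radial symmetry is imposed pointwise. Every almost everywhere class of radially symmetric
  functions has such a representative, and for it \<open>u(r)\<close> makes sense without further choices.\<close>

definition radial :: "(R2 \<Rightarrow> real) \<Rightarrow> bool" where
  "radial u \<longleftrightarrow> (\<forall>x y. norm x = norm y \<longrightarrow> u x = u y)"

definition H1_r :: "(R2 \<Rightarrow> real) set" where
  "H1_r = {u \<in> H1. radial u}"

definition X_space :: "(R2 \<Rightarrow> real) set" where
  "X_space = {u \<in> H1_r. (\<lambda>x. (u x)\<^sup>2) \<in> H1}"

section \<open>The equation\<close>

text \<open>For radial \<open>u\<close> and \<open>r \<ge> 0\<close> this is \<open>u(r)\<close>, that is, \<open>u x = profile u (norm x)\<close>.\<close>

definition profile :: "(R2 \<Rightarrow> real) \<Rightarrow> real \<Rightarrow> real" where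
  "profile u r = u (r *\<^sub>R axis 1 1)"

definition hu :: "(R2 \<Rightarrow> real) \<Rightarrow> real \<Rightarrow> real" where
  "hu u s = (LINT r:{0..s}|lebesgue. r * (profile u r)\<^sup>2)"

definition tail_potential :: "real \<Rightarrow> (R2 \<Rightarrow> real) \<Rightarrow> real \<Rightarrow> real" where
  "tail_potential \<mu> u t =
     (LINT s:{t..}|lebesgue. hu u s / s * (2 + \<mu> * (profile u s)\<^sup>2) * (profile u s)\<^sup>2)"

text \<open>\<open>has_bochner_integral M f 0\<close> says that \<open>f\<close> is integrable with integral \<open>0\<close>, whereas
  \<open>integral\<^sup>L M f = 0\<close> would also hold by convention for a non-integrable \<open>f\<close>. For
  \<open>u \<in> X_space\<close> the integrand below is always integrable, so nothing is added.\<close>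

definition weak_solution ::
    "real \<Rightarrow> real \<Rightarrow> real \<Rightarrow> real \<Rightarrow> real \<Rightarrow> (R2 \<Rightarrow> real) \<Rightarrow> bool" where
  "weak_solution p \<mu> q lam \<omega> u \<longleftrightarrow> u \<in> X_space \<and>
     (\<forall>\<phi>. test_function \<phi> \<and> radial \<phi> \<longrightarrow>
        has_bochner_integral lebesgue
          (\<lambda>x. (1 + 2 * \<mu> * (u x)\<^sup>2) * (weak_gradient u x \<bullet> grad \<phi> x)
             + 2 * \<mu> * u x * (norm (weak_gradient u x))\<^sup>2 * \<phi> x
             + \<omega> * u x * \<phi> x
             - lam * \<bar>u x\<bar> powr (p - 1) * u x * \<phi> x
             + q * ((hu u (norm x))\<^sup>2 / (norm x)\<^sup>2) * (1 + \<mu> * (u x)\<^sup>2) * u x * \<phi> x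
             + q * tail_potential \<mu> u (norm x) * u x * \<phi> x)
          0)"

end

theory Submission
  imports Defs
begin

text \<open>
  In the variable \<open>t = |x|\<^sup>2\<close> Lebesgue measure on the plane becomes \<open>\<pi> dt\<close>, and test functions
  \<open>\<psi>(|x|\<^sup>2)\<close> and \<open>x\<^sub>i \<psi>(|x|\<^sup>2)\<close> with \<open>\<psi>\<close> supported in \<open>(0,\<infinity>)\<close> suffice. The du Bois-Reymond argument,
  applied first to the weak gradient and then to the equation, shows that \<open>u(x) = V(|x|\<^sup>2)\<close> with
  \<open>V\<close> continuously differentiable on \<open>(0,\<infinity>)\<close>, so the equation may be multiplied by \<open>V\<close> and integrated
  over an annulus \<open>a < |x|\<^sup>2 \<le> b\<close>.

  Let \<open>H(t) = h\<^sub>u(\<surd>t)\<close>, so \<open>H' = V\<^sup>2 / 2\<close>. Completing a square absorbs \<open>(V\<^sup>4 H)'\<close> into the quasilinear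
  and the gauge term at the gain of a multiple of \<open>V\<^sup>6\<close>; since \<open>p + 1 < 6\<close>, this together with
  \<open>\<omega> V\<^sup>2\<close> dominates the source for large \<open>\<omega>\<close>. Hence
  \<open>G = 4 t V V' (1 + 2 \<mu> V\<^sup>2) + 2 \<mu> \<surd>q V\<^sup>4 H\<close> satisfies \<open>G' \<ge> V\<^sup>2\<close>. As \<open>G / \<surd>t\<close> is integrable at infinity,
  \<open>G \<le> 0\<close>. If \<open>V\<close> did not vanish, \<open>G\<close> would be bounded above by a negative constant near \<open>0\<close>, so
  \<open>V\<^sup>2 + \<mu> V\<^sup>4\<close> would grow at least like \<open>log (1/t)\<close>, which is incompatible with \<open>u\<^sup>2 \<in> H\<^sup>1\<close>.
\<close>

section \<open>Smooth bump functions and radial test functions\<close>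

text \<open>Test functions vanishing near the origin leave it as a possible singularity, with no
  boundary condition there; the sign of \<open>G\<close> together with the finite energy of u^2
  takes its place. The weak gradient g is never shown to be radial or unique. Only integrals of g .
  x against radial weights are identified, and |g|^2 enters through a lower bound, so testing with V
  gives an inequality.

  The square is \<mu> (4 sqrt t V V' + sqrt q H V^2 / sqrt t)^2. Its pure terms are the parts of the
  quasilinear and gauge terms that carry \<mu>. Its mixed term 8 \<mu> sqrt q V^3 V' H equals 2
  \<mu> sqrt q (V^4 H)' - \<mu> sqrt q V^6, because H' = V^2 / 2; this fixes the coefficient in
  \<open>G\<close> and the gain.

  The flux part of \<open>G\<close> is 2 t (V^2 + \<mu> V^4)', so a negative upper bound for
  \<open>G\<close> is a growth rate at 0. The final conflict is borderline: if V^4 grows like log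
  (1/t), the energy of u^2 diverges only like log log (1/t). Hence the energy is used to bound the
  logarithm of 1 + 4 \<mu> (V^2 + \<mu> V^4).\<close>

definition smooth_real :: "(real \<Rightarrow> real) \<Rightarrow> bool" where
  "smooth_real f \<longleftrightarrow> (\<forall>k t. (deriv ^^ k) f field_differentiable (at t))"

text \<open>Iterated derivatives never leave a class closed under differentiation, so membership
  replaces formulas for the k-th derivative; \<open>flat_quadratic_span\<close> is built to be such
  a class.\<close>

lemma smooth_realI_closed:
  assumes "f \<in> S" and S: "\<And>g. g \<in> S \<Longrightarrow> \<exists>g'\<in>S. \<forall>t. (g has_real_derivative g' t) (at t)"
  shows "smooth_real f"
proof -
  have *: "deriv g \<in> S" if "g \<in> S" for g
  proof -
    obtain g' where g': "g' \<in> S" "\<forall>t. (g has_real_derivative g' t) (at t)" using S[OF \<open>g \<in> S\<close>] by blast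
    then have "deriv g = g'" by (auto intro!: ext DERIV_imp_deriv)
    then show ?thesis using g' by simp
  qed
  have "(deriv ^^ k) f \<in> S" for k
    by (induction k) (auto simp: assms(1) *)
  then show ?thesis unfolding smooth_real_def
    by (metis S field_differentiable_def)
qed

lemma smooth_real_DERIV: "smooth_real f \<Longrightarrow> (f has_real_derivative deriv f t) (at t)"
  unfolding smooth_real_def
  by (metis field_differentiable_derivI funpow_0)

lemma smooth_real_deriv: "smooth_real f \<Longrightarrow> smooth_real (deriv f)"
  unfolding smooth_real_def
  by (metis comp_apply funpow_Suc_right)

lemma smooth_real_antiderivative:
  assumes "smooth_real f" "\<And>t. (F has_real_derivative f t) (at t)"
  shows "smooth_real F"
  unfolding smooth_real_def
proof (intro allI)
  fix k t
  have d: "deriv F = f" using assms(2) by (auto intro!: ext DERIV_imp_deriv)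
  show "(deriv ^^ k) F field_differentiable (at t)"
  proof (cases k)
    case 0
    then show ?thesis using assms(2) by (auto simp: field_differentiable_def)
  next
    case (Suc j)
    then show ?thesis using assms(1) d unfolding smooth_real_def
      by (metis comp_apply funpow_Suc_right)
  qed
qed

lemma smooth_real_continuous: "smooth_real f \<Longrightarrow> continuous_on A f"
  by (meson DERIV_isCont continuous_at_imp_continuous_on smooth_real_DERIV)

text \<open>For \<open>m = 0\<close> this is the classical flat function exp (-1/t). The powers of t
  in the denominator are what differentiation produces, so derivatives are linear combinations
  within the family.\<close>

definition flat :: "nat \<Rightarrow> real \<Rightarrow> real" where
  "flat m t = (if t > 0 then exp (- 1 / t) / t ^ m else 0)"

lemma flat_tendsto_0: "(flat m \<longlongrightarrow> 0) (at 0)"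
proof -
  have "((\<lambda>t. (inverse t) ^ m / exp (inverse t)) \<longlongrightarrow> (0::real)) (at_right 0)"
    by (rule filterlim_compose[OF tendsto_power_div_exp_0 filterlim_inverse_at_top_right])
  moreover have "\<forall>\<^sub>F t in at_right 0. (inverse t) ^ m / exp (inverse t) = flat m t"
    by (auto simp: eventually_at_right_less flat_def exp_minus field_simps power_inverse
        intro!: eventually_mono[OF eventually_at_right_less[of 0]])
  ultimately have r: "(flat m \<longlongrightarrow> 0) (at_right 0)"
    by (rule Lim_transform_eventually)
  have "\<forall>\<^sub>F t in at_left 0. 0 = flat m t"
    by (auto simp: flat_def eventually_at_left_field intro!: exI[of _ "-1"])
  then have l: "(flat m \<longlongrightarrow> 0) (at_left 0)"
    by (rule Lim_transform_eventually[OF tendsto_const])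
  show ?thesis using l r filterlim_split_at by blast
qed

lemma flat_DERIV: "(flat m has_real_derivative flat (m + 2) t - m * flat (m + 1) t) (at t)"
proof -
  consider "t > 0" | "t < 0" | "t = 0" by linarith
  then show ?thesis
  proof cases
    case 1
    have "((\<lambda>t. exp (- 1 / t) / t ^ m) has_real_derivative flat (m + 2) t - m * flat (m + 1) t) (at t)"
    proof -
      have "((\<lambda>t. exp (- inverse t) * inverse t ^ m) has_real_derivative
          exp (- inverse t) * inverse t ^ 2 * inverse t ^ m
          + exp (- inverse t) * (m * inverse t ^ (m - 1) * (- (inverse t ^ 2)))) (at t)"
        using 1 by (auto intro!: derivative_eq_intros simp: power2_eq_square)
      moreover have "exp (- inverse t) * inverse t ^ 2 * inverse t ^ m
          + exp (- inverse t) * (m * inverse t ^ (m - 1) * (- (inverse t ^ 2)))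
          = flat (m + 2) t - m * flat (m + 1) t"
        using 1 by (cases m) (simp_all add: flat_def divide_inverse power2_eq_square power_inverse algebra_simps)
      ultimately show ?thesis
        by (simp add: divide_inverse power_inverse)
    qed
    then show ?thesis
      by (rule has_field_derivative_transform_within[where d=t]) (use 1 in \<open>auto simp: flat_def dist_real_def\<close>)
  next
    case 2
    have "((\<lambda>t. 0) has_real_derivative flat (m + 2) t - m * flat (m + 1) t) (at t)"
      using 2 by (auto simp: flat_def)
    then show ?thesis
      by (rule has_field_derivative_transform_within[where d="-t"]) (use 2 in \<open>auto simp: flat_def dist_real_def\<close>)
  next
    case 3
    \<comment> \<open>The difference quotient at 0 is again a member of the family, so
      differentiability there is just \<open>flat_tendsto_0\<close>. At h = 0 both sides are 0, by
      division by zero on the left.\<close>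
    have "(\<lambda>h. (flat m (0 + h) - flat m 0) / h) = flat (m + 1)"
      by (auto simp: flat_def fun_eq_iff)
    then show ?thesis using flat_tendsto_0[of "m + 1"] 3
      by (simp add: DERIV_def flat_def)
  qed
qed

text \<open>Contains the derivatives of its members: the chain rule contributes the derivative of n
  (t - a) (b - t), which is affine in t, and for this reason multiplication by t is among the
  generators.\<close>

inductive_set flat_quadratic_span :: "real \<Rightarrow> real \<Rightarrow> real \<Rightarrow> (real \<Rightarrow> real) set" for n a b where
  flat: "(\<lambda>t. flat m (n * ((t - a) * (b - t)))) \<in> flat_quadratic_span n a b"
| times: "f \<in> flat_quadratic_span n a b \<Longrightarrow> (\<lambda>t. t * f t) \<in> flat_quadratic_span n a b"
| scale: "f \<in> flat_quadratic_span n a b \<Longrightarrow> (\<lambda>t. c * f t) \<in> flat_quadratic_span n a b"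
| add: "f \<in> flat_quadratic_span n a b \<Longrightarrow> g \<in> flat_quadratic_span n a b \<Longrightarrow>
    (\<lambda>t. f t + g t) \<in> flat_quadratic_span n a b"

text \<open>The factor \<open>n\<close> pushes the exponent -1/s to 0, so the bumps increase to the
  indicator of (a, b). For n > 0 all are positive exactly on (a, b), and the values stay in [0, 1],
  so dominated convergence applies directly.\<close>

definition bump :: "nat \<Rightarrow> real \<Rightarrow> real \<Rightarrow> real \<Rightarrow> real" where
  "bump n a b t = flat 0 (real n * ((t - a) * (b - t)))"

lemma smooth_bump: "smooth_real (bump n a b)"
proof (rule smooth_realI_closed)
  show "bump n a b \<in> flat_quadratic_span (real n) a b"
    unfolding bump_def by (rule flat_quadratic_span.flat)
next
  fix g assume "g \<in> flat_quadratic_span (real n) a b"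
  then show "\<exists>g'\<in>flat_quadratic_span (real n) a b. \<forall>t. (g has_real_derivative g' t) (at t)"
  proof induction
    case (flat m)
    let ?f = "\<lambda>m t. flat m (real n * ((t - a) * (b - t)))"
    let ?h = "\<lambda>t. ?f (m + 2) t + (- real m) * ?f (m + 1) t"
    let ?g = "\<lambda>t. (- 2 * real n) * (t * ?h t) + (real n * (a + b)) * ?h t"
    have h: "?h \<in> flat_quadratic_span (real n) a b"
      by (intro flat_quadratic_span.intros)
    have "?g \<in> flat_quadratic_span (real n) a b"
      by (intro flat_quadratic_span.add flat_quadratic_span.scale flat_quadratic_span.times h)
    moreover have "(?f m has_real_derivative ?g t) (at t)" for t
    proof -
      have "((\<lambda>t. real n * ((t - a) * (b - t))) has_real_derivative
          real n * (a + b - 2 * t)) (at t)"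
        by (auto intro!: derivative_eq_intros simp: field_simps)
      from DERIV_chain2[OF flat_DERIV this] show ?thesis
        by (rule DERIV_cong) (simp add: algebra_simps)
    qed
    ultimately show ?case by (intro bexI[of _ ?g] allI)
  next
    case (times f)
    then obtain f' where f': "f' \<in> flat_quadratic_span (real n) a b"
      "\<forall>t. (f has_real_derivative f' t) (at t)" by blast
    have "(\<lambda>t. f t + t * f' t) \<in> flat_quadratic_span (real n) a b"
      by (intro flat_quadratic_span.add flat_quadratic_span.times times f')
    moreover have "((\<lambda>t. t * f t) has_real_derivative f t + t * f' t) (at t)" for t
      using f'(2) by (auto intro!: derivative_eq_intros)
    ultimately show ?case by (intro bexI[of _ "\<lambda>t. f t + t * f' t"] allI)
  next
    case (scale f c)
    then obtain f' where f': "f' \<in> flat_quadratic_span (real n) a b"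
      "\<forall>t. (f has_real_derivative f' t) (at t)" by blast
    have "((\<lambda>t. c * f t) has_real_derivative c * f' t) (at t)" for t
      using f'(2) by (auto intro!: derivative_eq_intros)
    then show ?case using flat_quadratic_span.scale[OF f'(1)]
      by (intro bexI[of _ "\<lambda>t. c * f' t"] allI)
  next
    case (add f g)
    then obtain f' g' where f': "f' \<in> flat_quadratic_span (real n) a b"
      "\<forall>t. (f has_real_derivative f' t) (at t)"
      and g': "g' \<in> flat_quadratic_span (real n) a b"
      "\<forall>t. (g has_real_derivative g' t) (at t)" by blast
    have "((\<lambda>t. f t + g t) has_real_derivative f' t + g' t) (at t)" for t
      using f'(2) g'(2) by (auto intro!: derivative_eq_intros)
    then show ?case using flat_quadratic_span.add[OF f'(1) g'(1)]
      by (intro bexI[of _ "\<lambda>t. f' t + g' t"] allI)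
  qed
qed

lemma bump_nonneg: "0 \<le> bump n a b t"
  by (simp add: bump_def flat_def)

lemma bump_le_1: "bump n a b t \<le> 1"
  by (simp add: bump_def flat_def)

lemma bump_outside: "a \<le> b \<Longrightarrow> t \<notin> {a<..<b} \<Longrightarrow> bump n a b t = 0"
proof -
  assume "a \<le> b" "t \<notin> {a<..<b}"
  then have "(t - a) * (b - t) \<le> 0"
    by (auto simp: mult_le_0_iff)
  then have "real n * ((t - a) * (b - t)) \<le> 0"
    by (simp add: mult_nonneg_nonpos)
  then show ?thesis by (simp add: bump_def flat_def)
qed

lemma bump_pos: "n > 0 \<Longrightarrow> t \<in> {a<..<b} \<Longrightarrow> bump n a b t > 0"
  by (auto simp: bump_def flat_def)

lemma bump_tendsto_indicator:
  assumes "a \<le> b"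
  shows "(\<lambda>n. bump n a b t) \<longlonglongrightarrow> indicator {a<..<b} t"
proof (cases "t \<in> {a<..<b}")
  case False
  then show ?thesis using bump_outside[OF assms False] by simp
next
  case True
  define d where "d = (t - a) * (b - t)"
  have d: "d > 0" using True by (simp add: d_def)
  have "(\<lambda>n. exp (- (1 / d) * inverse (real n))) \<longlonglongrightarrow> exp (- (1 / d) * 0)"
    by (intro tendsto_intros LIMSEQ_inverse_real_of_nat[THEN LIMSEQ_imp_Suc])
  moreover have "exp (- (1 / d) * inverse (real n)) = bump n a b t" if "n > 0" for n
  proof -
    have "real n * d > 0" using that d by simp
    then show ?thesis
      unfolding bump_def flat_def d_def[symmetric] using that by (simp add: field_simps)
  qed
  then have "\<forall>\<^sub>F n in sequentially. exp (- (1 / d) * inverse (real n)) = bump n a b t"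
    using eventually_gt_at_top[of 0] by (rule eventually_mono[rotated])
  ultimately have "(\<lambda>n. bump n a b t) \<longlonglongrightarrow> exp (- (1 / d) * 0)"
    by (rule Lim_transform_eventually)
  then show ?thesis using True by (simp del: greaterThanLessThan_iff)
qed

lemma continuous_bump: "continuous_on A (bump n a b)"
  by (rule smooth_real_continuous[OF smooth_bump])

text \<open>Closed under every \<open>partial_deriv i\<close>: differentiating the k-th derivative
  of \<psi> at x . x gives 2 x_i times the next one. Multiplication by coordinates thus has to be
  included, and it brings in the functions x_i \<psi>(x . x) as well.\<close>

inductive_set radial_span :: "(real \<Rightarrow> real) \<Rightarrow> (R2 \<Rightarrow> real) set" for \<psi> where
  base: "(\<lambda>x. (deriv ^^ k) \<psi> (x \<bullet> x)) \<in> radial_span \<psi>"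
| times: "f \<in> radial_span \<psi> \<Longrightarrow> (\<lambda>x. x $ i * f x) \<in> radial_span \<psi>"
| scale: "f \<in> radial_span \<psi> \<Longrightarrow> (\<lambda>x. c * f x) \<in> radial_span \<psi>"
| add: "f \<in> radial_span \<psi> \<Longrightarrow> g \<in> radial_span \<psi> \<Longrightarrow> (\<lambda>x. f x + g x) \<in> radial_span \<psi>"

lemma has_derivative_radial:
  fixes x :: "'a::real_inner"
  assumes "(\<psi> has_real_derivative d) (at (x \<bullet> x))"
  shows "((\<lambda>x. \<psi> (x \<bullet> x)) has_derivative (\<lambda>v. d * (2 * (x \<bullet> v)))) (at x)"
proof -
  have "((\<lambda>x. x \<bullet> x) has_derivative (\<lambda>v. x \<bullet> v + v \<bullet> x)) (at x)"
    by (auto intro!: derivative_eq_intros)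
  moreover have "(\<lambda>v. x \<bullet> v + v \<bullet> x) = (\<lambda>v. 2 * (x \<bullet> v))"
    by (simp add: inner_commute)
  ultimately have 1: "((\<lambda>x. x \<bullet> x) has_derivative (\<lambda>v. 2 * (x \<bullet> v))) (at x)" by simp
  show ?thesis
    using has_derivative_compose[OF 1, of \<psi> "(*) d"] assms
    by (simp add: has_field_derivative_def)
qed

lemma partial_deriv_eq:
  assumes "(f has_derivative f') (at x)"
  shows "partial_deriv i f x = f' (axis i 1)"
  using frechet_derivative_at[OF assms] by (simp add: partial_deriv_def)

lemma radial_span_derivative:
  assumes "smooth_real \<psi>" "f \<in> radial_span \<psi>"
  shows "\<exists>f'. (\<forall>x. (f has_derivative f' x) (at x)) \<and> (\<forall>i. (\<lambda>x. f' x (axis i 1)) \<in> radial_span \<psi>)"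
  using assms(2)
proof induction
  case (base k)
  have "((deriv ^^ k) \<psi> has_real_derivative (deriv ^^ Suc k) \<psi> t) (at t)" for t
    using assms(1) by (auto simp: smooth_real_def field_differentiable_derivI)
  from has_derivative_radial[OF this]
  have "((\<lambda>x::R2. (deriv ^^ k) \<psi> (x \<bullet> x)) has_derivative
    (\<lambda>v. (deriv ^^ Suc k) \<psi> (x \<bullet> x) * (2 * (x \<bullet> v)))) (at x)" for x .
  moreover have "(\<lambda>x::R2. (deriv ^^ Suc k) \<psi> (x \<bullet> x) * (2 * (x \<bullet> axis i 1)))
    = (\<lambda>x. 2 * (x $ i * (deriv ^^ Suc k) \<psi> (x \<bullet> x)))" for i
    by (simp add: inner_axis fun_eq_iff)
  moreover have "(\<lambda>x. 2 * (x $ i * (deriv ^^ Suc k) \<psi> (x \<bullet> x))) \<in> radial_span \<psi>" for i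
    by (intro radial_span.scale radial_span.times radial_span.base)
  ultimately show ?case
    by (intro exI[of _ "\<lambda>x v. (deriv ^^ Suc k) \<psi> (x \<bullet> x) * (2 * (x \<bullet> v))"]) presburger
next
  case (times f j)
  then obtain f' where f': "\<And>x. (f has_derivative f' x) (at x)"
    "\<And>i. (\<lambda>x. f' x (axis i 1)) \<in> radial_span \<psi>" by blast
  have 1: "((\<lambda>x. x $ j * f x) has_derivative (\<lambda>v. x $ j * f' x v + v $ j * f x)) (at x)" for x
    using has_derivative_mult[OF bounded_linear.has_derivative[OF bounded_linear_vec_nth has_derivative_ident]
        f'(1)] .
  have "(\<lambda>x. x $ j * f' x (axis i 1) + (axis i 1 :: R2) $ j * f x) \<in> radial_span \<psi>" for i
    by (intro radial_span.add radial_span.scale radial_span.times f' times)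
  then show ?case using 1 by (intro exI[of _ "\<lambda>x v. x $ j * f' x v + v $ j * f x"]) auto
next
  case (scale f c)
  then obtain f' where f': "\<And>x. (f has_derivative f' x) (at x)"
    "\<And>i. (\<lambda>x. f' x (axis i 1)) \<in> radial_span \<psi>" by blast
  show ?case
    by (intro exI[of _ "\<lambda>x v. c * f' x v"] conjI allI radial_span.scale f' has_derivative_mult_right)
next
  case (add f g)
  then obtain f' g' where f': "\<And>x. (f has_derivative f' x) (at x)"
    "\<And>i. (\<lambda>x. f' x (axis i 1)) \<in> radial_span \<psi>"
    and g': "\<And>x. (g has_derivative g' x) (at x)"
    "\<And>i. (\<lambda>x. g' x (axis i 1)) \<in> radial_span \<psi>" by blast
  show ?case
    by (intro exI[of _ "\<lambda>x v. f' x v + g' x v"] conjI allI radial_span.add f' g' has_derivative_add)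
qed

lemma smooth_radial_span:
  assumes "smooth_real \<psi>" "f \<in> radial_span \<psi>"
  shows "smooth f"
proof -
  have *: "g differentiable at x \<and> partial_deriv i g \<in> radial_span \<psi>" if g: "g \<in> radial_span \<psi>" for g x i
  proof -
    obtain g' where g': "(\<forall>x. (g has_derivative g' x) (at x)) \<and>
      (\<forall>i. (\<lambda>x. g' x (axis i 1)) \<in> radial_span \<psi>)"
      using radial_span_derivative[OF assms(1) g] by (rule exE)
    have "partial_deriv i g = (\<lambda>x. g' x (axis i 1))"
      using g' by (intro ext partial_deriv_eq) blast
    then show ?thesis using g' by (auto simp: differentiable_def)
  qed
  have "foldr partial_deriv is f \<in> radial_span \<psi>" for "is"
    by (induction "is") (auto simp: assms(2) *)
  then show ?thesis using * by (auto simp: smooth_def)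
qed

definition annular_profile :: "(real \<Rightarrow> real) \<Rightarrow> bool" where
  "annular_profile \<psi> \<longleftrightarrow> smooth_real \<psi> \<and> (\<exists>a b. 0 < a \<and> a < b \<and> (\<forall>t. t \<notin> {a..b} \<longrightarrow> \<psi> t = 0))"

lemma compact_support_radial:
  assumes "annular_profile \<psi>"
  shows "compact (closure {x::R2. h x * \<psi> (x \<bullet> x) \<noteq> 0})"
proof -
  obtain a b where ab: "0 < a" "a < b" "\<And>t. t \<notin> {a..b} \<Longrightarrow> \<psi> t = 0"
    using assms by (auto simp: annular_profile_def)
  have "{x::R2. h x * \<psi> (x \<bullet> x) \<noteq> 0} \<subseteq> cball 0 (sqrt b)"
  proof
    fix x :: R2 assume "x \<in> {x. h x * \<psi> (x \<bullet> x) \<noteq> 0}"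
    then have "x \<bullet> x \<le> b" using ab(3)[of "x \<bullet> x"] by force
    then show "x \<in> cball 0 (sqrt b)" by (simp add: norm_eq_sqrt_inner)
  qed
  then have "bounded {x::R2. h x * \<psi> (x \<bullet> x) \<noteq> 0}" using bounded_cball bounded_subset by blast
  then show ?thesis by (simp add: compact_closure)
qed

lemma test_function_radial:
  assumes "annular_profile \<psi>"
  shows "test_function (\<lambda>x. \<psi> (x \<bullet> x))"
proof -
  have "(\<lambda>x. \<psi> (x \<bullet> x)) \<in> radial_span \<psi>" using radial_span.base[of 0 \<psi>] by simp
  then show ?thesis using assms compact_support_radial[OF assms, of "\<lambda>_. 1"]
    by (auto simp: test_function_def annular_profile_def intro: smooth_radial_span)
qed

lemma test_function_radial_component:
  assumes "annular_profile \<psi>"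
  shows "test_function (\<lambda>x. x $ i * \<psi> (x \<bullet> x))"
proof -
  have "(\<lambda>x. x $ i * \<psi> (x \<bullet> x)) \<in> radial_span \<psi>"
    using radial_span.times[OF radial_span.base[of 0 \<psi>]] by simp
  then show ?thesis using assms compact_support_radial[OF assms, of "\<lambda>x. x $ i"]
    by (auto simp: test_function_def annular_profile_def intro: smooth_radial_span)
qed

lemma radial_inner_self: "radial (\<lambda>x. \<psi> (x \<bullet> x))"
  by (auto simp: radial_def norm_eq_sqrt_inner)

lemma grad_radial:
  assumes "smooth_real \<psi>"
  shows "grad (\<lambda>x. \<psi> (x \<bullet> x)) x = (2 * deriv \<psi> (x \<bullet> x)) *\<^sub>R x"
  using partial_deriv_eq[OF has_derivative_radial[OF smooth_real_DERIV[OF assms]]]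
  by (simp add: grad_def vec_eq_iff inner_axis)

lemma partial_deriv_radial_component:
  assumes "smooth_real \<psi>"
  shows "partial_deriv i (\<lambda>x. x $ i * \<psi> (x \<bullet> x)) x = \<psi> (x \<bullet> x) + 2 * (x $ i)\<^sup>2 * deriv \<psi> (x \<bullet> x)"
proof -
  have "((\<lambda>x::R2. x $ i * \<psi> (x \<bullet> x)) has_derivative
      (\<lambda>v. x $ i * (deriv \<psi> (x \<bullet> x) * (2 * (x \<bullet> v))) + v $ i * \<psi> (x \<bullet> x))) (at x)"
    using has_derivative_mult[OF bounded_linear.has_derivative[OF bounded_linear_vec_nth has_derivative_ident]
        has_derivative_radial[OF smooth_real_DERIV[OF assms]]] .
  from partial_deriv_eq[OF this] show ?thesis
    by (simp add: inner_axis power2_eq_square)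
qed

section \<open>Integration over annuli\<close>

lemma emeasure_inner_self_le:
  assumes "0 \<le> t"
  shows "emeasure lborel {x::R2. x \<bullet> x \<le> t} = ennreal (pi * t)"
proof -
  have "{x::R2. x \<bullet> x \<le> t} = cball 0 (sqrt t)"
    using assms by (auto simp: norm_eq_sqrt_inner)
  then show ?thesis using assms
    by (simp add: emeasure_cball unit_ball_vol_2)
qed

text \<open>The disc of squared radius t has area pi t, and the half-lines \<open>{..t}\<close> form
  an intersection-stable generator of the Borel sets. Linearity of the area in t is what makes the
  density constant.\<close>

lemma distr_inner_self:
  "distr lborel borel (\<lambda>x::R2. x \<bullet> x) = density lborel (\<lambda>t. ennreal pi * indicator {0..} t)"
proof (rule measure_eqI_generator_eq[where E = "range atMost" and \<Omega> = UNIV and A = "\<lambda>i::nat. {..real i}"])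
  show "Int_stable (range (atMost :: real \<Rightarrow> real set))"
    by (auto simp: Int_stable_def)
  show eq: "emeasure (distr lborel borel (\<lambda>x::R2. x \<bullet> x)) X
    = emeasure (density lborel (\<lambda>t. ennreal pi * indicator {0..} t)) X" if X: "X \<in> range atMost" for X
  proof -
    obtain t :: real where t: "X = {..t}" using X by auto
    have "emeasure (distr lborel borel (\<lambda>x::R2. x \<bullet> x)) X = emeasure lborel {x::R2. x \<bullet> x \<le> t}"
      by (auto simp: emeasure_distr t vimage_def)
    also have "\<dots> = ennreal (pi * max 0 t)"
    proof (cases "0 \<le> t")
      case False
      have "\<not> x \<bullet> x \<le> t" for x :: R2 using False inner_ge_zero[of x] by linarith
      then show ?thesis using False by simp
    qed (simp add: emeasure_inner_self_le max_def)
    also have "\<dots> = emeasure (density lborel (\<lambda>t. ennreal pi * indicator {0..} t)) X"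
    proof -
      have "indicator {0..} s * indicator {..t} s = (indicator {0..t} s :: ennreal)" for s
        by (auto split: split_indicator)
      then show ?thesis
        by (simp add: t emeasure_density nn_integral_cmult mult.assoc emeasure_lborel_Icc_eq ennreal_mult max_def)
    qed
    finally show ?thesis .
  qed
  show "emeasure (distr lborel borel (\<lambda>x::R2. x \<bullet> x)) {..real i} \<noteq> \<infinity>" for i
  proof -
    have "emeasure (distr lborel borel (\<lambda>x::R2. x \<bullet> x)) {..real i} = emeasure lborel {x::R2. x \<bullet> x \<le> real i}"
      by (auto simp: emeasure_distr vimage_def)
    then show ?thesis by (simp add: emeasure_inner_self_le)
  qed
  show "(\<Union>i. {..real i}) = UNIV"
    by (auto intro: real_arch_simple)
  have "sets (borel :: real measure) = sigma_sets UNIV (range atMost)"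
    unfolding borel_eq_atMost by (rule sets_measure_of) simp
  then show "sets (distr lborel borel (\<lambda>x::R2. x \<bullet> x)) = sigma_sets UNIV (range atMost)"
    "sets (density lborel (\<lambda>t. ennreal pi * indicator {0..} t)) = sigma_sets UNIV (range (atMost :: real \<Rightarrow> _))"
    by simp_all
qed auto

text \<open>The bounds are squared radii. The set is half-open, so that annuli sharing a boundary
  circle are disjoint and their integrals add.\<close>

definition annulus :: "real \<Rightarrow> real \<Rightarrow> R2 set" where
  "annulus a b = {x. a < x \<bullet> x \<and> x \<bullet> x \<le> b}"

lemma annulus_measurable [measurable]: "annulus a b \<in> sets borel" "annulus a b \<in> sets lebesgue"
proof -
  show "annulus a b \<in> sets borel" unfolding annulus_def by measurable
  then show "annulus a b \<in> sets lebesgue" by simp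
qed

lemma emeasure_radial:
  assumes "N \<in> sets borel"
  shows "emeasure lborel {x::R2. x \<bullet> x \<in> N} = pi * emeasure lborel (N \<inter> {0..})"
proof -
  have "emeasure lborel {x::R2. x \<bullet> x \<in> N} = emeasure (distr lborel borel (\<lambda>x::R2. x \<bullet> x)) N"
    using assms by (auto simp: emeasure_distr vimage_def)
  also have "\<dots> = \<integral>\<^sup>+ t. ennreal pi * indicator (N \<inter> {0..}) t \<partial>lborel"
    using assms unfolding distr_inner_self
    by (subst emeasure_density) (auto intro!: nn_integral_cong split: split_indicator)
  finally show ?thesis using assms by (simp add: nn_integral_cmult)
qed

lemma circle_null: "{x::R2. x \<bullet> x = t} \<in> null_sets lebesgue"
proof -
  have "emeasure lborel {x::R2. x \<bullet> x = t} = 0"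
    using emeasure_radial[of "{t}"] emeasure_mono[of "{t} \<inter> {0..}" "{t}" lborel] by simp
  moreover have "{x::R2. x \<bullet> x = t} \<in> sets borel" by measurable
  ultimately show ?thesis by (simp add: null_sets_completionI null_sets_def)
qed

lemma annulus_integral_radial:
  fixes F :: "real \<Rightarrow> real"
  assumes ab: "0 \<le> a" "a \<le> b" and F: "continuous_on {a..b} F"
  shows "set_integrable lebesgue (annulus a b) (\<lambda>x. F (x \<bullet> x))"
    and "(LINT x:annulus a b|lebesgue. F (x \<bullet> x)) = pi * integral {a..b} F"
proof -
  define F' where "F' = (\<lambda>t. indicator {a<..b} t *\<^sub>R F t)"
  have 0: "set_integrable lborel {a..b} F"
    using F by (rule borel_integrable_compact[OF compact_Icc, folded set_integrable_def])
  then have iF: "set_integrable lborel {a<..b} F"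
    by (rule set_integrable_subset) auto
  then have iF': "integrable lborel F'" by (simp add: F'_def set_integrable_def)
  then have mF' [measurable]: "F' \<in> borel_measurable borel" by simp
  have eq: "indicator (annulus a b) x *\<^sub>R F (x \<bullet> x) = F' (x \<bullet> x)" for x
    by (auto simp: F'_def annulus_def split: split_indicator)
  have pos: "(ennreal pi * indicator {0..} t) = ennreal (pi * indicator {0..} t)" for t :: real
    by (auto split: split_indicator)
  have restr: "pi * indicator {0..} t * F' t = pi * F' t" for t
    using ab by (auto simp: F'_def split: split_indicator)
  have "integrable (density lborel (\<lambda>t. ennreal pi * indicator {0..} t)) F'"
    unfolding pos using iF' by (subst integrable_density) (auto simp: restr)
  then have int: "integrable lborel (\<lambda>x::R2. F' (x \<bullet> x))"
    unfolding distr_inner_self[symmetric] by (subst (asm) integrable_distr_eq) auto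
  have "(LINT x::R2|lborel. F' (x \<bullet> x)) = integral\<^sup>L (distr lborel borel (\<lambda>x::R2. x \<bullet> x)) F'"
    by (subst integral_distr) auto
  also have "\<dots> = (LINT t|lborel. pi * F' t)"
    unfolding distr_inner_self pos by (subst integral_density) (auto simp: restr)
  also have "\<dots> = pi * (LINT t:{a<..b}|lborel. F t)"
    by (simp add: set_lebesgue_integral_def F'_def)
  also have "(LINT t:{a<..b}|lborel. F t) = integral {a<..b} F"
    using iF by (rule set_borel_integral_eq_integral)
  also have "\<dots> = integral {a..b} F"
    by (rule integral_spike_set) (auto intro: negligible_subset[of "{a}"])
  finally have eqI: "(LINT x::R2|lborel. F' (x \<bullet> x)) = pi * integral {a..b} F" .
  have m: "(\<lambda>x::R2. F' (x \<bullet> x)) \<in> borel_measurable lborel" by measurable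
  show "set_integrable lebesgue (annulus a b) (\<lambda>x. F (x \<bullet> x))"
    unfolding set_integrable_def eq using int m by (simp add: integrable_completion)
  show "(LINT x:annulus a b|lebesgue. F (x \<bullet> x)) = pi * integral {a..b} F"
    unfolding set_lebesgue_integral_def eq using m eqI by (simp add: integral_completion)
qed

text \<open>The difficulty is that \<open>N\<close> is not known to be measurable, so
  \<open>emeasure_radial\<close> does not apply to it. The complement of its preimage contains a
  sigma-compact set \<open>C\<close> of full measure in that complement; the image of
  \<open>C\<close> under x . x is sigma-compact, hence Borel. The rest \<open>B\<close> of the
  half-line contains \<open>N\<close>, and its preimage avoids \<open>C\<close>, so it is null in
  the plane.\<close>

lemma null_of_radial_null:
  assumes "{x::R2. x \<bullet> x \<in> N} \<in> null_sets lebesgue" "N \<subseteq> {0..}"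
  shows "N \<in> null_sets lebesgue"
proof -
  define M where "M = {x::R2. x \<bullet> x \<in> N}"
  have "- M \<in> sets lebesgue"
    using assms(1) sets.compl_sets[of M lebesgue] by (simp add: M_def Compl_eq_Diff_UNIV null_sets_def)
  then obtain C T where CT: "fsigma C" "T \<in> null_sets lebesgue" "C \<union> T = - M"
    using lebesgue_set_almost_fsigma by metis
  obtain F :: "nat \<Rightarrow> R2 set" where F: "range F \<subseteq> Collect compact" "C = \<Union>(F ` UNIV)"
    using iffD1[OF fsigma_Union_compact CT(1)] by metis
  define C' where "C' = (\<lambda>x::R2. x \<bullet> x) ` C"
  have "compact ((\<lambda>x::R2. x \<bullet> x) ` F n)" for n
    using F(1) by (intro compact_continuous_image continuous_intros) auto
  then have [measurable]: "C' \<in> sets borel"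
    unfolding C'_def F(2) image_UN by (intro sets.countable_UN') (auto intro: borel_compact)
  define B where "B = {0..} - C'"
  have [measurable]: "B \<in> sets borel" by (simp add: B_def)
  have null: "M \<union> T \<in> null_sets lebesgue" using assms(1) CT(2) by (auto simp: M_def)
  have sub: "{x::R2. x \<bullet> x \<in> B} \<subseteq> M \<union> T" using CT(3) by (auto simp: B_def C'_def)
  have mB: "{x::R2. x \<bullet> x \<in> B} \<in> sets borel" by measurable
  have "{x::R2. x \<bullet> x \<in> B} \<in> null_sets lebesgue"
    by (rule null_sets_subset[OF null _ sub]) (use mB in simp)
  then have "emeasure lborel {x::R2. x \<bullet> x \<in> B} = 0"
    using mB by (simp only: null_sets_def) simp
  then have "emeasure lborel B = 0"
    using emeasure_radial[of B] by (simp add: Int_absorb2 B_def)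
  then have "B \<in> null_sets lebesgue" by (auto simp: null_sets_def)
  moreover have "N \<subseteq> B"
  proof
    fix t assume "t \<in> N"
    have "t \<noteq> x \<bullet> x" if "x \<in> C" for x
      using that \<open>t \<in> N\<close> CT(3) by (auto simp: M_def)
    then show "t \<in> B" using \<open>t \<in> N\<close> assms(2) by (auto simp: B_def C'_def)
  qed
  ultimately show ?thesis
    using negligible_subset[of B N] by (simp add: negligible_iff_null_sets)
qed

section \<open>Integrals over annuli as functions of the squared radius\<close>

definition annularly_integrable :: "(R2 \<Rightarrow> real) \<Rightarrow> bool" where
  "annularly_integrable f \<longleftrightarrow> (\<forall>a>0. \<forall>b. set_integrable lebesgue (annulus a b) f)"

definition cumulative :: "(R2 \<Rightarrow> real) \<Rightarrow> real \<Rightarrow> real" where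
  "cumulative f t = (if 1 \<le> t then (LINT x:annulus 1 t|lebesgue. f x)
    else - (LINT x:annulus t 1|lebesgue. f x))"

lemma annulus_integral_split:
  assumes "annularly_integrable f" "0 < a" "a \<le> b" "b \<le> c"
  shows "(LINT x:annulus a c|lebesgue. f x)
    = (LINT x:annulus a b|lebesgue. f x) + (LINT x:annulus b c|lebesgue. f x)"
proof -
  have "annulus a c = annulus a b \<union> annulus b c" "annulus a b \<inter> annulus b c = {}"
    using assms(3,4) by (auto simp: annulus_def)
  then show ?thesis using assms
    by (simp add: set_integral_Un annularly_integrable_def)
qed

lemma cumulative_diff:
  assumes "annularly_integrable f" "0 < a" "a \<le> b"
  shows "cumulative f b - cumulative f a = (LINT x:annulus a b|lebesgue. f x)"
  using annulus_integral_split[OF assms(1), of 1 a b] annulus_integral_split[OF assms(1), of a 1 b]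
    annulus_integral_split[OF assms(1), of a b 1] assms
  by (auto simp: cumulative_def)

text \<open>Dominated convergence: along a sequence tending to t the indicators of the annuli
  converge off the circle x . x = t, which is null.\<close>

lemma continuous_cumulative:
  assumes f: "annularly_integrable f"
  shows "continuous_on {0<..} (cumulative f)"
proof -
  have "continuous_on {a..} (cumulative f)" if a: "0 < a" for a
    unfolding continuous_on_sequentially comp_def
  proof (intro ballI allI impI, elim conjE)
    fix t s assume t: "t \<in> {a..}" and sa: "\<forall>n. s n \<in> {a..}" and s: "s \<longlonglongrightarrow> t"
    obtain b where b: "\<And>n. \<bar>s n\<bar> \<le> b" using convergent_imp_Bseq[of s] s
      by (auto simp: convergent_def Bseq_def)
    have tb: "t \<le> b" by (rule LIMSEQ_le_const2[OF s]) (use b in \<open>auto intro!: exI[of _ 0] intro: abs_le_D1\<close>)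
    have sb: "s n \<le> b" for n using b[of n] by simp
    have ib: "set_integrable lebesgue (annulus a b) f" using f a by (auto simp: annularly_integrable_def)
    have "(\<lambda>n. LINT x|lebesgue. indicator (annulus a (s n)) x *\<^sub>R f x)
      \<longlonglongrightarrow> (LINT x|lebesgue. indicator (annulus a t) x *\<^sub>R f x)"
    proof (rule integral_dominated_convergence[where w = "\<lambda>x. norm (indicator (annulus a b) x *\<^sub>R f x)"])
      show "(\<lambda>x. indicator (annulus a t) x *\<^sub>R f x) \<in> borel_measurable lebesgue"
        "\<And>n. (\<lambda>x. indicator (annulus a (s n)) x *\<^sub>R f x) \<in> borel_measurable lebesgue"
        using f a by (auto simp: annularly_integrable_def set_integrable_def)
      show "integrable lebesgue (\<lambda>x. norm (indicator (annulus a b) x *\<^sub>R f x))"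
        using ib by (simp add: set_integrable_def)
      show "AE x in lebesgue. norm (indicator (annulus a (s n)) x *\<^sub>R f x)
          \<le> norm (indicator (annulus a b) x *\<^sub>R f x)" for n
        using sb[of n] by (auto simp: annulus_def split: split_indicator)
      have "AE x::R2 in lebesgue. x \<bullet> x \<noteq> t"
        by (rule eventually_mono[OF AE_not_in[OF circle_null[of t]]]) simp
      then show "AE x in lebesgue. (\<lambda>n. indicator (annulus a (s n)) x *\<^sub>R f x)
          \<longlonglongrightarrow> indicator (annulus a t) x *\<^sub>R f x"
      proof (rule eventually_mono)
        fix x :: R2 assume elim: "x \<bullet> x \<noteq> t"
        have "\<forall>\<^sub>F n in sequentially. (x \<bullet> x \<le> s n) = (x \<bullet> x \<le> t)"
        proof (cases "x \<bullet> x < t")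
          case True
          from order_tendstoD(1)[OF s this] show ?thesis by eventually_elim (use True in auto)
        next
          case False
          with elim have *: "t < x \<bullet> x" by simp
          from order_tendstoD(2)[OF s this] show ?thesis by eventually_elim (use * in auto)
        qed
        then have "\<forall>\<^sub>F n in sequentially. indicator (annulus a t) x *\<^sub>R f x
            = indicator (annulus a (s n)) x *\<^sub>R f x"
          by eventually_elim (auto simp: annulus_def indicator_def)
        then show "(\<lambda>n. indicator (annulus a (s n)) x *\<^sub>R f x)
          \<longlonglongrightarrow> indicator (annulus a t) x *\<^sub>R f x"
          by (rule Lim_transform_eventually[OF tendsto_const])
      qed
    qed
    moreover have "(LINT x|lebesgue. indicator (annulus a r) x *\<^sub>R f x) = cumulative f r - cumulative f a"
      if "a \<le> r" for r
      using cumulative_diff[OF f a that] by (simp add: set_lebesgue_integral_def)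
    ultimately have "(\<lambda>n. cumulative f (s n) - cumulative f a) \<longlonglongrightarrow> cumulative f t - cumulative f a"
      using sa t by simp
    from tendsto_add[OF this tendsto_const[of "cumulative f a"]]
    show "(\<lambda>n. cumulative f (s n)) \<longlonglongrightarrow> cumulative f t" by simp
  qed
  then have "continuous (at t) (cumulative f)" if "t > 0" for t
    using that continuous_on_interior[of "{t/2..}" "cumulative f" t] by (auto simp: interior_real_atLeast)
  then show ?thesis by (intro continuous_at_imp_continuous_on) auto
qed

lemma continuous_on_cumulative_Icc:
  "annularly_integrable f \<Longrightarrow> 0 < a \<Longrightarrow> continuous_on {a..b} (cumulative f)"
  by (rule continuous_on_subset[OF continuous_cumulative]) auto

lemma sigma_finite_lebesgue: "sigma_finite_measure (lebesgue :: 'a::euclidean_space measure)"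
proof
  show "\<exists>A::'a set set. countable A \<and> A \<subseteq> sets lebesgue \<and> \<Union> A = space lebesgue \<and> (\<forall>a\<in>A. emeasure lebesgue a \<noteq> \<infinity>)"
  proof (intro exI[of _ "range (\<lambda>n::nat. cball 0 (real n))"] conjI ballI)
    show "\<Union> (range (\<lambda>n::nat. cball (0::'a) (real n))) = space lebesgue"
      by (auto intro: real_arch_simple)
    show "emeasure lebesgue a \<noteq> \<infinity>" if "a \<in> range (\<lambda>n::nat. cball (0::'a) (real n))" for a
      using that emeasure_lborel_cball_finite[where 'a='a] by (auto simp: less_top)
  qed auto
qed

text \<open>Fubini for the function R(x) F'(t) on the region x . x \<le> t, t \<in> [a, b].
  Integrating in t first gives R(x) (F b - F (x . x)), integrating in x first gives F'(t) times an
  increment of \<open>cumulative R\<close>. In this way \<open>R\<close> need be neither radial nor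
  continuous.\<close>

lemma annulus_by_parts:
  fixes F F' :: "real \<Rightarrow> real"
  assumes ab: "0 < a" "a \<le> b" and R: "annularly_integrable R"
    and F: "\<And>t. t \<in> {a..b} \<Longrightarrow> (F has_real_derivative F' t) (at t within {a..b})"
    and F': "continuous_on {a..b} F'"
  shows "(LINT x:annulus a b|lebesgue. F (x \<bullet> x) * R x)
    = F b * cumulative R b - F a * cumulative R a - integral {a..b} (\<lambda>t. F' t * cumulative R t)"
proof -
  interpret L: sigma_finite_measure "lebesgue :: R2 measure" by (rule sigma_finite_lebesgue)
  interpret P: pair_sigma_finite "lebesgue :: R2 measure" "lborel :: real measure" ..
  define r where "r = (\<lambda>x. indicator (annulus a b) x *\<^sub>R R x)"
  define g where "g = (\<lambda>t. indicator {a..b} t *\<^sub>R F' t)"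
  define h where "h = (\<lambda>(x::R2) t. if x \<bullet> x \<le> t then r x * g t else 0)"
  have ir: "integrable lebesgue r" using R ab by (simp add: r_def annularly_integrable_def set_integrable_def)
  then have [measurable]: "r \<in> borel_measurable lebesgue" by simp
  have ig: "integrable lborel g" unfolding g_def
    by (rule borel_integrable_compact[OF compact_Icc F'])
  then have [measurable]: "g \<in> borel_measurable borel" by simp
  have [measurable]: "(\<lambda>x::R2. x \<bullet> x) \<in> borel_measurable lebesgue" by (rule measurable_completion) measurable
  have mh: "(\<lambda>(x, t). h x t) \<in> borel_measurable (lebesgue \<Otimes>\<^sub>M lborel)"
    unfolding h_def by measurable
  have "integrable (lebesgue \<Otimes>\<^sub>M lborel) (\<lambda>(x, t). r x * g t)"
  proof (rule P.Fubini_integrable)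
    show "(\<lambda>(x, t). r x * g t) \<in> borel_measurable (lebesgue \<Otimes>\<^sub>M lborel)" by measurable
    show "integrable lebesgue (\<lambda>x. LINT t|lborel. norm (case (x, t) of (x, t) \<Rightarrow> r x * g t))"
      using ir ig by (simp add: abs_mult)
    show "AE x in lebesgue. integrable lborel (\<lambda>t. case (x, t) of (x, t) \<Rightarrow> r x * g t)"
      using ig by simp
  qed
  then have ih: "integrable (lebesgue \<Otimes>\<^sub>M lborel) (\<lambda>(x, t). h x t)"
    by (rule Bochner_Integration.integrable_bound[OF _ mh]) (auto simp: h_def)
  have inner1: "(LINT t|lborel. h x t) = r x * (F b - F (x \<bullet> x))" for x
  proof (cases "x \<in> annulus a b")
    case False
    then have "r x = 0" by (simp add: r_def)
    then have "h x t = 0" for t by (simp add: h_def)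
    then show ?thesis using \<open>r x = 0\<close> by simp
  next
    case True
    then have x: "a < x \<bullet> x" "x \<bullet> x \<le> b" by (auto simp: annulus_def)
    have "h x t = r x * (indicator {x \<bullet> x..b} t *\<^sub>R F' t)" for t
      using x by (auto simp: h_def g_def split: split_indicator)
    then have "(LINT t|lborel. h x t) = r x * (LINT t:{x \<bullet> x..b}|lborel. F' t)"
      by (simp add: set_lebesgue_integral_def)
    also have "(LINT t:{x \<bullet> x..b}|lborel. F' t) = integral {x \<bullet> x..b} F'"
      using x unfolding set_integrable_def
      by (intro set_borel_integral_eq_integral borel_integrable_compact[folded set_integrable_def]
          continuous_on_subset[OF F']) auto
    also have "\<dots> = F b - F (x \<bullet> x)"
    proof (rule integral_unique, rule fundamental_theorem_of_calculus)
      show "(F has_vector_derivative F' t) (at t within {x \<bullet> x..b})" if "t \<in> {x \<bullet> x..b}" for t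
        using F[of t] that x by (auto simp: has_real_derivative_iff_has_vector_derivative
            intro: has_vector_derivative_within_subset)
    qed (use x in auto)
    finally show ?thesis .
  qed
  have inner2: "(LINT x|lebesgue. h x t) = g t * (cumulative R t - cumulative R a)" for t
  proof (cases "t \<in> {a..b}")
    case False
    then have "g t = 0" by (simp add: g_def)
    then have "h x t = 0" for x by (simp add: h_def)
    then show ?thesis using \<open>g t = 0\<close> by simp
  next
    case True
    then have "h x t = g t * (indicator (annulus a t) x *\<^sub>R R x)" for x
      by (auto simp: h_def r_def annulus_def split: split_indicator)
    then have "(LINT x|lebesgue. h x t) = g t * (LINT x:annulus a t|lebesgue. R x)"
      by (simp add: set_lebesgue_integral_def)
    then show ?thesis using cumulative_diff[OF R ab(1), of t] True by simp
  qed
  have cg: "continuous_on {a..b} (\<lambda>t. F' t * (cumulative R t - cumulative R a))"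
    using F' continuous_on_cumulative_Icc[OF R ab(1)] by (intro continuous_intros)
  have FF: "integral {a..b} F' = F b - F a"
    using F ab by (intro integral_unique fundamental_theorem_of_calculus)
      (auto simp: has_real_derivative_iff_has_vector_derivative)
  have "(LINT x|lebesgue. r x * (F b - F (x \<bullet> x))) = (LINT t|lborel. g t * (cumulative R t - cumulative R a))"
    using P.Fubini_integral[OF ih] by (simp add: inner1 inner2)
  also have "\<dots> = (LINT t:{a..b}|lborel. F' t * (cumulative R t - cumulative R a))"
    by (simp add: set_lebesgue_integral_def g_def mult.assoc)
  also have "\<dots> = integral {a..b} (\<lambda>t. F' t * (cumulative R t - cumulative R a))"
    using cg by (intro set_borel_integral_eq_integral
        borel_integrable_compact[folded set_integrable_def]) auto
  also have "\<dots> = integral {a..b} (\<lambda>t. F' t * cumulative R t) - integral {a..b} F' * cumulative R a"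
    using F' continuous_on_cumulative_Icc[OF R ab(1)]
    by (simp add: right_diff_distrib integral_diff integrable_continuous_real continuous_on_mult)
  finally have 1: "(LINT x|lebesgue. r x * (F b - F (x \<bullet> x)))
    = integral {a..b} (\<lambda>t. F' t * cumulative R t) - (F b - F a) * cumulative R a" by (simp add: FF)
  have i1: "integrable lebesgue (\<lambda>x. r x * (F b - F (x \<bullet> x)))"
    using P.integrable_fst'[OF ih] by (simp add: inner1)
  have "(LINT x:annulus a b|lebesgue. F (x \<bullet> x) * R x) = (LINT x|lebesgue. F b * r x - r x * (F b - F (x \<bullet> x)))"
    unfolding set_lebesgue_integral_def
    by (intro Bochner_Integration.integral_cong) (auto simp: r_def algebra_simps)
  also have "\<dots> = F b * (LINT x|lebesgue. r x) - (LINT x|lebesgue. r x * (F b - F (x \<bullet> x)))"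
    using ir i1 by simp
  also have "(LINT x|lebesgue. r x) = cumulative R b - cumulative R a"
    using cumulative_diff[OF R ab] by (simp add: r_def set_lebesgue_integral_def)
  finally show ?thesis using 1 by (simp add: algebra_simps)
qed

lemma measurable_inner_self [measurable]: "(\<lambda>x::R2. x \<bullet> x) \<in> borel_measurable lebesgue"
  by (rule measurable_completion) measurable

lemma annulus_mult_integrable:
  assumes f: "set_integrable lebesgue (annulus a b) f" and \<theta>: "continuous_on {a..b} \<theta>"
  shows "set_integrable lebesgue (annulus a b) (\<lambda>x. \<theta> (x \<bullet> x) * f x :: real)"
proof -
  define \<theta>' where "\<theta>' = (\<lambda>t. indicator {a..b} t *\<^sub>R \<theta> t)"
  have [measurable]: "\<theta>' \<in> borel_measurable borel"
    unfolding \<theta>'_def using borel_measurable_continuous_on_indicator[OF _ \<theta>] by simp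
  obtain M where M: "\<And>t. t \<in> {a..b} \<Longrightarrow> \<bar>\<theta> t\<bar> \<le> M"
    using compact_imp_bounded[OF compact_continuous_image[OF \<theta> compact_Icc]]
    unfolding bounded_iff by (metis imageI real_norm_def)
  define F where "F = (\<lambda>x. indicator (annulus a b) x *\<^sub>R f x)"
  have iF: "integrable lebesgue F" using f by (simp add: F_def set_integrable_def)
  then have [measurable]: "F \<in> borel_measurable lebesgue" by simp
  have eq: "indicator (annulus a b) x *\<^sub>R (\<theta> (x \<bullet> x) * f x) = \<theta>' (x \<bullet> x) * F x" for x
    by (auto simp: F_def \<theta>'_def annulus_def split: split_indicator)
  have "integrable lebesgue (\<lambda>x. \<theta>' (x \<bullet> x) * F x)"
  proof (rule Bochner_Integration.integrable_bound)
    show "integrable lebesgue (\<lambda>x. M * F x)" using iF by simp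
    show "AE x in lebesgue. norm (\<theta>' (x \<bullet> x) * F x) \<le> norm (M * F x)"
    proof (rule AE_I2)
      fix x :: R2
      have "\<bar>\<theta>' (x \<bullet> x)\<bar> \<le> \<bar>M\<bar>" if "F x \<noteq> 0"
        using that M[of "x \<bullet> x"] by (auto simp: F_def \<theta>'_def annulus_def split: split_indicator)
      then show "norm (\<theta>' (x \<bullet> x) * F x) \<le> norm (M * F x)"
        by (cases "F x = 0") (auto simp: abs_mult intro!: mult_right_mono)
    qed
  qed measurable
  then show ?thesis unfolding set_integrable_def eq .
qed

text \<open>\<open>cumulative k\<close> is constant on [a, b], so for a polynomial weight
  integration by parts gives 0. Stone-Weierstrass then reaches continuous weights, with error at
  most e times the integral of |k|.\<close>

lemma annulus_orthogonal:
  assumes k: "annularly_integrable k"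
    and 0: "\<And>a b. 0 < a \<Longrightarrow> a < b \<Longrightarrow> (LINT x:annulus a b|lebesgue. k x) = 0"
    and ab: "0 < a" "a \<le> b" and \<theta>: "continuous_on {a..b} \<theta>"
  shows "(LINT x:annulus a b|lebesgue. \<theta> (x \<bullet> x) * k x) = 0"
proof -
  have ik: "set_integrable lebesgue (annulus a b) k" using k ab by (simp add: annularly_integrable_def)
  define K where "K = (LINT x:annulus a b|lebesgue. \<bar>k x\<bar>)"
  have iak: "set_integrable lebesgue (annulus a b) (\<lambda>x. \<bar>k x\<bar>)"
    using ik by (rule set_integrable_abs)
  have K0: "0 \<le> K" unfolding K_def set_lebesgue_integral_def by (rule integral_nonneg_AE) auto
  have bound: "\<bar>LINT x:annulus a b|lebesgue. \<theta> (x \<bullet> x) * k x\<bar> \<le> e * K" if e: "e > 0" for e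
  proof -
    obtain g where g: "real_polynomial_function g" "\<And>t. t \<in> {a..b} \<Longrightarrow> \<bar>\<theta> t - g t\<bar> < e"
      using Stone_Weierstrass_real_polynomial_function[OF compact_Icc \<theta> e] by blast
    obtain g' where g': "real_polynomial_function g'" "\<And>t. (g has_real_derivative g' t) (at t)"
      using has_real_derivative_polynomial_function[OF g(1)] by blast
    have cg: "continuous_on A g" "continuous_on A g'" for A
      using g(1) g'(1) continuous_on_polymonial_function real_polynomial_function_eq by blast+
    have const: "cumulative k t = cumulative k a" if "t \<in> {a..b}" for t
      using cumulative_diff[OF k ab(1), of t] 0[of a t] ab that by (cases "t = a") auto
    have gI: "integral {a..b} g' = g b - g a"
      using ab g'(2) by (intro integral_unique fundamental_theorem_of_calculus)
        (auto simp: has_real_derivative_iff_has_vector_derivative intro: has_vector_derivative_at_within)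
    have "integral {a..b} (\<lambda>t. g' t * cumulative k t) = integral {a..b} (\<lambda>t. g' t * cumulative k a)"
      using const by (intro integral_cong) presburger
    then have g0: "(LINT x:annulus a b|lebesgue. g (x \<bullet> x) * k x) = 0"
      using annulus_by_parts[OF ab k, of g g'] g'(2) cg const[of b] ab
      by (simp add: gI has_field_derivative_at_within algebra_simps)
    have i1: "set_integrable lebesgue (annulus a b) (\<lambda>x. \<theta> (x \<bullet> x) * k x)"
      "set_integrable lebesgue (annulus a b) (\<lambda>x. g (x \<bullet> x) * k x)"
      using annulus_mult_integrable[OF ik] \<theta> cg by auto
    have "(LINT x:annulus a b|lebesgue. \<theta> (x \<bullet> x) * k x)
      = (LINT x:annulus a b|lebesgue. \<theta> (x \<bullet> x) * k x - g (x \<bullet> x) * k x)"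
      using g0 set_integral_diff(2)[OF i1] by simp
    also have "\<bar>\<dots>\<bar> \<le> (LINT x:annulus a b|lebesgue. \<bar>\<theta> (x \<bullet> x) * k x - g (x \<bullet> x) * k x\<bar>)"
      using set_integral_norm_bound[OF set_integral_diff(1)[OF i1]] by simp
    also have "\<dots> \<le> (LINT x:annulus a b|lebesgue. e * \<bar>k x\<bar>)"
    proof (rule set_integral_mono)
      show "set_integrable lebesgue (annulus a b) (\<lambda>x. \<bar>\<theta> (x \<bullet> x) * k x - g (x \<bullet> x) * k x\<bar>)"
        by (rule set_integrable_abs[OF set_integral_diff(1)[OF i1]])
      show "set_integrable lebesgue (annulus a b) (\<lambda>x. e * \<bar>k x\<bar>)"
        using iak by simp
      show "\<bar>\<theta> (x \<bullet> x) * k x - g (x \<bullet> x) * k x\<bar> \<le> e * \<bar>k x\<bar>" if "x \<in> annulus a b" for x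
      proof -
        have "\<bar>(\<theta> (x \<bullet> x) - g (x \<bullet> x)) * k x\<bar> \<le> e * \<bar>k x\<bar>"
          unfolding abs_mult using g(2)[of "x \<bullet> x"] that
          by (intro mult_right_mono) (auto simp: annulus_def)
        then show ?thesis by (simp add: left_diff_distrib)
      qed
    qed
    also have "\<dots> = e * K" by (simp add: K_def)
    finally show ?thesis .
  qed
  have "\<bar>LINT x:annulus a b|lebesgue. \<theta> (x \<bullet> x) * k x\<bar> \<le> 0"
  proof (rule field_le_epsilon)
    fix e :: real assume "e > 0"
    \<comment> \<open>Dividing by \<open>K + 1\<close> rather than \<open>K\<close> covers the case
      that \<open>K\<close> vanishes.\<close>
    have "e / (K + 1) * K \<le> e" using \<open>e > 0\<close> K0 by (simp add: field_simps)
    then show "\<bar>LINT x:annulus a b|lebesgue. \<theta> (x \<bullet> x) * k x\<bar> \<le> 0 + e"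
      using bound[of "e / (K + 1)"] \<open>e > 0\<close> K0 by simp
  qed
  then show ?thesis by simp
qed

section \<open>The du Bois-Reymond argument\<close>

lemma smooth_real_lincomb:
  assumes "smooth_real f" "smooth_real g"
  shows "smooth_real (\<lambda>t. c * f t + d * g t)"
proof (rule smooth_realI_closed[where S = "{\<lambda>t. c * f t + d * g t |f g. smooth_real f \<and> smooth_real g}"])
  show "(\<lambda>t. c * f t + d * g t) \<in> {\<lambda>t. c * f t + d * g t |f g. smooth_real f \<and> smooth_real g}"
    using assms by blast
next
  fix h assume "h \<in> {\<lambda>t. c * f t + d * g t |f g. smooth_real f \<and> smooth_real g}"
  then obtain f g where fg: "h = (\<lambda>t. c * f t + d * g t)" "smooth_real f" "smooth_real g" by blast
  have "(h has_real_derivative c * deriv f t + d * deriv g t) (at t)" for t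
    unfolding fg(1) by (intro DERIV_add DERIV_cmult smooth_real_DERIV fg)
  moreover have "(\<lambda>t. c * deriv f t + d * deriv g t) \<in> {\<lambda>t. c * f t + d * g t |f g. smooth_real f \<and> smooth_real g}"
    using smooth_real_deriv fg(2,3) by blast
  ultimately show "\<exists>g'\<in>{\<lambda>t. c * f t + d * g t |f g. smooth_real f \<and> smooth_real g}.
      \<forall>t. (h has_real_derivative g' t) (at t)" by (intro bexI[rotated]) auto
qed

text \<open>The primitive that vanishes to the left of the support is constant to its right, with
  the total integral as its value; zero mean makes it compactly supported, hence admissible as a
  test profile.\<close>

lemma smooth_real_compact_antiderivative:
  assumes g: "smooth_real g" and ab: "0 < a" "a \<le> b" and supp: "\<And>t. t \<notin> {a..b} \<Longrightarrow> g t = 0"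
    and int0: "integral {a..b} g = 0"
  obtains \<psi> where "smooth_real \<psi>" "\<And>t. t \<notin> {a..b} \<Longrightarrow> \<psi> t = 0" "\<And>t. deriv \<psi> t = g t"
proof -
  \<comment> \<open>The base point lies strictly to the left of the support, so that the fundamental
    theorem is available in a full neighbourhood of every t > a/2. For smaller t the interval is
    empty or a point and the integral is 0, as it should be.\<close>
  define \<psi> where "\<psi> = (\<lambda>t. integral {a / 2..t} g)"
  have cg: "continuous_on A g" for A by (rule smooth_real_continuous[OF g])
  have left: "\<psi> t = 0" if "t < a" for t
  proof -
    have "integral {a / 2..t} g = integral {a / 2..t} (\<lambda>_. 0)"
      by (rule integral_cong) (use supp that in auto)
    then show ?thesis by (simp add: \<psi>_def)
  qed
  have right: "\<psi> t = 0" if "b < t" for t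
  proof -
    have "integral {a / 2..a} g + integral {a..t} g = integral {a / 2..t} g"
      by (rule Henstock_Kurzweil_Integration.integral_combine)
        (use that ab in \<open>auto intro: integrable_continuous_real cg\<close>)
    moreover have "integral {a..b} g + integral {b..t} g = integral {a..t} g"
      by (rule Henstock_Kurzweil_Integration.integral_combine)
        (use that ab in \<open>auto intro: integrable_continuous_real cg\<close>)
    moreover have "integral {b..t} g = integral {b<..t} g"
      by (rule integral_spike_set) (auto intro: negligible_subset[of "{b}"])
    moreover have "integral {b<..t} g = integral {b<..t} (\<lambda>_. 0)"
      by (rule integral_cong) (use supp in auto)
    moreover have "integral {a / 2..a} g = integral {a / 2..<a} g"
      by (rule integral_spike_set) (auto intro: negligible_subset[of "{a}"])
    moreover have "integral {a / 2..<a} g = integral {a / 2..<a} (\<lambda>_. 0)"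
      by (rule integral_cong) (use supp in auto)
    ultimately show ?thesis using int0 by (simp add: \<psi>_def)
  qed
  have D: "(\<psi> has_real_derivative g t) (at t)" for t
  proof (cases "a / 2 < t")
    case True
    have "(\<psi> has_real_derivative g t) (at t within {a / 2..t + 1})"
      unfolding \<psi>_def using True by (intro integral_has_real_derivative cg) auto
    then show ?thesis using True by (simp add: at_within_Icc_at)
  next
    case False
    then have t: "t < a" using ab by simp
    have "((\<lambda>_. 0) has_real_derivative g t) (at t)" using supp[of t] t by auto
    then show ?thesis
      by (rule has_field_derivative_transform_within[where d = "a - t"])
        (use t left in \<open>auto simp: dist_real_def\<close>)
  qed
  show ?thesis
  proof (rule that)
    show "smooth_real \<psi>" by (rule smooth_real_antiderivative[OF g D])
    show "\<psi> t = 0" if "t \<notin> {a..b}" for t using that left right by auto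
    show "deriv \<psi> t = g t" for t by (rule DERIV_imp_deriv[OF D])
  qed
qed

text \<open>The map \<open>\<tau>\<close> is left general because the limit is taken both in the
  plane, with x . x, and on the line, with the identity.\<close>

lemma integral_bump_LIMSEQ:
  fixes g :: "'a \<Rightarrow> real"
  assumes g: "integrable M g" and [measurable]: "\<tau> \<in> borel_measurable M" and "a \<le> b"
  shows "(\<lambda>n. LINT x|M. bump n a b (\<tau> x) * g x) \<longlonglongrightarrow> (LINT x|M. indicator {a<..<b} (\<tau> x) * g x)"
proof (rule integral_dominated_convergence[where w = "\<lambda>x. norm (g x)"])
  have [measurable]: "g \<in> borel_measurable M" using g by simp
  have [measurable]: "bump n a b \<in> borel_measurable borel" for n
    by (rule borel_measurable_continuous_onI[OF continuous_bump])
  show "(\<lambda>x. indicator {a<..<b} (\<tau> x) * g x) \<in> borel_measurable M" by measurable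
  show "(\<lambda>x. bump n a b (\<tau> x) * g x) \<in> borel_measurable M" for n by measurable
  show "integrable M (\<lambda>x. norm (g x))" using g by simp
  show "AE x in M. (\<lambda>n. bump n a b (\<tau> x) * g x) \<longlonglongrightarrow> indicator {a<..<b} (\<tau> x) * g x"
    by (intro AE_I2 tendsto_intros bump_tendsto_indicator assms)
  show "AE x in M. norm (bump n a b (\<tau> x) * g x) \<le> norm (g x)" for n
    by (intro AE_I2) (auto simp: abs_mult bump_nonneg bump_le_1 intro!: mult_left_le_one_le)
qed

lemma integral_bump_Icc_LIMSEQ:
  assumes lr: "l \<le> a" "a \<le> b" "b \<le> r" and K: "continuous_on {l..r} K"
  shows "(\<lambda>n. integral {l..r} (\<lambda>t. bump n a b t * K t)) \<longlonglongrightarrow> integral {a..b} K"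
proof -
  have iK: "set_integrable lborel {l..r} K"
    using K by (rule borel_integrable_compact[OF compact_Icc, folded set_integrable_def])
  have "(\<lambda>n. LINT t|lborel. bump n a b t * (indicator {l..r} t * K t))
    \<longlonglongrightarrow> (LINT t|lborel. indicator {a<..<b} t * (indicator {l..r} t * K t))"
    using iK lr by (intro integral_bump_LIMSEQ) (simp_all add: set_integrable_def)
  moreover have "(LINT t|lborel. bump n a b t * (indicator {l..r} t * K t)) = integral {l..r} (\<lambda>t. bump n a b t * K t)" for n
  proof -
    have "(LINT t|lborel. bump n a b t * (indicator {l..r} t * K t)) = (LINT t:{l..r}|lborel. bump n a b t * K t)"
      by (simp add: set_lebesgue_integral_def mult_ac)
    also have "\<dots> = integral {l..r} (\<lambda>t. bump n a b t * K t)"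
      by (intro set_borel_integral_eq_integral borel_integrable_compact[folded set_integrable_def]
          continuous_intros continuous_bump K compact_Icc)
    finally show ?thesis .
  qed
  moreover have "(LINT t|lborel. indicator {a<..<b} t * (indicator {l..r} t * K t)) = integral {a..b} K"
  proof -
    have "indicator {a<..<b} t * (indicator {l..r} t * K t) = indicator {a<..<b} t *\<^sub>R K t" for t
      using lr by (auto split: split_indicator)
    then have "(LINT t|lborel. indicator {a<..<b} t * (indicator {l..r} t * K t)) = (LINT t:{a<..<b}|lborel. K t)"
      unfolding set_lebesgue_integral_def by presburger
    also have "\<dots> = integral {a<..<b} K"
      by (intro set_borel_integral_eq_integral set_integrable_subset[OF iK]) (use lr in auto)
    also have "\<dots> = integral {a..b} K" by (simp add: integral_open_interval_real)
    finally show ?thesis .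
  qed
  ultimately show ?thesis by simp
qed

text \<open>The derivative of the test function is chosen as a difference of two bumps with the same
  integral; letting the bumps converge to indicators shows that the mean value over \<open>(a, b)\<close> of the
  push-forward of \<open>f dx\<close> minus \<open>K dt\<close> is the same for all intervals.\<close>

lemma annulus_du_Bois_Reymond:
  assumes f: "annularly_integrable f" and K: "continuous_on {0<..} K"
    and eq: "\<And>\<psi> a b. smooth_real \<psi> \<Longrightarrow> 0 < a \<Longrightarrow> a < b \<Longrightarrow> (\<And>t. t \<notin> {a..b} \<Longrightarrow> \<psi> t = 0) \<Longrightarrow>
      (LINT x:annulus a b|lebesgue. deriv \<psi> (x \<bullet> x) * f x) = integral {a..b} (\<lambda>t. deriv \<psi> t * K t)"
  obtains c where "\<And>a b. 0 < a \<Longrightarrow> a < b \<Longrightarrow>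
    (LINT x:annulus a b|lebesgue. f x) = integral {a..b} (\<lambda>t. K t + c)"
proof -
  define D where "D = (\<lambda>a b. (LINT x:annulus a b|lebesgue. f x) - integral {a..b} K)"
  have KI: "continuous_on {a..b} K" if "0 < a" for a b
    by (rule continuous_on_subset[OF K]) (use that in auto)
  \<comment> \<open>Every interval is compared with the reference interval (1, 2) of length 1. The
    interval [l, r] contains both, so that both bumps live on one annulus.\<close>
  have main: "D a b = D 1 2 * (b - a)" if ab: "0 < a" "a < b" for a b
  proof -
    define l where "l = min a 1"
    define r where "r = max b 2"
    have lr: "0 < l" "l < r" "l \<le> a" "b \<le> r" "l \<le> 1" "2 \<le> r" using ab by (auto simp: l_def r_def)
    have ifl: "set_integrable lebesgue (annulus l r) f" using f lr by (simp add: annularly_integrable_def)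
    define J where "J = (\<lambda>n c d. integral {l..r} (bump n c d))"
    define E where "E = (\<lambda>n c d. (LINT x:annulus l r|lebesgue. bump n c d (x \<bullet> x) * f x)
      - integral {l..r} (\<lambda>t. bump n c d t * K t))"
    have JL: "(\<lambda>n. J n c d) \<longlonglongrightarrow> d - c" if "l \<le> c" "c \<le> d" "d \<le> r" for c d
      using integral_bump_Icc_LIMSEQ[OF that, of "\<lambda>_. 1"] that by (simp add: J_def)
    have EL: "(\<lambda>n. E n c d) \<longlonglongrightarrow> D c d" if "l \<le> c" "c \<le> d" "d \<le> r" for c d
    proof -
      have "(\<lambda>n. LINT x|lebesgue. bump n c d (x \<bullet> x) * (indicator (annulus l r) x * f x))
        \<longlonglongrightarrow> (LINT x|lebesgue. indicator {c<..<d} (x \<bullet> x) * (indicator (annulus l r) x * f x))"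
        using ifl that by (intro integral_bump_LIMSEQ measurable_inner_self) (simp_all add: set_integrable_def)
      moreover have "(LINT x|lebesgue. indicator {c<..<d} (x \<bullet> x) * (indicator (annulus l r) x * f x))
        = (LINT x|lebesgue. indicator (annulus c d) x * f x)"
      proof (rule integral_cong_AE)
        have "(\<lambda>x. indicator (annulus l r) x * f x) \<in> borel_measurable lebesgue"
          using ifl by (auto simp: set_integrable_def)
        then show "(\<lambda>x. indicator {c<..<d} (x \<bullet> x) * (indicator (annulus l r) x * f x)) \<in> borel_measurable lebesgue"
          by measurable
        have "0 < c" using that lr by simp
        then show "(\<lambda>x. indicator (annulus c d) x * f x) \<in> borel_measurable lebesgue"
          using f by (auto simp: annularly_integrable_def set_integrable_def)
        show "AE x in lebesgue. indicator {c<..<d} (x \<bullet> x) * (indicator (annulus l r) x * f x)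
          = indicator (annulus c d) x * f x"
          by (rule eventually_mono[OF AE_not_in[OF circle_null[of d]]])
            (use that in \<open>auto simp: annulus_def split: split_indicator\<close>)
      qed
      ultimately have "(\<lambda>n. LINT x:annulus l r|lebesgue. bump n c d (x \<bullet> x) * f x)
        \<longlonglongrightarrow> (LINT x:annulus c d|lebesgue. f x)"
        by (simp add: set_lebesgue_integral_def mult_ac)
      then show ?thesis unfolding E_def D_def
        by (intro tendsto_diff integral_bump_Icc_LIMSEQ that KI lr)
    qed
    have "J n 1 2 * E n a b = J n a b * E n 1 2" for n
    proof -
      define g where "g = (\<lambda>t. J n 1 2 * bump n a b t + (- J n a b) * bump n 1 2 t)"
      have sg: "smooth_real g" unfolding g_def by (intro smooth_real_lincomb smooth_bump)
      have supp: "g t = 0" if "t \<notin> {l..r}" for t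
        using that lr ab bump_outside[of a b t n] bump_outside[of 1 2 t n] by (auto simp: g_def)
      have int_g: "integral {l..r} g = 0"
      proof -
        have "integral {l..r} g = integral {l..r} (\<lambda>t. J n 1 2 * bump n a b t)
            + integral {l..r} (\<lambda>t. (- J n a b) * bump n 1 2 t)"
          unfolding g_def
          by (intro integral_add integrable_continuous_real continuous_intros continuous_bump)
        then show ?thesis by (simp add: J_def)
      qed
      obtain \<psi> where \<psi>: "smooth_real \<psi>" "\<And>t. t \<notin> {l..r} \<Longrightarrow> \<psi> t = 0" "\<And>t. deriv \<psi> t = g t"
        using smooth_real_compact_antiderivative[OF sg lr(1) _ supp int_g] lr(2) by auto
      have "(LINT x:annulus l r|lebesgue. g (x \<bullet> x) * f x) = integral {l..r} (\<lambda>t. g t * K t)"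
        using eq[OF \<psi>(1) lr(1,2) \<psi>(2)] by (simp add: \<psi>(3))
      moreover have "(LINT x:annulus l r|lebesgue. g (x \<bullet> x) * f x)
        = J n 1 2 * (LINT x:annulus l r|lebesgue. bump n a b (x \<bullet> x) * f x)
          - J n a b * (LINT x:annulus l r|lebesgue. bump n 1 2 (x \<bullet> x) * f x)"
      proof -
        have "(LINT x:annulus l r|lebesgue. g (x \<bullet> x) * f x)
          = (LINT x:annulus l r|lebesgue. J n 1 2 * (bump n a b (x \<bullet> x) * f x) - J n a b * (bump n 1 2 (x \<bullet> x) * f x))"
          by (simp add: g_def algebra_simps)
        then show ?thesis
          by (simp add: set_integral_diff annulus_mult_integrable[OF ifl continuous_bump])
      qed
      moreover have "integral {l..r} (\<lambda>t. g t * K t)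
        = J n 1 2 * integral {l..r} (\<lambda>t. bump n a b t * K t) - J n a b * integral {l..r} (\<lambda>t. bump n 1 2 t * K t)"
      proof -
        have "integral {l..r} (\<lambda>t. g t * K t)
          = integral {l..r} (\<lambda>t. J n 1 2 * (bump n a b t * K t) - J n a b * (bump n 1 2 t * K t))"
          by (simp add: g_def algebra_simps)
        also have "\<dots> = integral {l..r} (\<lambda>t. J n 1 2 * (bump n a b t * K t)) - integral {l..r} (\<lambda>t. J n a b * (bump n 1 2 t * K t))"
          by (intro integral_diff integrable_continuous_real continuous_intros continuous_bump KI lr)
        finally show ?thesis by simp
      qed
      ultimately show ?thesis by (simp add: E_def algebra_simps)
    qed
    moreover have "(\<lambda>n. J n 1 2 * E n a b) \<longlonglongrightarrow> (2 - 1) * D a b"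
      using lr ab by (intro tendsto_mult JL EL) auto
    moreover have "(\<lambda>n. J n a b * E n 1 2) \<longlonglongrightarrow> (b - a) * D 1 2"
      using lr ab by (intro tendsto_mult JL EL) auto
    ultimately show ?thesis
      using LIMSEQ_unique[of "\<lambda>n. J n 1 2 * E n a b"] by (simp add: mult.commute)
  qed
  show ?thesis
  proof (rule that[of "D 1 2"])
    fix a b :: real assume ab: "0 < a" "a < b"
    have "integral {a..b} (\<lambda>t. K t + D 1 2) = integral {a..b} K + D 1 2 * (b - a)"
      using ab by (subst integral_add) (auto intro!: integrable_continuous_real KI)
    then show "(LINT x:annulus a b|lebesgue. f x) = integral {a..b} (\<lambda>t. K t + D 1 2)"
      using main[OF ab] by (simp add: D_def)
  qed
qed

text \<open>The set where \<open>d > 0\<close> is, up to a null set, a union of compact sets whose rotational saturations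
  stay inside it, and \<open>d\<close> integrates to \<open>0\<close> over each saturation. This way the measurability
  of the radial profile of \<open>d\<close> is not needed.\<close>

lemma radial_zero_aux:
  assumes d: "annularly_integrable d" "radial d"
    and 0: "\<And>a b. 0 < a \<Longrightarrow> a < b \<Longrightarrow> (LINT x:annulus a b|lebesgue. d x) = 0"
    and ab: "0 < a" "a < b"
  shows "{x \<in> annulus a b. d x > 0} \<in> null_sets lebesgue"
proof -
  define P where "P = {x \<in> annulus a b. d x > 0}"
  have id: "integrable lebesgue (\<lambda>x. indicator (annulus a b) x *\<^sub>R d x)"
    using d(1) ab by (simp add: annularly_integrable_def set_integrable_def)
  then have [measurable]: "(\<lambda>x. indicator (annulus a b) x *\<^sub>R d x) \<in> borel_measurable lebesgue" by simp
  have "P = {x. indicator (annulus a b) x *\<^sub>R d x > 0}"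
    by (auto simp: P_def split: split_indicator)
  moreover have "{x \<in> space lebesgue. indicator (annulus a b) x *\<^sub>R d x > 0} \<in> sets lebesgue" by measurable
  ultimately have "P \<in> sets lebesgue" by simp
  then obtain C T where CT: "fsigma C" "T \<in> null_sets lebesgue" "C \<union> T = P"
    using lebesgue_set_almost_fsigma by metis
  obtain F :: "nat \<Rightarrow> R2 set" where F: "range F \<subseteq> Collect compact" "C = \<Union>(F ` UNIV)"
    using iffD1[OF fsigma_Union_compact CT(1)] by metis
  have null: "F i \<in> null_sets lebesgue" for i
  \<comment> \<open>\<open>infdist\<close> to the empty set is 0 by convention, so the cut-offs
    below would not tend to the indicator for an empty piece.\<close>
  proof (cases "F i = {}")
    case False
    define C' where "C' = (\<lambda>x::R2. x \<bullet> x) ` F i"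
    have "compact C'"
      unfolding C'_def using F(1) by (intro compact_continuous_image continuous_intros) auto
    then have cl: "closed C'" by (rule compact_imp_closed)
    have ne: "C' \<noteq> {}" using False by (simp add: C'_def)
    \<comment> \<open>Continuous functions decreasing to the indicator of the closed set
      \<open>C'\<close>: being continuous they are admissible weights in
      \<open>annulus_orthogonal\<close>, and the indicator is reached by dominated
      convergence.\<close>
    define \<theta> where "\<theta> = (\<lambda>(n::nat) t. max 0 (1 - real n * infdist t C'))"
    have c\<theta>: "continuous_on A (\<theta> n)" for n A
      unfolding \<theta>_def by (intro continuous_intros)
    have lim: "(\<lambda>n. \<theta> n t) \<longlonglongrightarrow> indicator C' t" for t
    proof (cases "t \<in> C'")
      case True
      then show ?thesis by (simp add: \<theta>_def)
    next
      case False
      then have pos: "infdist t C' > 0"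
        using in_closed_iff_infdist_zero[OF cl ne, of t] infdist_nonneg[of t C'] by linarith
      obtain N :: nat where N: "1 / infdist t C' \<le> N" using real_arch_simple by blast
      have "\<theta> n t = 0" if "n \<ge> N" for n
      proof -
        have "1 / infdist t C' \<le> n" using N that by linarith
        then show ?thesis using pos by (simp add: \<theta>_def field_simps)
      qed
      then have "\<forall>\<^sub>F n in sequentially. 0 = \<theta> n t" by (auto simp: eventually_sequentially)
      then show ?thesis using False by (auto intro: Lim_transform_eventually[OF tendsto_const])
    qed
    let ?d = "\<lambda>x. indicator (annulus a b) x *\<^sub>R d x"
    have "C' \<in> sets borel" using cl by simp
    then have [measurable]: "{x::R2. x \<bullet> x \<in> C'} \<in> sets lebesgue"
      using measurable_sets[OF measurable_inner_self] by (simp add: vimage_def)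
    have mC: "(\<lambda>x::R2. indicator C' (x \<bullet> x) * ?d x) \<in> borel_measurable lebesgue"
      using \<open>C' \<in> sets borel\<close> by measurable
    have [measurable]: "\<theta> n \<in> borel_measurable borel" for n
      by (rule borel_measurable_continuous_onI[OF c\<theta>])
    have "(\<lambda>n. LINT x|lebesgue. \<theta> n (x \<bullet> x) * ?d x) \<longlonglongrightarrow> (LINT x|lebesgue. indicator C' (x \<bullet> x) * ?d x)"
    proof (rule integral_dominated_convergence[where w = "\<lambda>x. norm (?d x)"])
      show "integrable lebesgue (\<lambda>x. norm (?d x))" using id by simp
      show "AE x in lebesgue. (\<lambda>n. \<theta> n (x \<bullet> x) * ?d x) \<longlonglongrightarrow> indicator C' (x \<bullet> x) * ?d x"
        by (intro AE_I2 tendsto_mult lim tendsto_const)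
      have "0 \<le> \<theta> n t" "\<theta> n t \<le> 1" for n t
        by (auto simp: \<theta>_def infdist_nonneg)
      then show "AE x in lebesgue. norm (\<theta> n (x \<bullet> x) * ?d x) \<le> norm (?d x)" for n
        by (intro AE_I2) (auto simp: abs_mult intro!: mult_left_le_one_le)
      show "(\<lambda>x. \<theta> n (x \<bullet> x) * ?d x) \<in> borel_measurable lebesgue" for n by measurable
    qed (rule mC)
    moreover have "(LINT x|lebesgue. \<theta> n (x \<bullet> x) * ?d x) = 0" for n
      using annulus_orthogonal[OF d(1) 0 ab(1) _ c\<theta>, of b n] ab
      by (simp add: set_lebesgue_integral_def mult_ac)
    ultimately have I0: "(LINT x|lebesgue. indicator C' (x \<bullet> x) * ?d x) = 0"
      by (simp only: LIMSEQ_const_iff)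
    have rad: "x \<in> annulus a b \<and> d x > 0" if xC: "x \<bullet> x \<in> C'" for x
    proof -
      obtain y where y: "y \<in> F i" "y \<bullet> y = x \<bullet> x" using xC by (auto simp: C'_def)
      have "y \<in> P" using y(1) F(2) CT(3) by blast
      then have P: "a < y \<bullet> y" "y \<bullet> y \<le> b" "d y > 0" by (auto simp: P_def annulus_def)
      have "norm x = norm y" by (simp add: norm_eq_sqrt_inner y(2))
      with d(2) have "d x = d y" unfolding radial_def by blast
      with P show ?thesis by (simp add: annulus_def y(2))
    qed
    have iC: "integrable lebesgue (\<lambda>x. indicator C' (x \<bullet> x) * ?d x)"
      by (rule Bochner_Integration.integrable_bound[OF id mC])
        (auto split: split_indicator)
    have "0 \<le> indicator C' (x \<bullet> x) * ?d x" for x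
      using rad[of x] by (cases "x \<bullet> x \<in> C'") (simp_all add: less_imp_le)
    then have "AE x in lebesgue. indicator C' (x \<bullet> x) * ?d x = 0"
      by (intro integral_nonneg_eq_0_iff_AE[OF iC, THEN iffD1, OF _ I0] AE_I2)
    then have "AE x in lebesgue. x \<notin> F i"
    proof (rule eventually_mono)
      fix x assume x: "indicator C' (x \<bullet> x) * ?d x = 0"
      show "x \<notin> F i"
      proof
        assume "x \<in> F i"
        then have "x \<bullet> x \<in> C'" by (auto simp: C'_def)
        then show False using rad[of x] x by simp
      qed
    qed
    moreover have "F i \<in> sets lebesgue" using F(1) by (intro lmeasurable_compact[THEN fmeasurableD]) auto
    ultimately show ?thesis by (simp add: AE_iff_null_sets)
  qed simp
  have "C \<in> null_sets lebesgue" unfolding F(2) by (intro null_sets_UN null)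
  then show ?thesis using CT(2,3) null_sets.Un unfolding P_def by metis
qed

lemma radial_zero:
  assumes d: "annularly_integrable d" "radial d"
    and 0: "\<And>a b. 0 < a \<Longrightarrow> a < b \<Longrightarrow> (LINT x:annulus a b|lebesgue. d x) = 0"
  shows "{x. x \<bullet> x > 0 \<and> d x \<noteq> 0} \<in> null_sets lebesgue"
proof -
  have m1: "annularly_integrable (\<lambda>x. - d x)"
    using d(1) by (simp add: annularly_integrable_def set_integrable_def)
  have m2: "radial (\<lambda>x. - d x)"
    using d(2) unfolding radial_def by metis
  have m3: "(LINT x:annulus a b|lebesgue. - d x) = 0" if "0 < a" "a < b" for a b
    using 0[OF that] by (simp add: set_lebesgue_integral_def)
  \<comment> \<open>These annuli exhaust the punctured plane. The additional \<open>Suc\<close> in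
    the inner bound keeps it strictly below the outer one already for n = 0.\<close>
  have "{x \<in> annulus (1 / Suc (Suc n)) (Suc n). d x > 0} \<in> null_sets lebesgue"
    "{x \<in> annulus (1 / Suc (Suc n)) (Suc n). - d x > 0} \<in> null_sets lebesgue" for n
  proof -
    have "1 / real (Suc (Suc n)) < 1" by simp
    also have "1 \<le> real (Suc n)" by simp
    finally have *: "1 / real (Suc (Suc n)) < real (Suc n)" .
    show "{x \<in> annulus (1 / Suc (Suc n)) (Suc n). d x > 0} \<in> null_sets lebesgue"
      by (rule radial_zero_aux[OF assms _ *]) simp_all
    show "{x \<in> annulus (1 / Suc (Suc n)) (Suc n). - d x > 0} \<in> null_sets lebesgue"
      by (rule radial_zero_aux[OF m1 m2 m3 _ *]) simp_all
  qed
  then have "(\<Union>n. {x \<in> annulus (1 / Suc (Suc n)) (Suc n). d x > 0}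
    \<union> {x \<in> annulus (1 / Suc (Suc n)) (Suc n). - d x > 0}) \<in> null_sets lebesgue" (is "?U \<in> _")
    by (intro null_sets_UN null_sets.Un)
  moreover have "{x. x \<bullet> x > 0 \<and> d x \<noteq> 0} \<subseteq> ?U"
  proof
    fix x :: R2 assume x: "x \<in> {x. x \<bullet> x > 0 \<and> d x \<noteq> 0}"
    obtain n where n: "max (x \<bullet> x) (1 / (x \<bullet> x)) \<le> real n" using real_arch_simple by blast
    then have "1 / (x \<bullet> x) < real (Suc (Suc n))" by simp
    then have "1 / real (Suc (Suc n)) < x \<bullet> x" using x by (simp add: field_simps)
    then have "x \<in> annulus (1 / Suc (Suc n)) (Suc n)" using n by (auto simp: annulus_def)
    then show "x \<in> ?U" using x by (cases "d x > 0") auto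
  qed
  ultimately show ?thesis
    unfolding negligible_iff_null_sets[symmetric] by (rule negligible_subset)
qed

section \<open>Weak gradients of radial functions\<close>

lemma annularly_integrable_continuous_mult:
  fixes h :: "R2 \<Rightarrow> real"
  assumes f: "annularly_integrable f" and h: "continuous_on UNIV h"
  shows "annularly_integrable (\<lambda>x. h x * f x)"
  unfolding annularly_integrable_def
proof (intro allI impI)
  fix a b :: real assume a: "0 < a"
  have [measurable]: "h \<in> borel_measurable lebesgue"
    by (rule measurable_completion) (simp add: borel_measurable_continuous_onI[OF h])
  have "compact (h ` cball 0 (sqrt b))"
    by (intro compact_continuous_image continuous_on_subset[OF h]) auto
  from compact_imp_bounded[OF this] obtain M where M: "\<And>x. x \<in> cball 0 (sqrt b) \<Longrightarrow> \<bar>h x\<bar> \<le> M"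
    unfolding bounded_iff by (metis imageI real_norm_def)
  define F where "F = (\<lambda>x. indicator (annulus a b) x *\<^sub>R f x)"
  have iF: "integrable lebesgue F" using f a by (simp add: F_def set_integrable_def annularly_integrable_def)
  then have [measurable]: "F \<in> borel_measurable lebesgue" by simp
  have eq: "indicator (annulus a b) x *\<^sub>R (h x * f x) = h x * F x" for x
    by (auto simp: F_def split: split_indicator)
  have "integrable lebesgue (\<lambda>x. h x * F x)"
  proof (rule Bochner_Integration.integrable_bound)
    show "integrable lebesgue (\<lambda>x. M * F x)" using iF by simp
    show "AE x in lebesgue. norm (h x * F x) \<le> norm (M * F x)"
    proof (rule AE_I2)
      fix x :: R2
      have "\<bar>h x\<bar> \<le> \<bar>M\<bar>" if "F x \<noteq> 0"
      proof -
        have "x \<in> annulus a b" using that by (auto simp: F_def indicator_def split: if_splits)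
        then have "x \<in> cball 0 (sqrt b)" by (simp add: annulus_def norm_eq_sqrt_inner)
        then show ?thesis using M[of x] by simp
      qed
      then show "norm (h x * F x) \<le> norm (M * F x)"
        by (cases "F x = 0") (auto simp: abs_mult intro!: mult_right_mono)
    qed
  qed measurable
  then show "set_integrable lebesgue (annulus a b) (\<lambda>x. h x * f x)" unfolding set_integrable_def eq .
qed

lemma annularly_integrable_add:
  "annularly_integrable f \<Longrightarrow> annularly_integrable g \<Longrightarrow> annularly_integrable (\<lambda>x. f x + g x)"
  unfolding annularly_integrable_def by (intro allI impI set_integral_add(1)) blast+

lemma annularly_integrable_diff:
  "annularly_integrable f \<Longrightarrow> annularly_integrable g \<Longrightarrow> annularly_integrable (\<lambda>x. f x - g x)"
  unfolding annularly_integrable_def by (intro allI impI set_integral_diff(1)) blast+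

lemma annularly_integrable_cmult:
  "annularly_integrable f \<Longrightarrow> annularly_integrable (\<lambda>x. c * f x)"
  unfolding annularly_integrable_def by (intro allI impI set_integrable_mult_right) blast

lemma annularly_integrable_radial:
  assumes "continuous_on {0<..} F"
  shows "annularly_integrable (\<lambda>x. F (x \<bullet> x))"
  unfolding annularly_integrable_def
proof (intro allI impI)
  fix a b :: real assume a: "0 < a"
  show "set_integrable lebesgue (annulus a b) (\<lambda>x. F (x \<bullet> x))"
  proof (cases "a \<le> b")
    case True
    then show ?thesis using a
      by (intro annulus_integral_radial continuous_on_subset[OF assms]) auto
  next
    case False
    then have "annulus a b = {}" by (auto simp: annulus_def)
    then show ?thesis by simp
  qed
qed

lemma annularly_integrable_radial_mult:
  assumes "annularly_integrable f" "continuous_on {0<..} F"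
  shows "annularly_integrable (\<lambda>x. F (x \<bullet> x) * f x)"
  unfolding annularly_integrable_def
proof (intro allI impI)
  fix a b :: real assume a: "0 < a"
  then show "set_integrable lebesgue (annulus a b) (\<lambda>x. F (x \<bullet> x) * f x)"
    using assms by (intro annulus_mult_integrable continuous_on_subset[OF assms(2)])
      (auto simp: annularly_integrable_def)
qed

lemma locally_integrable_annulus:
  assumes "locally_integrable f"
  shows "set_integrable lebesgue (annulus a b) f"
proof (rule set_integrable_subset)
  show "set_integrable lebesgue (cball 0 (sqrt b)) f"
    using assms by (simp add: locally_integrable_def)
  show "annulus a b \<subseteq> cball 0 (sqrt b)" by (auto simp: annulus_def norm_eq_sqrt_inner)
qed simp

lemma locally_integrable_imp_annularly_integrable:
  "locally_integrable f \<Longrightarrow> annularly_integrable f"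
  unfolding annularly_integrable_def by (intro allI impI locally_integrable_annulus)

lemma locally_integrable_component:
  fixes g :: "R2 \<Rightarrow> R2"
  assumes "locally_integrable g"
  shows "annularly_integrable (\<lambda>x. g x $ i)"
  unfolding annularly_integrable_def
proof (intro allI impI)
  fix a b :: real
  have "integrable lebesgue (\<lambda>x. indicator (annulus a b) x *\<^sub>R g x)"
    using locally_integrable_annulus[OF assms] by (simp add: set_integrable_def)
  then have "integrable lebesgue (\<lambda>x. (indicator (annulus a b) x *\<^sub>R g x) \<bullet> axis i 1)"
    by (rule integrable_inner_left)
  then show "set_integrable lebesgue (annulus a b) (\<lambda>x. g x $ i)"
    by (simp add: set_integrable_def inner_axis)
qed

lemma inner_R2: "(x :: R2) \<bullet> y = x $ 1 * y $ 1 + x $ 2 * y $ 2"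
  by (simp add: inner_vec_def sum_2)

lemma locally_integrable_radial_part:
  fixes g :: "R2 \<Rightarrow> R2"
  assumes "locally_integrable g"
  shows "annularly_integrable (\<lambda>x. g x \<bullet> x)"
proof -
  have "annularly_integrable (\<lambda>x. x $ i * g x $ i)" for i
    by (intro annularly_integrable_continuous_mult locally_integrable_component assms continuous_intros)
  from annularly_integrable_add[OF this[of 1] this[of 2]] show ?thesis
    by (simp add: inner_R2 mult.commute)
qed

lemma continuous_zero_at_ends:
  fixes f :: "real \<Rightarrow> real"
  assumes f: "continuous_on UNIV f" and ab: "a < b" and 0: "\<And>t. t \<notin> {a..b} \<Longrightarrow> f t = 0"
  shows "t \<notin> {a<..<b} \<Longrightarrow> f t = 0"
proof -
  have cl: "closed {t. f t = 0}" using f by (intro closed_Collect_eq) auto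
  have "{..<a} \<subseteq> {t. f t = 0}" "{b<..} \<subseteq> {t. f t = 0}" using 0 by auto
  from this[THEN closure_minimal, OF cl]
  have "{..a} \<subseteq> {t. f t = 0}" "{b..} \<subseteq> {t. f t = 0}" by simp_all
  moreover assume "t \<notin> {a<..<b}"
  then have "t \<in> {..a} \<or> t \<in> {b..}" by auto
  ultimately show "f t = 0" by blast
qed

text \<open>Vanishing at the endpoints too is what identifies plane integrals with integrals over
  the half-open annulus, and what removes the boundary terms in
  \<open>annulus_by_parts_compact\<close>.\<close>

lemma smooth_real_support:
  assumes \<psi>: "smooth_real \<psi>" and ab: "a < b" and 0: "\<And>t. t \<notin> {a..b} \<Longrightarrow> \<psi> t = 0"
  shows "t \<notin> {a<..<b} \<Longrightarrow> \<psi> t = 0" "t \<notin> {a<..<b} \<Longrightarrow> deriv \<psi> t = 0"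
proof -
  show "t \<notin> {a<..<b} \<Longrightarrow> \<psi> t = 0"
    by (rule continuous_zero_at_ends[OF smooth_real_continuous[OF \<psi>] ab 0])
  have "deriv \<psi> t = 0" if t: "t \<notin> {a..b}" for t
  proof -
    have "open (- {a..b})" by auto
    then have "((\<lambda>_. 0) has_real_derivative deriv \<psi> t) (at t)"
      using t 0 by (intro has_field_derivative_transform_within_open[OF smooth_real_DERIV[OF \<psi>]]) auto
    then show ?thesis using DERIV_unique DERIV_const by blast
  qed
  then show "t \<notin> {a<..<b} \<Longrightarrow> deriv \<psi> t = 0"
    by (rule continuous_zero_at_ends[OF smooth_real_continuous[OF smooth_real_deriv[OF \<psi>]] ab])
qed

lemma integral_eq_annulus:
  fixes h :: "R2 \<Rightarrow> real"
  assumes "\<And>x. x \<bullet> x \<notin> {a<..<b} \<Longrightarrow> h x = 0"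
  shows "(LINT x|lebesgue. h x) = (LINT x:annulus a b|lebesgue. h x)"
  unfolding set_lebesgue_integral_def
proof (intro Bochner_Integration.integral_cong refl)
  show "h x = indicator (annulus a b) x *\<^sub>R h x" for x
    using assms[of x] by (cases "x \<in> annulus a b") (auto simp: annulus_def)
qed

text \<open>Component i of the gradient is tested with x_i \<psi>(x . x) and the two identities are
  added. The sum of the partial derivatives is the divergence of \<psi>(x . x) x, that is 2 \<psi> +
  2 (x . x) \<psi>'.\<close>

lemma weak_gradient_radial_test:
  assumes w: "has_weak_gradient u g" and \<psi>: "smooth_real \<psi>" and ab: "0 < a" "a < b"
    and supp: "\<And>t. t \<notin> {a..b} \<Longrightarrow> \<psi> t = 0"
  shows "(LINT x:annulus a b|lebesgue. deriv \<psi> (x \<bullet> x) * (2 * (x \<bullet> x) * u x))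
    = - (LINT x:annulus a b|lebesgue. \<psi> (x \<bullet> x) * (g x \<bullet> x)) - (LINT x:annulus a b|lebesgue. \<psi> (x \<bullet> x) * (2 * u x))"
proof -
  note z = smooth_real_support[OF \<psi> ab(2) supp]
  have u: "annularly_integrable u" and g: "annularly_integrable (\<lambda>x. g x $ i)" for i
    using w by (auto simp: has_weak_gradient_def locally_integrable_component
        locally_integrable_imp_annularly_integrable)
  note c\<psi> = smooth_real_continuous[OF \<psi>] smooth_real_continuous[OF smooth_real_deriv[OF \<psi>]]
  have c2: "continuous_on {a..b} \<psi>" "continuous_on {a..b} (deriv \<psi>)" by (intro c\<psi>)+
  have tst: "(LINT x:annulus a b|lebesgue. \<psi> (x \<bullet> x) * u x + deriv \<psi> (x \<bullet> x) * ((2 * (x $ i)\<^sup>2) * u x))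
    = - (LINT x:annulus a b|lebesgue. \<psi> (x \<bullet> x) * (x $ i * g x $ i))" for i
  proof -
    have "annular_profile \<psi>" using \<psi> ab supp unfolding annular_profile_def by blast
    from test_function_radial_component[OF this, of i]
    have "(LINT x|lebesgue. u x * partial_deriv i (\<lambda>x. x $ i * \<psi> (x \<bullet> x)) x)
      = - (LINT x|lebesgue. g x $ i * (x $ i * \<psi> (x \<bullet> x)))"
      using w by (auto simp: has_weak_gradient_def)
    moreover have "(LINT x|lebesgue. u x * partial_deriv i (\<lambda>x. x $ i * \<psi> (x \<bullet> x)) x)
      = (LINT x:annulus a b|lebesgue. u x * partial_deriv i (\<lambda>x. x $ i * \<psi> (x \<bullet> x)) x)"
      using z by (intro integral_eq_annulus) (simp only: partial_deriv_radial_component[OF \<psi>], simp)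
    moreover have "(LINT x|lebesgue. g x $ i * (x $ i * \<psi> (x \<bullet> x)))
      = (LINT x:annulus a b|lebesgue. g x $ i * (x $ i * \<psi> (x \<bullet> x)))"
      using z by (intro integral_eq_annulus) simp
    ultimately show ?thesis
      by (simp add: partial_deriv_radial_component[OF \<psi>] algebra_simps)
  qed
  have mi: "set_integrable lebesgue (annulus a b) (\<lambda>x. \<theta> (x \<bullet> x) * f x)"
    if "annularly_integrable f" "continuous_on {a..b} \<theta>" for f \<theta>
    using that ab by (intro annulus_mult_integrable) (auto simp: annularly_integrable_def)
  have ui: "annularly_integrable (\<lambda>x. (2 * (x $ i)\<^sup>2) * u x)" for i
    by (intro annularly_integrable_continuous_mult u continuous_intros)
  have gi: "annularly_integrable (\<lambda>x. x $ i * g x $ i)" for i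
    by (intro annularly_integrable_continuous_mult g continuous_intros)
  have "(LINT x:annulus a b|lebesgue. \<psi> (x \<bullet> x) * (g x \<bullet> x))
    = (LINT x:annulus a b|lebesgue. \<psi> (x \<bullet> x) * (x $ 1 * g x $ 1) + \<psi> (x \<bullet> x) * (x $ 2 * g x $ 2))"
    by (simp add: inner_R2 algebra_simps)
  also have "\<dots> = (LINT x:annulus a b|lebesgue. \<psi> (x \<bullet> x) * (x $ 1 * g x $ 1))
      + (LINT x:annulus a b|lebesgue. \<psi> (x \<bullet> x) * (x $ 2 * g x $ 2))"
    by (intro set_integral_add mi gi c2)
  finally have G: "(LINT x:annulus a b|lebesgue. \<psi> (x \<bullet> x) * (g x \<bullet> x)) = \<dots>" .
  have U: "(LINT x:annulus a b|lebesgue. \<psi> (x \<bullet> x) * u x + deriv \<psi> (x \<bullet> x) * ((2 * (x $ i)\<^sup>2) * u x))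
    = (LINT x:annulus a b|lebesgue. \<psi> (x \<bullet> x) * u x)
      + (LINT x:annulus a b|lebesgue. deriv \<psi> (x \<bullet> x) * ((2 * (x $ i)\<^sup>2) * u x))" for i
    by (intro set_integral_add mi u ui c2)
  have "(LINT x:annulus a b|lebesgue. deriv \<psi> (x \<bullet> x) * (2 * (x \<bullet> x) * u x))
    = (LINT x:annulus a b|lebesgue. deriv \<psi> (x \<bullet> x) * ((2 * (x $ 1)\<^sup>2) * u x) + deriv \<psi> (x \<bullet> x) * ((2 * (x $ 2)\<^sup>2) * u x))"
  proof -
    have "deriv \<psi> (x \<bullet> x) * (2 * (x \<bullet> x) * u x)
      = deriv \<psi> (x \<bullet> x) * ((2 * (x $ 1)\<^sup>2) * u x) + deriv \<psi> (x \<bullet> x) * ((2 * (x $ 2)\<^sup>2) * u x)" for x :: R2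
    proof -
      have "x \<bullet> x = (x $ 1)\<^sup>2 + (x $ 2)\<^sup>2" by (simp add: inner_R2 power2_eq_square)
      then have "2 * (x \<bullet> x) * u x = (2 * (x $ 1)\<^sup>2) * u x + (2 * (x $ 2)\<^sup>2) * u x"
        by (simp add: algebra_simps)
      then show ?thesis by (simp only: distrib_left)
    qed
    then show ?thesis by simp
  qed
  also have "\<dots> = (LINT x:annulus a b|lebesgue. deriv \<psi> (x \<bullet> x) * ((2 * (x $ 1)\<^sup>2) * u x))
    + (LINT x:annulus a b|lebesgue. deriv \<psi> (x \<bullet> x) * ((2 * (x $ 2)\<^sup>2) * u x))"
    by (intro set_integral_add mi ui c2)
  finally have UU: "(LINT x:annulus a b|lebesgue. deriv \<psi> (x \<bullet> x) * (2 * (x \<bullet> x) * u x)) = \<dots>" .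
  have "(LINT x:annulus a b|lebesgue. \<psi> (x \<bullet> x) * (2 * u x)) = (LINT x:annulus a b|lebesgue. 2 * (\<psi> (x \<bullet> x) * u x))"
    by (simp add: mult_ac)
  also have "\<dots> = 2 * (LINT x:annulus a b|lebesgue. \<psi> (x \<bullet> x) * u x)"
    by (rule set_integral_mult_right)
  finally show ?thesis using tst[of 1] tst[of 2] U[of 1] U[of 2] G UU by linarith
qed

lemma annulus_by_parts_compact:
  assumes R: "annularly_integrable R" and \<psi>: "smooth_real \<psi>" and ab: "0 < a" "a < b"
    and supp: "\<And>t. t \<notin> {a..b} \<Longrightarrow> \<psi> t = 0"
  shows "(LINT x:annulus a b|lebesgue. \<psi> (x \<bullet> x) * R x) = - integral {a..b} (\<lambda>t. deriv \<psi> t * cumulative R t)"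
  using annulus_by_parts[OF ab(1) less_imp_le[OF ab(2)] R, of \<psi> "deriv \<psi>"]
    smooth_real_support(1)[OF \<psi> ab(2) supp, of a] smooth_real_support(1)[OF \<psi> ab(2) supp, of b]
  by (simp add: has_field_derivative_at_within smooth_real_DERIV[OF \<psi>]
      smooth_real_continuous[OF smooth_real_deriv[OF \<psi>]])

lemma cumulative_DERIV:
  assumes f: "annularly_integrable f" and k: "continuous_on {0<..} k"
    and eq: "\<And>a b. 0 < a \<Longrightarrow> a < b \<Longrightarrow> (LINT x:annulus a b|lebesgue. f x) = integral {a..b} k"
    and t: "0 < t"
  shows "(cumulative f has_real_derivative k t) (at t)"
proof -
  have "((\<lambda>s. integral {t / 2..s} k) has_real_derivative k t) (at t within {t / 2..t + 1})"
    using t by (intro integral_has_real_derivative continuous_on_subset[OF k]) auto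
  then have "((\<lambda>s. integral {t / 2..s} k) has_real_derivative k t) (at t)"
    using t by (simp add: at_within_Icc_at)
  then have "((\<lambda>s. cumulative f (t / 2) + integral {t / 2..s} k) has_real_derivative k t) (at t)"
    by (auto intro!: derivative_eq_intros)
  then show ?thesis
  proof (rule has_field_derivative_transform_within_open)
    show "open {t / 2<..}" by simp
    show "t \<in> {t / 2<..}" using t by simp
    show "cumulative f (t / 2) + integral {t / 2..s} k = cumulative f s" if "s \<in> {t / 2<..}" for s
      using cumulative_diff[OF f, of "t / 2" s] eq[of "t / 2" s] t that by simp
  qed
qed

lemma annulus_integral_AE_radial:
  assumes ae: "AE x in lebesgue. f x = F (x \<bullet> x)" and f: "annularly_integrable f"
    and F: "continuous_on {0<..} F" and ab: "0 < a" "a \<le> b"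
  shows "(LINT x:annulus a b|lebesgue. f x) = integral {a..b} (\<lambda>t. pi * F t)"
proof -
  have Fab: "continuous_on {a..b} F" by (rule continuous_on_subset[OF F]) (use ab in auto)
  have "(LINT x:annulus a b|lebesgue. f x) = (LINT x:annulus a b|lebesgue. F (x \<bullet> x))"
    unfolding set_lebesgue_integral_def
  proof (rule integral_cong_AE)
    show "(\<lambda>x. indicator (annulus a b) x *\<^sub>R f x) \<in> borel_measurable lebesgue"
      using f ab by (auto simp: annularly_integrable_def set_integrable_def)
    show "(\<lambda>x. indicator (annulus a b) x *\<^sub>R F (x \<bullet> x)) \<in> borel_measurable lebesgue"
      using annulus_integral_radial(1)[OF _ ab(2) Fab] ab by (auto simp: set_integrable_def)
    show "AE x in lebesgue. indicator (annulus a b) x *\<^sub>R f x = indicator (annulus a b) x *\<^sub>R F (x \<bullet> x)"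
      using ae by (rule eventually_mono) simp
  qed
  also have "\<dots> = pi * integral {a..b} F" using annulus_integral_radial(2)[OF _ ab(2) Fab] ab by simp
  finally show ?thesis by simp
qed

text \<open>With g . x = 2 t V' the last identity is the integrated product rule for 2 pi t V. In
  weak form it is the radial test identity after integration by parts, so du Bois-Reymond determines
  the integrals of 2 (x . x) u over annuli; this defines V, and \<open>radial_zero\<close> turns
  equality of integrals into equality almost everywhere. The statement about \<open>profile\<close>
  is needed since \<open>hu\<close> integrates along a ray, a null set of the plane.\<close>

proposition radial_weakly_differentiable_continuous:
  assumes w: "has_weak_gradient u g" and u: "radial u"
  obtains V c where "continuous_on {0<..} V" "AE x in lebesgue. u x = V (x \<bullet> x)"
    "{t. 0 < t \<and> profile u (sqrt t) \<noteq> V t} \<in> null_sets lebesgue"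
    "\<forall>t>0. 2 * pi * t * V t = cumulative (\<lambda>x. 2 * u x) t + cumulative (\<lambda>x. g x \<bullet> x) t + c"
proof -
  have iu: "annularly_integrable u" and ig: "annularly_integrable (\<lambda>x. g x \<bullet> x)"
    using w by (auto simp: has_weak_gradient_def locally_integrable_radial_part
        locally_integrable_imp_annularly_integrable)
  have i2u: "annularly_integrable (\<lambda>x. 2 * u x)" using iu by (rule annularly_integrable_cmult)
  have i2tu: "annularly_integrable (\<lambda>x. (2 * (x \<bullet> x)) * u x)"
    by (intro annularly_integrable_continuous_mult iu continuous_intros)
  define K where "K = (\<lambda>t. cumulative (\<lambda>x. 2 * u x) t + cumulative (\<lambda>x. g x \<bullet> x) t)"
  have cK: "continuous_on {0<..} K"
    unfolding K_def by (intro continuous_intros continuous_cumulative i2u ig)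
  obtain c where c: "\<And>a b. 0 < a \<Longrightarrow> a < b \<Longrightarrow>
      (LINT x:annulus a b|lebesgue. (2 * (x \<bullet> x)) * u x) = integral {a..b} (\<lambda>t. K t + c)"
  proof (rule annulus_du_Bois_Reymond[OF i2tu cK])
    fix \<psi> and a b :: real
    assume \<psi>: "smooth_real \<psi>" and ab: "0 < a" "a < b" and supp: "\<And>t. t \<notin> {a..b} \<Longrightarrow> \<psi> t = 0"
    have cc: "continuous_on {a..b} (deriv \<psi>)" by (rule smooth_real_continuous[OF smooth_real_deriv[OF \<psi>]])
    have "integral {a..b} (\<lambda>t. deriv \<psi> t * K t)
      = integral {a..b} (\<lambda>t. deriv \<psi> t * cumulative (\<lambda>x. 2 * u x) t)
        + integral {a..b} (\<lambda>t. deriv \<psi> t * cumulative (\<lambda>x. g x \<bullet> x) t)"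
      unfolding K_def distrib_left
      by (intro integral_add integrable_continuous_real continuous_intros cc
          continuous_on_cumulative_Icc i2u ig ab)
    then show "(LINT x:annulus a b|lebesgue. deriv \<psi> (x \<bullet> x) * (2 * (x \<bullet> x) * u x))
      = integral {a..b} (\<lambda>t. deriv \<psi> t * K t)"
      using weak_gradient_radial_test[OF w \<psi> ab supp] annulus_by_parts_compact[OF i2u \<psi> ab supp]
        annulus_by_parts_compact[OF ig \<psi> ab supp] by linarith
  qed blast
  define V where "V = (\<lambda>t. (K t + c) / (2 * pi * t))"
  have cV: "continuous_on {0<..} V"
    unfolding V_def by (intro continuous_intros cK) auto
  have iV: "annularly_integrable (\<lambda>x. 2 * (x \<bullet> x) * V (x \<bullet> x))"
    by (rule annularly_integrable_radial[where F = "\<lambda>t. 2 * t * V t"]) (intro continuous_intros cV)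
  define d where "d = (\<lambda>x. (2 * (x \<bullet> x)) * u x - 2 * (x \<bullet> x) * V (x \<bullet> x))"
  have "{x. x \<bullet> x > 0 \<and> d x \<noteq> 0} \<in> null_sets lebesgue"
  proof (rule radial_zero)
    show "annularly_integrable d" unfolding d_def by (intro annularly_integrable_diff i2tu iV)
    show "radial d"
      unfolding radial_def
    proof (intro allI impI)
      fix x y :: R2 assume xy: "norm x = norm y"
      then have "u x = u y" using u unfolding radial_def by blast
      moreover have "x \<bullet> x = y \<bullet> y" using xy by (simp add: norm_eq)
      ultimately show "d x = d y" by (simp add: d_def)
    qed
    fix a b :: real assume ab: "0 < a" "a < b"
    have "(LINT x:annulus a b|lebesgue. 2 * (x \<bullet> x) * V (x \<bullet> x)) = pi * integral {a..b} (\<lambda>t. 2 * t * V t)"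
      using ab by (intro annulus_integral_radial(2) continuous_intros continuous_on_subset[OF cV]) auto
    also have "\<dots> = integral {a..b} (\<lambda>t. pi * (2 * t * V t))" by simp
    also have "\<dots> = integral {a..b} (\<lambda>t. K t + c)"
      using ab by (intro integral_cong) (auto simp: V_def)
    finally have "(LINT x:annulus a b|lebesgue. 2 * (x \<bullet> x) * V (x \<bullet> x)) = integral {a..b} (\<lambda>t. K t + c)" .
    moreover have "(LINT x:annulus a b|lebesgue. d x) = (LINT x:annulus a b|lebesgue. (2 * (x \<bullet> x)) * u x)
      - (LINT x:annulus a b|lebesgue. 2 * (x \<bullet> x) * V (x \<bullet> x))"
      unfolding d_def using ab i2tu iV
      by (intro set_integral_diff) (auto simp: annularly_integrable_def)
    ultimately show "(LINT x:annulus a b|lebesgue. d x) = 0" using c[OF ab] by simp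
  qed
  then have null: "{x. x \<bullet> x > 0 \<and> u x \<noteq> V (x \<bullet> x)} \<in> null_sets lebesgue" (is "?N \<in> _")
    by (rule back_subst[where P = "\<lambda>S. S \<in> null_sets lebesgue"]) (auto simp: d_def)
  show ?thesis
  proof (rule that[OF cV])
    show "AE x in lebesgue. u x = V (x \<bullet> x)"
      using AE_not_in[OF null] AE_not_in[OF circle_null[of 0]]
      by eventually_elim auto
    show "{t. 0 < t \<and> profile u (sqrt t) \<noteq> V t} \<in> null_sets lebesgue"
    proof (rule null_of_radial_null)
      have "profile u (sqrt (x \<bullet> x)) = u x" for x
      proof -
        have "norm (sqrt (x \<bullet> x) *\<^sub>R (axis 1 1 :: R2)) = norm x"
          by (simp add: norm_axis_1 norm_eq_sqrt_inner[of x])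
        then show ?thesis using u unfolding profile_def radial_def by blast
      qed
      then show "{x::R2. x \<bullet> x \<in> {t. 0 < t \<and> profile u (sqrt t) \<noteq> V t}} \<in> null_sets lebesgue"
        using null by simp
    qed auto
    show "\<forall>t>0. 2 * pi * t * V t = cumulative (\<lambda>x. 2 * u x) t + cumulative (\<lambda>x. g x \<bullet> x) t + c"
      by (simp add: V_def K_def)
  qed
qed

text \<open>The cumulative integral of the difference is differentiated in two ways, as an integral
  of 0 and as an integral of pi (V - W).\<close>

lemma AE_continuous_unique:
  fixes V W :: "real \<Rightarrow> real"
  assumes V: "continuous_on {0<..} V" and W: "continuous_on {0<..} W"
    and ae: "AE x in lebesgue. V ((x::R2) \<bullet> x) = W (x \<bullet> x)" and t: "0 < t"
  shows "V t = W t"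
proof -
  have i: "annularly_integrable (\<lambda>x. V (x \<bullet> x) - W (x \<bullet> x))"
    by (intro annularly_integrable_diff annularly_integrable_radial V W)
  have 0: "(LINT x:annulus a b|lebesgue. V (x \<bullet> x) - W (x \<bullet> x)) = 0" if "0 < a" "a < b" for a b
    using annulus_integral_AE_radial[of _ "\<lambda>_. 0", OF _ i continuous_on_const that(1) less_imp_le[OF that(2)]] ae
    by simp
  have "(cumulative (\<lambda>x. V (x \<bullet> x) - W (x \<bullet> x)) has_real_derivative (\<lambda>_. 0) t) (at t)"
    by (rule cumulative_DERIV[OF i]) (use 0 t in auto)
  moreover have "(cumulative (\<lambda>x. V (x \<bullet> x) - W (x \<bullet> x)) has_real_derivative (\<lambda>t. pi * (V t - W t)) t) (at t)"
  proof (rule cumulative_DERIV[OF i])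
    show "continuous_on {0<..} (\<lambda>t. pi * (V t - W t))" by (intro continuous_intros V W)
    show "(LINT x:annulus a b|lebesgue. V (x \<bullet> x) - W (x \<bullet> x)) = integral {a..b} (\<lambda>t. pi * (V t - W t))"
      if "0 < a" "a < b" for a b
      by (rule annulus_integral_AE_radial[OF _ i]) (use that V W in \<open>auto intro!: continuous_intros\<close>)
  qed (rule t)
  ultimately have "pi * (V t - W t) = 0" using DERIV_unique by fastforce
  then show ?thesis by simp
qed

text \<open>Differentiating the formula for 2 pi t V shows that g . x and 2 (x . x) V' have the same
  integral over every annulus, and \<open>annulus_orthogonal\<close> inserts the weight. This holds
  for any weak gradient, which makes uniqueness of weak gradients dispensable.\<close>

lemma radial_part_of_weak_gradient:
  assumes w: "has_weak_gradient u g" and u: "radial u" and ae: "AE x in lebesgue. u x = V (x \<bullet> x)"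
    and V: "\<And>t. 0 < t \<Longrightarrow> (V has_real_derivative V' t) (at t)" and V': "continuous_on {0<..} V'"
    and ab: "0 < a" "a \<le> b" and \<theta>: "continuous_on {a..b} \<theta>"
  shows "(LINT x:annulus a b|lebesgue. \<theta> (x \<bullet> x) * (g x \<bullet> x)) = 2 * pi * integral {a..b} (\<lambda>t. \<theta> t * (t * V' t))"
proof -
  have iu: "annularly_integrable u" and ig: "annularly_integrable (\<lambda>x. g x \<bullet> x)"
    using w by (auto simp: has_weak_gradient_def locally_integrable_radial_part
        locally_integrable_imp_annularly_integrable)
  have i2u: "annularly_integrable (\<lambda>x. 2 * u x)" using iu by (rule annularly_integrable_cmult)
  have cV: "continuous_on {0<..} V"
    using V by (auto intro!: continuous_at_imp_continuous_on DERIV_isCont)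
  obtain W c where W: "continuous_on {0<..} W" "AE x in lebesgue. u x = W (x \<bullet> x)"
    "{t. 0 < t \<and> profile u (sqrt t) \<noteq> W t} \<in> null_sets lebesgue"
    "\<forall>t>0. 2 * pi * t * W t = cumulative (\<lambda>x. 2 * u x) t + cumulative (\<lambda>x. g x \<bullet> x) t + c"
    by (rule radial_weakly_differentiable_continuous[OF w u]) (rule that; assumption)
  have WV: "W t = V t" if "0 < t" for t
    by (rule AE_continuous_unique[OF W(1) cV _ that]) (use ae W(2) in eventually_elim, simp)
  have cg: "cumulative (\<lambda>x. g x \<bullet> x) t = 2 * pi * t * V t - cumulative (\<lambda>x. 2 * u x) t - c" if "0 < t" for t
    using W(4)[rule_format, OF that] unfolding WV[OF that] by linarith
  have d2u: "(cumulative (\<lambda>x. 2 * u x) has_real_derivative (\<lambda>t. pi * (2 * V t)) t) (at t)" if "0 < t" for t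
  proof (rule cumulative_DERIV[OF i2u _ _ that])
    show "continuous_on {0<..} (\<lambda>t. pi * (2 * V t))" by (intro continuous_intros cV)
    show "(LINT x:annulus a b|lebesgue. 2 * u x) = integral {a..b} (\<lambda>t. pi * (2 * V t))" if "0 < a" "a < b" for a b
      by (rule annulus_integral_AE_radial[OF _ i2u]) (use ae that cV in \<open>auto intro!: continuous_intros\<close>)
  qed
  have dg: "(cumulative (\<lambda>x. g x \<bullet> x) has_real_derivative 2 * pi * t * V' t) (at t)" if "0 < t" for t
  proof -
    have "((\<lambda>t. 2 * pi * t * V t - cumulative (\<lambda>x. 2 * u x) t - c) has_real_derivative 2 * pi * t * V' t) (at t)"
      by (rule derivative_eq_intros refl V d2u that)+ (simp add: algebra_simps)
    then show ?thesis
      by (rule has_field_derivative_transform_within_open[of _ _ _ "{0<..}"]) (use that cg in auto)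
  qed
  define k where "k = (\<lambda>x::R2. g x \<bullet> x - 2 * (x \<bullet> x) * V' (x \<bullet> x))"
  have iV': "annularly_integrable (\<lambda>x. 2 * (x \<bullet> x) * V' (x \<bullet> x))"
    by (rule annularly_integrable_radial[where F = "\<lambda>t. 2 * t * V' t"]) (intro continuous_intros V')
  have ik: "annularly_integrable k" unfolding k_def by (intro annularly_integrable_diff ig iV')
  have "(LINT x:annulus a b|lebesgue. k x) = 0" if "0 < a" "a < b" for a b
  proof -
    have "(LINT x:annulus a b|lebesgue. g x \<bullet> x) = cumulative (\<lambda>x. g x \<bullet> x) b - cumulative (\<lambda>x. g x \<bullet> x) a"
      using cumulative_diff[OF ig that(1)] that by simp
    also have "\<dots> = integral {a..b} (\<lambda>t. 2 * pi * t * V' t)"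
      using that dg by (intro integral_unique[symmetric] fundamental_theorem_of_calculus)
        (auto simp flip: has_real_derivative_iff_has_vector_derivative intro: has_field_derivative_at_within)
    also have "\<dots> = pi * integral {a..b} (\<lambda>t. 2 * t * V' t)"
      by (simp add: mult_ac flip: integral_mult_right)
    also have "\<dots> = (LINT x:annulus a b|lebesgue. 2 * (x \<bullet> x) * V' (x \<bullet> x))"
      using that by (intro annulus_integral_radial(2)[symmetric] continuous_intros continuous_on_subset[OF V']) auto
    finally show ?thesis unfolding k_def using that ig iV'
      by (subst set_integral_diff) (auto simp: annularly_integrable_def)
  qed
  from annulus_orthogonal[OF ik this ab \<theta>]
  have "0 = (LINT x:annulus a b|lebesgue. \<theta> (x \<bullet> x) * k x)" by simp
  also have "\<dots> = (LINT x:annulus a b|lebesgue. \<theta> (x \<bullet> x) * (g x \<bullet> x) - \<theta> (x \<bullet> x) * (2 * (x \<bullet> x) * V' (x \<bullet> x)))"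
    by (simp add: k_def right_diff_distrib)
  also have "\<dots> = (LINT x:annulus a b|lebesgue. \<theta> (x \<bullet> x) * (g x \<bullet> x))
    - (LINT x:annulus a b|lebesgue. \<theta> (x \<bullet> x) * (2 * (x \<bullet> x) * V' (x \<bullet> x)))"
    using ab \<theta> ig iV'
    by (intro set_integral_diff annulus_mult_integrable[where f = "\<lambda>x. g x \<bullet> x"]
        annulus_mult_integrable[where f = "\<lambda>x. 2 * (x \<bullet> x) * V' (x \<bullet> x)"]) (auto simp: annularly_integrable_def)
  also have "(LINT x:annulus a b|lebesgue. \<theta> (x \<bullet> x) * (2 * (x \<bullet> x) * V' (x \<bullet> x)))
    = pi * integral {a..b} (\<lambda>t. \<theta> t * (2 * t * V' t))"
    using ab by (intro annulus_integral_radial(2) continuous_intros \<theta> continuous_on_subset[OF V']) auto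
  also have "integral {a..b} (\<lambda>t. \<theta> t * (2 * t * V' t)) = 2 * integral {a..b} (\<lambda>t. \<theta> t * (t * V' t))"
    by (simp add: mult_ac flip: integral_mult_right)
  finally show ?thesis by simp
qed

text \<open>The left side is the Dirichlet integral of V(x . x) over the annulus. Expanding |g - 2
  V' x|^2 \<ge> 0 bounds |g|^2 below by 4 V' (g . x) - 4 t V'^2, which is linear in g and therefore
  has a known integral: 8 pi minus 4 pi times the integral of t V'^2.\<close>

lemma radial_energy_bound:
  assumes w: "has_weak_gradient u g" and g: "square_integrable g"
    and u: "radial u" and ae: "AE x in lebesgue. u x = V (x \<bullet> x)"
    and V: "\<And>t. 0 < t \<Longrightarrow> (V has_real_derivative V' t) (at t)" and V': "continuous_on {0<..} V'"
    and ab: "0 < a" "a \<le> b"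
  shows "4 * pi * integral {a..b} (\<lambda>t. t * (V' t)\<^sup>2) \<le> (LINT x|lebesgue. (norm (g x))\<^sup>2)"
proof -
  have ig: "annularly_integrable (\<lambda>x. g x \<bullet> x)"
    using w by (auto simp: has_weak_gradient_def locally_integrable_radial_part)
  have V'ab: "continuous_on {a..b} V'" by (rule continuous_on_subset[OF V']) (use ab in auto)
  have ig2: "integrable lebesgue (\<lambda>x. (norm (g x))\<^sup>2)" using g by (simp add: square_integrable_def)
  have i1: "set_integrable lebesgue (annulus a b) (\<lambda>x. 4 * V' (x \<bullet> x) * (g x \<bullet> x))"
    using ig ab by (intro annulus_mult_integrable[where \<theta> = "\<lambda>t. 4 * V' t"] continuous_intros V'ab)
      (auto simp: annularly_integrable_def)
  have i2: "set_integrable lebesgue (annulus a b) (\<lambda>x. 4 * ((x \<bullet> x) * (V' (x \<bullet> x))\<^sup>2))"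
    using ab by (intro annulus_integral_radial(1)[where F = "\<lambda>t. 4 * (t * (V' t)\<^sup>2)"] continuous_intros V'ab) auto
  have i3: "set_integrable lebesgue (annulus a b) (\<lambda>x. (norm (g x))\<^sup>2)"
    using set_integrable_subset[of lebesgue UNIV "\<lambda>x. (norm (g x))\<^sup>2" "annulus a b"] ig2
    by (simp add: set_integrable_def)
  have "4 * pi * integral {a..b} (\<lambda>t. t * (V' t)\<^sup>2)
    = 2 * pi * integral {a..b} (\<lambda>t. 4 * V' t * (t * V' t)) - pi * integral {a..b} (\<lambda>t. 4 * (t * (V' t)\<^sup>2))"
  proof -
    have "(\<lambda>t. 4 * V' t * (t * V' t)) = (\<lambda>t. 4 * (t * (V' t)\<^sup>2))" by (auto simp: power2_eq_square)
    then show ?thesis by simp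
  qed
  also have "\<dots> = (LINT x:annulus a b|lebesgue. 4 * V' (x \<bullet> x) * (g x \<bullet> x))
    - (LINT x:annulus a b|lebesgue. 4 * ((x \<bullet> x) * (V' (x \<bullet> x))\<^sup>2))"
    using annulus_integral_radial(2)[where F = "\<lambda>t. 4 * (t * (V' t)\<^sup>2)", of a b] ab V'ab
      radial_part_of_weak_gradient[OF w u ae V V' ab, of "\<lambda>t. 4 * V' t"]
    by (simp add: continuous_intros)
  also have "\<dots> = (LINT x:annulus a b|lebesgue. 4 * V' (x \<bullet> x) * (g x \<bullet> x) - 4 * ((x \<bullet> x) * (V' (x \<bullet> x))\<^sup>2))"
    using set_integral_diff(2)[OF i1 i2] by simp
  also have "\<dots> \<le> (LINT x:annulus a b|lebesgue. (norm (g x))\<^sup>2)"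
  proof (rule set_integral_mono[OF set_integral_diff(1)[OF i1 i2] i3])
    fix x :: R2
    have "0 \<le> (norm (g x - (2 * V' (x \<bullet> x)) *\<^sub>R x))\<^sup>2" by simp
    also have "\<dots> = (norm (g x))\<^sup>2 - 4 * V' (x \<bullet> x) * (g x \<bullet> x) + 4 * ((x \<bullet> x) * (V' (x \<bullet> x))\<^sup>2)"
      unfolding power2_norm_eq_inner
      by (simp add: inner_diff_left inner_diff_right inner_commute power2_eq_square algebra_simps)
    finally show "4 * V' (x \<bullet> x) * (g x \<bullet> x) - 4 * ((x \<bullet> x) * (V' (x \<bullet> x))\<^sup>2) \<le> (norm (g x))\<^sup>2" by simp
  qed
  also have "\<dots> \<le> (LINT x|lebesgue. (norm (g x))\<^sup>2)"
    unfolding set_lebesgue_integral_def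
    by (rule integral_mono) (use i3 ig2 in \<open>auto simp: set_integrable_def split: split_indicator\<close>)
  finally show ?thesis .
qed

section \<open>The ordinary differential equation in the squared radius\<close>

text \<open>The last assumption is the equation tested with \<open>V\<close> over an annulus, after discarding the
  nonnegative nonlocal tail and dividing by \<open>\<pi>\<close>.\<close>

locale radial_profile =
  fixes V V' H :: "real \<Rightarrow> real" and \<mu> q lam \<omega> p B C :: real
  assumes pos: "0 < \<mu>" "0 < q"
    and V: "\<And>t. 0 < t \<Longrightarrow> (V has_real_derivative V' t) (at t)" and V': "continuous_on {0<..} V'"
    and H: "\<And>t. 0 < t \<Longrightarrow> (H has_real_derivative (V t)\<^sup>2 / 2) (at t)"
    and H_bounds: "\<And>t. 0 < t \<Longrightarrow> 0 \<le> H t" "\<And>t. 0 < t \<Longrightarrow> H t \<le> B"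
    and C1: "\<And>a b. 0 < a \<Longrightarrow> a \<le> b \<Longrightarrow> integral {a..b} (\<lambda>t. (V t)\<^sup>2) \<le> C"
    and C2: "\<And>a b. 0 < a \<Longrightarrow> a \<le> b \<Longrightarrow> integral {a..b} (\<lambda>t. (V t) ^ 4) \<le> C"
    and C3: "\<And>a b. 0 < a \<Longrightarrow> a \<le> b \<Longrightarrow> integral {a..b} (\<lambda>t. t * (V' t)\<^sup>2) \<le> C"
    and C4: "\<And>a b. 0 < a \<Longrightarrow> a \<le> b \<Longrightarrow> integral {a..b} (\<lambda>t. t * (V t * V' t)\<^sup>2) \<le> C"
    and \<omega>: "\<And>y. y\<^sup>2 + lam * \<bar>y\<bar> powr (p - 1) * y\<^sup>2 \<le> \<omega> * y\<^sup>2 + \<mu> * sqrt q * y ^ 6"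
    and p: "1 < p"
    and ineq: "\<And>a b. 0 < a \<Longrightarrow> a \<le> b \<Longrightarrow>
      integral {a..b} (\<lambda>t. 4 * t * (V' t)\<^sup>2 * (1 + 4 * \<mu> * (V t)\<^sup>2) + \<omega> * (V t)\<^sup>2
          - lam * \<bar>V t\<bar> powr (p - 1) * (V t)\<^sup>2 + q * ((H t)\<^sup>2 / t) * (1 + \<mu> * (V t)\<^sup>2) * (V t)\<^sup>2)
      \<le> V b * (4 * b * (1 + 2 * \<mu> * (V b)\<^sup>2) * V' b) - V a * (4 * a * (1 + 2 * \<mu> * (V a)\<^sup>2) * V' a)"
begin

definition G :: "real \<Rightarrow> real" where
  "G t = V t * (4 * t * (1 + 2 * \<mu> * (V t)\<^sup>2) * V' t) + 2 * \<mu> * sqrt q * ((V t) ^ 4 * H t)"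

lemma cont: "0 < a \<Longrightarrow> continuous_on {a..b} V" "0 < a \<Longrightarrow> continuous_on {a..b} V'" "0 < a \<Longrightarrow> continuous_on {a..b} H"
  by (auto intro!: continuous_at_imp_continuous_on DERIV_isCont[OF V] DERIV_isCont[OF H] continuous_on_subset[OF V'])

lemma B_nonneg: "0 \<le> B"
  using H_bounds[of 1] by simp

lemma G_increase:
  assumes ab: "0 < a" "a \<le> b"
  shows "integral {a..b} (\<lambda>t. (V t)\<^sup>2) \<le> G b - G a"
proof -
  note cs = cont[OF ab(1)]
  define c where "c = 2 * \<mu> * sqrt q"
  define f where "f = (\<lambda>t. 4 * t * (V' t)\<^sup>2 * (1 + 4 * \<mu> * (V t)\<^sup>2) + \<omega> * (V t)\<^sup>2
          - lam * \<bar>V t\<bar> powr (p - 1) * (V t)\<^sup>2 + q * ((H t)\<^sup>2 / t) * (1 + \<mu> * (V t)\<^sup>2) * (V t)\<^sup>2)"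
  define k where "k = (\<lambda>t. c * (4 * (V t) ^ 3 * V' t * H t + (V t) ^ 6 / 2))"
  have cp: "continuous_on {a..b} (\<lambda>t. \<bar>V t\<bar> powr (p - 1))"
    by (rule continuous_on_powr') (use p in \<open>auto intro!: continuous_intros cs\<close>)
  have cf: "continuous_on {a..b} f" unfolding f_def
    by (intro continuous_on_add continuous_on_diff continuous_on_mult continuous_on_divide continuous_on_power
        continuous_on_const continuous_on_id cs cp) (use ab in auto)
  have ck: "continuous_on {a..b} k" unfolding k_def by (intro continuous_intros cs) auto
  have FTC: "integral {a..b} k = c * ((V b) ^ 4 * H b) - c * ((V a) ^ 4 * H a)"
  proof (rule integral_unique, rule fundamental_theorem_of_calculus[OF ab(2)])
    fix t assume t: "t \<in> {a..b}"
    then have "0 < t" using ab by simp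
    have "((\<lambda>t. c * ((V t) ^ 4 * H t)) has_real_derivative k t) (at t)"
      by (rule derivative_eq_intros refl V H \<open>0 < t\<close>)+ (simp add: k_def algebra_simps eval_nat_numeral)
    then show "((\<lambda>t. c * ((V t) ^ 4 * H t)) has_vector_derivative k t) (at t within {a..b})"
      by (simp add: has_field_derivative_at_within flip: has_real_derivative_iff_has_vector_derivative)
  qed
  have "integral {a..b} (\<lambda>t. (V t)\<^sup>2) \<le> integral {a..b} (\<lambda>t. f t + k t)"
  proof (rule integral_le)
    show "(\<lambda>t. (V t)\<^sup>2) integrable_on {a..b}" by (intro integrable_continuous_real continuous_intros cs)
    show "(\<lambda>t. f t + k t) integrable_on {a..b}" by (intro integrable_continuous_real continuous_intros cf ck)
    fix t assume t: "t \<in> {a..b}"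
    then have t0: "0 < t" using ab by simp
    \<comment> \<open>The pure terms are the summands 16 \<mu> t (V V')^2 and \<mu> q H^2 V^4 / t of
      \<open>f\<close>; the mixed term is the part of \<open>k\<close> coming from the derivative of
      V^4. What is left of \<open>k\<close> is \<mu> sqrt q V^6, the gain that dominates the
      source.\<close>
    have "0 \<le> \<mu> * (4 * sqrt t * (V t * V' t) + sqrt q * (H t * (V t)\<^sup>2) / sqrt t)\<^sup>2"
      using pos by simp
    also have "(4 * sqrt t * (V t * V' t) + sqrt q * (H t * (V t)\<^sup>2) / sqrt t)\<^sup>2
      = 16 * t * (V t * V' t)\<^sup>2 + q * (H t * (V t)\<^sup>2)\<^sup>2 / t + 8 * sqrt q * ((V t * V' t) * (H t * (V t)\<^sup>2))"
    proof -
      have "(4 * sqrt t * X + sqrt q * Y / sqrt t)\<^sup>2 = 16 * t * X\<^sup>2 + q * Y\<^sup>2 / t + 8 * sqrt q * (X * Y)" for X Y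
      proof -
        have "(4 * sqrt t * X + sqrt q * Y / sqrt t)\<^sup>2
          = 16 * (sqrt t)\<^sup>2 * X\<^sup>2 + (sqrt q)\<^sup>2 * Y\<^sup>2 / (sqrt t)\<^sup>2 + 8 * sqrt q * (X * Y) * (sqrt t / sqrt t)"
          by (simp add: power2_eq_square algebra_simps add_divide_distrib)
        then show ?thesis using t0 pos by simp
      qed
      then show ?thesis .
    qed
    finally have sq: "0 \<le> \<mu> * (16 * t * (V t * V' t)\<^sup>2 + q * (H t * (V t)\<^sup>2)\<^sup>2 / t
      + 8 * sqrt q * ((V t * V' t) * (H t * (V t)\<^sup>2)))" .
    have nn: "0 \<le> 4 * t * (V' t)\<^sup>2" "0 \<le> q * ((H t)\<^sup>2 / t) * (V t)\<^sup>2" using t0 pos by auto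
    have "f t + k t = 4 * t * (V' t)\<^sup>2 + q * ((H t)\<^sup>2 / t) * (V t)\<^sup>2
      + \<mu> * (16 * t * (V t * V' t)\<^sup>2 + q * (H t * (V t)\<^sup>2)\<^sup>2 / t + 8 * sqrt q * ((V t * V' t) * (H t * (V t)\<^sup>2)))
      + (\<omega> * (V t)\<^sup>2 + \<mu> * sqrt q * (V t) ^ 6 - lam * \<bar>V t\<bar> powr (p - 1) * (V t)\<^sup>2)"
      unfolding f_def k_def c_def using t0 by (simp add: field_simps eval_nat_numeral)
    then show "(V t)\<^sup>2 \<le> f t + k t" using sq nn \<omega>[of "V t"] by linarith
  qed
  also have "\<dots> = integral {a..b} f + integral {a..b} k"
    by (intro integral_add integrable_continuous_real cf ck)
  also have "\<dots> \<le> G b - G a"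
    using ineq[OF ab] FTC by (simp add: G_def f_def c_def)
  finally show ?thesis .
qed

lemma V_sq_integral_nonneg: "0 < a \<Longrightarrow> 0 \<le> integral {a..b} (\<lambda>t. (V t)\<^sup>2)"
  by (intro integral_nonneg integrable_continuous_real continuous_intros cont) auto

lemma G_mono: "0 < a \<Longrightarrow> a \<le> b \<Longrightarrow> G a \<le> G b"
  using G_increase[of a b] V_sq_integral_nonneg[of a b] by linarith

lemma two_mult_le: "2 * (X * Y) \<le> X\<^sup>2 + Y\<^sup>2" for X Y :: real
  using sum_squares_bound[of X Y] by simp

text \<open>A positive value \<epsilon> of \<open>G\<close> would persist by monotonicity, so
  \<epsilon> / sqrt t would lie below \<open>Q\<close>. The integrals of \<open>Q\<close> are
  bounded by the four energy bounds, whereas those of 1 / sqrt t are not.\<close>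

lemma G_nonpos:
  assumes "0 < b"
  shows "G b \<le> 0"
proof (rule ccontr)
  assume "\<not> G b \<le> 0"
  define b0 where "b0 = max b 1"
  define \<epsilon> where "\<epsilon> = G b"
  have \<epsilon>: "0 < \<epsilon>" using \<open>\<not> G b \<le> 0\<close> by (simp add: \<epsilon>_def)
  have b0: "1 \<le> b0" "b \<le> b0" by (auto simp: b0_def)
  define Q where "Q = (\<lambda>t. 2 * (V t)\<^sup>2 + 2 * (t * (V' t)\<^sup>2) + (4 * \<mu> + 2 * \<mu> * sqrt q * B) * (V t) ^ 4
    + 4 * \<mu> * (t * (V t * V' t)\<^sup>2))"
  \<comment> \<open>Young's inequality is applied to the products of V and V^2 with sqrt t V' and
    sqrt t V V', so that t V'^2 and t (V V')^2 carry exactly the weight t of the energies and one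
    factor sqrt t is left over. The term with H has no such factor and is enlarged by sqrt t \<ge>
    1.\<close>
  have GQ: "G t \<le> sqrt t * Q t" if t: "1 \<le> t" for t
  proof -
    have st: "1 \<le> sqrt t" "(sqrt t)\<^sup>2 = t" using t by auto
    have "4 * t * (V t * V' t) \<le> sqrt t * (2 * ((V t)\<^sup>2 + t * (V' t)\<^sup>2))"
    proof -
      have "2 * (V t * (sqrt t * V' t)) \<le> (V t)\<^sup>2 + (sqrt t * V' t)\<^sup>2" by (rule two_mult_le)
      then have "2 * sqrt t * (2 * (V t * (sqrt t * V' t))) \<le> 2 * sqrt t * ((V t)\<^sup>2 + (sqrt t * V' t)\<^sup>2)"
        using st by (intro mult_left_mono) auto
      moreover have "2 * sqrt t * (2 * (V t * (sqrt t * V' t))) = 4 * (sqrt t)\<^sup>2 * (V t * V' t)"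
        by (simp add: power2_eq_square)
      moreover have "(sqrt t * V' t)\<^sup>2 = t * (V' t)\<^sup>2" using st by (simp add: power_mult_distrib)
      ultimately have "4 * t * (V t * V' t) \<le> 2 * sqrt t * ((V t)\<^sup>2 + t * (V' t)\<^sup>2)"
        by (simp only: st)
      then show ?thesis by (simp add: algebra_simps)
    qed
    moreover have "8 * \<mu> * t * ((V t)\<^sup>2 * (V t * V' t)) \<le> sqrt t * (4 * \<mu> * ((V t) ^ 4 + t * (V t * V' t)\<^sup>2))"
    proof -
      have "2 * ((V t)\<^sup>2 * (sqrt t * (V t * V' t))) \<le> ((V t)\<^sup>2)\<^sup>2 + (sqrt t * (V t * V' t))\<^sup>2" by (rule two_mult_le)
      then have "4 * \<mu> * sqrt t * (2 * ((V t)\<^sup>2 * (sqrt t * (V t * V' t))))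
          \<le> 4 * \<mu> * sqrt t * (((V t)\<^sup>2)\<^sup>2 + (sqrt t * (V t * V' t))\<^sup>2)"
        using st pos by (intro mult_left_mono) auto
      moreover have "4 * \<mu> * sqrt t * (2 * ((V t)\<^sup>2 * (sqrt t * (V t * V' t))))
        = 8 * \<mu> * (sqrt t)\<^sup>2 * ((V t)\<^sup>2 * (V t * V' t))"
        by (simp add: power2_eq_square)
      moreover have "(sqrt t * (V t * V' t))\<^sup>2 = t * (V t * V' t)\<^sup>2" "((V t)\<^sup>2)\<^sup>2 = (V t) ^ 4"
        using st by (simp_all add: power_mult_distrib flip: power_mult)
      ultimately have "8 * \<mu> * t * ((V t)\<^sup>2 * (V t * V' t)) \<le> 4 * \<mu> * sqrt t * ((V t) ^ 4 + t * (V t * V' t)\<^sup>2)"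
        by (simp only: st)
      then show ?thesis by (simp add: algebra_simps)
    qed
    moreover have "2 * \<mu> * sqrt q * ((V t) ^ 4 * H t) \<le> sqrt t * (2 * \<mu> * sqrt q * B * (V t) ^ 4)"
    proof -
      have "2 * \<mu> * sqrt q * ((V t) ^ 4 * H t) \<le> 2 * \<mu> * sqrt q * ((V t) ^ 4 * B)"
        using H_bounds[of t] t pos by (intro mult_left_mono) auto
      also have "\<dots> \<le> sqrt t * (2 * \<mu> * sqrt q * ((V t) ^ 4 * B))"
        using mult_right_mono[OF st(1), of "2 * \<mu> * sqrt q * ((V t) ^ 4 * B)"] pos B_nonneg by simp
      finally show ?thesis by (simp add: mult_ac)
    qed
    moreover have "G t = 4 * t * (V t * V' t) + 8 * \<mu> * t * ((V t)\<^sup>2 * (V t * V' t)) + 2 * \<mu> * sqrt q * ((V t) ^ 4 * H t)"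
      by (simp add: G_def algebra_simps)
    moreover have "sqrt t * Q t = sqrt t * (2 * ((V t)\<^sup>2 + t * (V' t)\<^sup>2))
      + sqrt t * (4 * \<mu> * ((V t) ^ 4 + t * (V t * V' t)\<^sup>2)) + sqrt t * (2 * \<mu> * sqrt q * B * (V t) ^ 4)"
      by (simp add: Q_def algebra_simps)
    ultimately show ?thesis by linarith
  qed
  define K where "K = 2 * C + 2 * C + (4 * \<mu> + 2 * \<mu> * sqrt q * B) * C + 4 * \<mu> * C"
  have QK: "integral {b0..r} Q \<le> K" and iQ: "Q integrable_on {b0..r}" if r: "b0 \<le> r" for r
  proof -
    have b00: "0 < b0" using b0 by simp
    note cs = cont[OF b00]
    have ii: "(\<lambda>t. 2 * (V t)\<^sup>2) integrable_on {b0..r}" "(\<lambda>t. 2 * (t * (V' t)\<^sup>2)) integrable_on {b0..r}"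
      "(\<lambda>t. (4 * \<mu> + 2 * \<mu> * sqrt q * B) * (V t) ^ 4) integrable_on {b0..r}"
      "(\<lambda>t. 4 * \<mu> * (t * (V t * V' t)\<^sup>2)) integrable_on {b0..r}"
      by (intro integrable_continuous_real continuous_intros cs)+
    show "Q integrable_on {b0..r}" unfolding Q_def by (intro integrable_add ii)
    have "integral {b0..r} Q = 2 * integral {b0..r} (\<lambda>t. (V t)\<^sup>2) + 2 * integral {b0..r} (\<lambda>t. t * (V' t)\<^sup>2)
      + (4 * \<mu> + 2 * \<mu> * sqrt q * B) * integral {b0..r} (\<lambda>t. (V t) ^ 4)
      + 4 * \<mu> * integral {b0..r} (\<lambda>t. t * (V t * V' t)\<^sup>2)"
      unfolding Q_def by (simp only: integral_add integrable_add ii integral_mult_right)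
    also have "\<dots> \<le> K" unfolding K_def
      using C1[OF b00 r] C2[OF b00 r] C3[OF b00 r] C4[OF b00 r] pos B_nonneg
      by (intro add_mono mult_left_mono) auto
    finally show "integral {b0..r} Q \<le> K" .
  qed
  have bound: "2 * \<epsilon> * (sqrt r - sqrt b0) \<le> K" if r: "b0 \<le> r" for r
  proof -
    have I: "((\<lambda>t. \<epsilon> / sqrt t) has_integral 2 * \<epsilon> * sqrt r - 2 * \<epsilon> * sqrt b0) {b0..r}"
    proof (rule fundamental_theorem_of_calculus[OF r])
      fix t assume "t \<in> {b0..r}"
      then have "0 < t" using b0 by simp
      then have "((\<lambda>t. 2 * \<epsilon> * sqrt t) has_real_derivative \<epsilon> / sqrt t) (at t)"
        by (auto intro!: derivative_eq_intros simp: field_simps)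
      then show "((\<lambda>t. 2 * \<epsilon> * sqrt t) has_vector_derivative \<epsilon> / sqrt t) (at t within {b0..r})"
        by (simp add: has_field_derivative_at_within flip: has_real_derivative_iff_has_vector_derivative)
    qed
    have "2 * \<epsilon> * sqrt r - 2 * \<epsilon> * sqrt b0 \<le> integral {b0..r} Q"
    proof (rule has_integral_le[OF I integrable_integral[OF iQ[OF r]]])
      fix t assume t: "t \<in> {b0..r}"
      have "\<epsilon> \<le> G t" unfolding \<epsilon>_def using t b0 assms by (intro G_mono) auto
      also have "\<dots> \<le> sqrt t * Q t" using t b0 by (intro GQ) auto
      finally show "\<epsilon> / sqrt t \<le> Q t" using t b0 by (simp add: field_simps)
    qed
    then show ?thesis using QK[OF r] by (simp add: algebra_simps)
  qed
  \<comment> \<open>Chosen to make 2 \<epsilon> (sqrt r - sqrt b0) equal to |K| + 1, which exceeds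
    K.\<close>
  define r where "r = (sqrt b0 + (\<bar>K\<bar> + 1) / (2 * \<epsilon>))\<^sup>2"
  have s: "sqrt r = sqrt b0 + (\<bar>K\<bar> + 1) / (2 * \<epsilon>)"
    unfolding r_def using \<epsilon> b0 by (intro real_sqrt_unique) (auto intro!: add_nonneg_nonneg)
  then have "sqrt b0 \<le> sqrt r" using \<epsilon> by simp
  then have "b0 \<le> r" by simp
  from bound[OF this] s have "2 * \<epsilon> * ((\<bar>K\<bar> + 1) / (2 * \<epsilon>)) \<le> K" by simp
  then show False using \<epsilon> by simp
qed

text \<open>Put y = V^2 + \<mu> V^4. A bound G \<le> -\<delta> near 0 gives 2 t y' \<le> -\<delta>,
  hence y \<ge> (\<delta>/2) log (a/t). The same bound trades one factor of y'^2 in the energy of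
  V^2 for a constant over t, leaving -y' / (1 + 4 \<mu> y) below a multiple of the energy density;
  integration bounds log (1 + 4 \<mu> y) uniformly, so y cannot tend to infinity.\<close>

lemma V_zero:
  assumes "0 < t0"
  shows "V t0 = 0"
proof (rule ccontr)
  assume nz: "V t0 \<noteq> 0"
  define a where "a = t0 / 2"
  have a: "0 < a" "a < t0" using assms by (auto simp: a_def)
  \<comment> \<open>Strict negativity comes from here: V does not vanish at \<open>t0\<close>, so
    \<open>G\<close> grows by a positive amount between \<open>a\<close> and \<open>t0\<close>,
    where it is at most 0.\<close>
  have "integral {a..t0} (\<lambda>t. (V t)\<^sup>2) \<noteq> 0"
  proof
    assume "integral {a..t0} (\<lambda>t. (V t)\<^sup>2) = 0"
    then have "\<forall>t\<in>{a..t0}. (V t)\<^sup>2 = 0"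
      using a by (subst (asm) integral_eq_0_iff) (auto intro!: continuous_intros cont)
    then show False using nz a by auto
  qed
  then have "0 < integral {a..t0} (\<lambda>t. (V t)\<^sup>2)" using V_sq_integral_nonneg[OF a(1), of t0] by linarith
  then have Ga: "G a < 0" using G_increase[OF a(1), of t0] G_nonpos[OF assms] a by linarith
  define \<delta> where "\<delta> = - G a"
  have \<delta>: "0 < \<delta>" using Ga by (simp add: \<delta>_def)
  define y where "y = (\<lambda>t. (V t)\<^sup>2 + \<mu> * (V t) ^ 4)"
  define y' where "y' = (\<lambda>t. 2 * (V t * V' t) * (1 + 2 * \<mu> * (V t)\<^sup>2))"
  have y: "(y has_real_derivative y' t) (at t)" if "0 < t" for t
    unfolding y_def by (rule derivative_eq_intros refl V that)+ (simp add: y'_def algebra_simps eval_nat_numeral)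
  have y0: "0 \<le> y t" for t using pos by (simp add: y_def)
  \<comment> \<open>The discriminant of the quadratic equation for V^2 in terms of y; it allows y'^2
    to be written as 4 (V V')^2 (1 + 4 \<mu> y), in which V V' is the quantity with finite
    energy.\<close>
  have y1: "1 + 4 * \<mu> * y t = (1 + 2 * \<mu> * (V t)\<^sup>2)\<^sup>2" for t
    by (simp add: y_def algebra_simps power2_eq_square eval_nat_numeral)
  have y'\<delta>: "2 * t * y' t \<le> - \<delta>" if t: "0 < t" "t \<le> a" for t
  proof -
    have "2 * t * y' t = G t - 2 * \<mu> * sqrt q * ((V t) ^ 4 * H t)"
      by (simp add: G_def y'_def algebra_simps)
    moreover have "0 \<le> 2 * \<mu> * sqrt q * ((V t) ^ 4 * H t)" using pos H_bounds[of t] t by simp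
    ultimately show ?thesis using G_mono[OF t] unfolding \<delta>_def by linarith
  qed
  define L where "L = (\<lambda>t. ln (1 + 4 * \<mu> * y t))"
  have L: "(L has_real_derivative 4 * \<mu> * y' t / (1 + 4 * \<mu> * y t)) (at t)" if "0 < t" for t
  proof -
    have "0 < 1 + 4 * \<mu> * y t" using y0[of t] pos by (simp add: add_pos_nonneg)
    then show ?thesis unfolding L_def
      by (auto intro!: derivative_eq_intros y[OF that])
  qed
  have Lbound: "L s \<le> L a + 32 * \<mu> / \<delta> * C" if s: "0 < s" "s \<le> a" for s
  proof -
    have I: "((\<lambda>t. - (4 * \<mu> * y' t / (1 + 4 * \<mu> * y t))) has_integral - (L a - L s)) {s..a}"
    proof (intro has_integral_neg fundamental_theorem_of_calculus s(2))
      fix t assume "t \<in> {s..a}"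
      then have "0 < t" using s by simp
      from L[OF this] show "(L has_vector_derivative 4 * \<mu> * y' t / (1 + 4 * \<mu> * y t)) (at t within {s..a})"
        by (simp add: has_field_derivative_at_within flip: has_real_derivative_iff_has_vector_derivative)
    qed
    have i: "(\<lambda>t. 32 * \<mu> / \<delta> * (t * (V t * V' t)\<^sup>2)) integrable_on {s..a}"
      by (intro integrable_continuous_real continuous_intros cont s)
    have "- (L a - L s) \<le> integral {s..a} (\<lambda>t. 32 * \<mu> / \<delta> * (t * (V t * V' t)\<^sup>2))"
    proof (rule has_integral_le[OF I integrable_integral[OF i]])
      fix t assume "t \<in> {s..a}"
      then have t: "0 < t" "t \<le> a" using s by auto
      have d: "0 < 1 + 4 * \<mu> * y t" using y0[of t] pos by (simp add: add_pos_nonneg)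
      have "y' t \<le> 0" using y'\<delta>[OF t] t \<delta> by (smt (verit) mult_nonneg_nonneg)
      \<comment> \<open>Both factors are nonnegative, and \<delta> is replaced by the larger -2 t
        y'; this produces the square of y' with the weight t of the energy.\<close>
      then have "(- y' t) * \<delta> \<le> (- y' t) * (- (2 * t * y' t))"
        using y'\<delta>[OF t] by (intro mult_left_mono) auto
      also have "\<dots> = 2 * t * (y' t)\<^sup>2" by (simp add: power2_eq_square)
      also have "\<dots> = 8 * (t * (V t * V' t)\<^sup>2) * (1 + 4 * \<mu> * y t)"
        unfolding y1 by (simp add: y'_def power_mult_distrib)
      finally have "- y' t / (1 + 4 * \<mu> * y t) \<le> 8 / \<delta> * (t * (V t * V' t)\<^sup>2)"
        using d \<delta> by (simp add: field_simps)
      then have "4 * \<mu> * (- y' t / (1 + 4 * \<mu> * y t)) \<le> 4 * \<mu> * (8 / \<delta> * (t * (V t * V' t)\<^sup>2))"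
        using pos by (intro mult_left_mono) auto
      then show "- (4 * \<mu> * y' t / (1 + 4 * \<mu> * y t)) \<le> 32 * \<mu> / \<delta> * (t * (V t * V' t)\<^sup>2)" by simp
    qed
    also have "\<dots> = 32 * \<mu> / \<delta> * integral {s..a} (\<lambda>t. t * (V t * V' t)\<^sup>2)" by simp
    also have "\<dots> \<le> 32 * \<mu> / \<delta> * C"
      using C4[OF s] pos \<delta> by (intro mult_left_mono) auto
    finally show ?thesis by simp
  qed
  have ybound: "\<delta> / 2 * (ln a - ln s) \<le> y s" if s: "0 < s" "s \<le> a" for s
  proof -
    have "y a + \<delta> / 2 * ln a \<le> y s + \<delta> / 2 * ln s"
    proof (rule DERIV_nonpos_imp_nonincreasing[OF s(2)])
      fix t assume t: "s \<le> t" "t \<le> a"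
      then have t0: "0 < t" using s by simp
      have "((\<lambda>t. y t + \<delta> / 2 * ln t) has_real_derivative y' t + \<delta> / 2 * (1 / t)) (at t)"
        using t0 by (auto intro!: derivative_eq_intros y simp: field_simps)
      moreover have "y' t + \<delta> / 2 * (1 / t) \<le> 0"
        using y'\<delta>[OF t0 t(2)] t0 by (simp add: field_simps)
      ultimately show "\<exists>z. ((\<lambda>t. y t + \<delta> / 2 * ln t) has_real_derivative z) (at t) \<and> z \<le> 0" by blast
    qed
    then show ?thesis using y0[of a] by (simp add: algebra_simps)
  qed
  define M where "M = exp (L a + 32 * \<mu> / \<delta> * C)"
  have M: "0 < M" by (simp add: M_def)
  \<comment> \<open>With log (a/s) = M / (2 \<mu> \<delta>) the logarithmic lower bound reads 4
    \<mu> y s \<ge> M, against 1 + 4 \<mu> y s \<le> M from the energy.\<close>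
  define s where "s = a * exp (- (M / (2 * \<mu> * \<delta>)))"
  have s: "0 < s" "s \<le> a" using a M pos \<delta> by (auto simp: s_def mult_le_cancel_left1)
  have "ln s = ln a - M / (2 * \<mu> * \<delta>)" using a by (simp add: s_def ln_mult)
  then have "\<delta> / 2 * (M / (2 * \<mu> * \<delta>)) \<le> y s" using ybound[OF s] by simp
  then have "M / (4 * \<mu>) \<le> y s" using \<delta> by simp
  then have "M \<le> 4 * \<mu> * y s" using pos by (simp add: field_simps)
  moreover have "1 + 4 * \<mu> * y s \<le> M"
  proof -
    have "0 < 1 + 4 * \<mu> * y s" using y0[of s] pos by (simp add: add_pos_nonneg)
    then have "1 + 4 * \<mu> * y s = exp (L s)" by (simp add: L_def)
    also have "\<dots> \<le> M" unfolding M_def using Lbound[OF s] by simp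
    finally show ?thesis .
  qed
  ultimately show False by simp
qed

end

section \<open>The weak formulation in the squared radius\<close>

lemma set_integral_le_integral:
  fixes f :: "R2 \<Rightarrow> real"
  assumes f: "integrable lebesgue f" "\<And>x. 0 \<le> f x"
  shows "(LINT x:annulus a b|lebesgue. f x) \<le> (LINT x|lebesgue. f x)"
    and "0 \<le> (LINT x:annulus a b|lebesgue. f x)"
proof -
  have i: "integrable lebesgue (\<lambda>x. indicator (annulus a b) x *\<^sub>R f x)"
    using set_integrable_subset[of lebesgue UNIV f "annulus a b"] f(1) by (simp add: set_integrable_def)
  show "(LINT x:annulus a b|lebesgue. f x) \<le> (LINT x|lebesgue. f x)"
    unfolding set_lebesgue_integral_def
    by (rule integral_mono[OF i f(1)]) (use f(2) in \<open>auto split: split_indicator\<close>)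
  show "0 \<le> (LINT x:annulus a b|lebesgue. f x)"
    unfolding set_lebesgue_integral_def
    by (rule integral_nonneg_AE) (use f(2) in \<open>auto split: split_indicator\<close>)
qed

lemma integrable_imp_annularly_integrable:
  assumes "integrable lebesgue f"
  shows "annularly_integrable f"
  unfolding annularly_integrable_def
proof (intro allI impI)
  show "set_integrable lebesgue (annulus a b) f" for a b
    using set_integrable_subset[of lebesgue UNIV f "annulus a b"] assms by (simp add: set_integrable_def)
qed

lemma integral_radial_bound:
  fixes f :: "R2 \<Rightarrow> real"
  assumes f: "integrable lebesgue f" "\<And>x. 0 \<le> f x" and ae: "AE x in lebesgue. f x = F (x \<bullet> x)"
    and F: "continuous_on {0<..} F" and ab: "0 < a" "a \<le> b"
  shows "integral {a..b} F \<le> (LINT x|lebesgue. f x) / pi"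
  using annulus_integral_AE_radial[OF ae integrable_imp_annularly_integrable[OF f(1)] F ab]
    set_integral_le_integral(1)[OF f, of a b]
  by (simp add: field_simps)

lemma borel_measurable_lebesgue_AE:
  fixes f g :: "'a::euclidean_space \<Rightarrow> real"
  assumes f: "f \<in> borel_measurable lebesgue" and ae: "AE x in lebesgue. f x = g x"
  shows "g \<in> borel_measurable lebesgue"
proof (rule measurableI)
  fix S :: "real set" assume S: "S \<in> sets borel"
  show "g -` S \<inter> space lebesgue \<in> sets lebesgue"
  proof (rule completion.in_sets_AE)
    show "f -` S \<inter> space lebesgue \<in> sets lebesgue" using f S by (rule measurable_sets)
    show "AE x in lebesgue. (x \<in> f -` S \<inter> space lebesgue) = (x \<in> g -` S \<inter> space lebesgue)"
      using ae by (rule eventually_mono) auto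
  qed auto
qed auto

lemma hu_nonneg: "0 \<le> hu u s"
  unfolding hu_def set_lebesgue_integral_def
  by (rule integral_nonneg_AE) (auto split: split_indicator)

lemma tail_potential_nonneg:
  assumes "0 \<le> \<mu>" "0 \<le> t"
  shows "0 \<le> tail_potential \<mu> u t"
  unfolding tail_potential_def set_lebesgue_integral_def
  by (rule integral_nonneg_AE) (use assms hu_nonneg in \<open>auto split: split_indicator intro!: mult_nonneg_nonneg add_nonneg_nonneg divide_nonneg_nonneg\<close>)

section \<open>The function \<open>hu\<close> in the squared radius\<close>

lemma sqrt_image_null:
  assumes "N \<in> null_sets lebesgue" "N \<subseteq> {0<..}"
  shows "sqrt ` N \<in> null_sets lebesgue"
proof -
  have "sqrt differentiable_on N"
    unfolding differentiable_on_def
  proof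
    fix t assume "t \<in> N"
    then have "0 < t" using assms(2) by auto
    then have "(sqrt has_real_derivative inverse (sqrt t) / 2) (at t within N)"
      using DERIV_real_sqrt has_field_derivative_at_within by blast
    then show "sqrt differentiable (at t within N)"
      by (metis differentiable_def has_field_derivative_def)
  qed
  with assms(1) show ?thesis
    using negligible_differentiable_image_negligible[of N sqrt] by (simp add: negligible_iff_null_sets)
qed

text \<open>\<open>hu\<close> integrates from 0 while \<open>cumulative\<close> starts at 1, so they
  differ by a limit at 0 that has to be shown to exist. It does because the primitive
  \<open>F\<close> in the radius r is monotone and bounded. The fundamental theorem for nonnegative
  integrands on an open interval then gives integrability near 0 together with the value. The
  exceptional set of \<open>profile\<close> is given in t = r^2 and is carried to r by the square
  root.\<close>

lemma hu_primitive:
  assumes u2: "integrable lebesgue (\<lambda>x. (u x)\<^sup>2)"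
    and ae: "AE x in lebesgue. u x = V (x \<bullet> x)" and V: "continuous_on {0<..} V"
    and null: "{t. 0 < t \<and> profile u (sqrt t) \<noteq> V t} \<in> null_sets lebesgue"
  shows "\<And>t. 0 < t \<Longrightarrow> ((\<lambda>t. hu u (sqrt t)) has_real_derivative (V t)\<^sup>2 / 2) (at t)"
    and "\<And>t. 0 < t \<Longrightarrow> hu u (sqrt t) \<le> (LINT x|lebesgue. (u x)\<^sup>2) / pi"
proof -
  define f where "f = (\<lambda>x. (u x)\<^sup>2)"
  define I where "I = (LINT x|lebesgue. (u x)\<^sup>2)"
  have f: "integrable lebesgue f" "\<And>x. 0 \<le> f x" using u2 by (auto simp: f_def)
  have fa: "annularly_integrable f" using f(1) by (rule integrable_imp_annularly_integrable)
  have aef: "AE x in lebesgue. f x = (V (x \<bullet> x))\<^sup>2"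
    using ae by (rule eventually_mono) (simp add: f_def)
  have cV2: "continuous_on {0<..} (\<lambda>t. (V t)\<^sup>2)" by (intro continuous_intros V)
  have D: "(cumulative f has_real_derivative pi * (V t)\<^sup>2) (at t)" if "0 < t" for t
  proof (rule cumulative_DERIV[OF fa _ _ that])
    show "continuous_on {0<..} (\<lambda>t. pi * (V t)\<^sup>2)" by (intro continuous_intros V)
    show "(LINT x:annulus a b|lebesgue. f x) = integral {a..b} (\<lambda>t. pi * (V t)\<^sup>2)" if "0 < a" "a < b" for a b
      by (rule annulus_integral_AE_radial[OF aef fa cV2 that(1) less_imp_le[OF that(2)]])
  qed
  have bnd: "\<bar>cumulative f t\<bar> \<le> I" for t
    using set_integral_le_integral[OF f, of 1 t] set_integral_le_integral[OF f, of t 1]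
    by (auto simp: cumulative_def I_def f_def)
  define F where "F = (\<lambda>r. cumulative f (r\<^sup>2) / (2 * pi))"
  have DF: "(F has_real_derivative r * (V (r\<^sup>2))\<^sup>2) (at r)" if "0 < r" for r
  proof -
    have "((\<lambda>r. cumulative f (r\<^sup>2)) has_real_derivative pi * (V (r\<^sup>2))\<^sup>2 * (2 * r)) (at r)"
      by (rule DERIV_chain2[OF D]) (use that in \<open>auto intro!: derivative_eq_intros\<close>)
    from DERIV_cdivide[OF this, of "2 * pi"] show ?thesis unfolding F_def by (simp add: field_simps)
  qed
  \<comment> \<open>The limit of \<open>F\<close> at 0 from the right, written in the shape in which
    \<open>Lim_right_bound\<close> delivers it.\<close>
  define A where "A = Inf (F ` ({0<..} \<inter> {0<..}))"
  have Fmono: "F r \<le> F s" if "0 < r" "r \<le> s" for r s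
  proof (rule DERIV_nonneg_imp_nondecreasing[OF that(2)])
    fix x assume "r \<le> x" "x \<le> s"
    then have "0 < x" using that by simp
    then show "\<exists>y. (F has_real_derivative y) (at x) \<and> 0 \<le> y"
      by (intro exI[of _ "x * (V (x\<^sup>2))\<^sup>2"] conjI DF) auto
  qed
  have Fge: "- I / (2 * pi) \<le> F r" for r
    unfolding F_def using bnd[of "r\<^sup>2"] by (intro divide_right_mono) auto
  have "(F \<longlongrightarrow> A) (at 0 within ({0<..} \<inter> {0<..}))"
    unfolding A_def by (rule Lim_right_bound[OF Fmono Fge]) auto
  then have lim0: "(F \<longlongrightarrow> A) (at_right 0)" by simp
  have AI: "- I / (2 * pi) \<le> A"
    by (rule tendsto_lowerbound[OF lim0]) (use Fge in auto)
  have hu_eq: "hu u s = F s - A" if s: "0 < s" for s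
  proof -
    let ?k = "\<lambda>r. r * (V (r\<^sup>2))\<^sup>2"
    have ck: "isCont ?k r" if "0 < r" for r
    proof -
      have "isCont V (r\<^sup>2)" using V that by (simp add: continuous_on_eq_continuous_at)
      then have "isCont (\<lambda>r. V (r\<^sup>2)) r"
        by (rule isCont_o2[where f = "\<lambda>r. r\<^sup>2" and g = V, rotated]) (intro continuous_intros)
      then show ?thesis by (intro continuous_mult continuous_power continuous_ident)
    qed
    have FTC: "set_integrable lborel (einterval 0 s) ?k" "(LBINT x=0..s. ?k x) = F s - A"
    proof -
      have 1: "(0::ereal) < ereal s" using s by simp
      have 2: "DERIV F x :> ?k x" "isCont ?k x" if "0 < ereal x" "ereal x < ereal s" for x
        using DF[of x] ck[of x] that by simp_all
      have 3: "AE x in lborel. 0 < ereal x \<longrightarrow> ereal x < ereal s \<longrightarrow> 0 \<le> ?k x" by simp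
      have 4: "((F \<circ> real_of_ereal) \<longlongrightarrow> A) (at_right 0)"
        using lim0 by (simp add: zero_ereal_def ereal_tendsto_simps)
      have "(F \<longlongrightarrow> F s) (at_left s)"
        using DERIV_isCont[OF DF[OF s]] by (simp add: isCont_def filterlim_at_split)
      then have 5: "((F \<circ> real_of_ereal) \<longlongrightarrow> F s) (at_left (ereal s))"
        by (simp add: ereal_tendsto_simps)
      show "set_integrable lborel (einterval 0 s) ?k" "(LBINT x=0..s. ?k x) = F s - A"
        using interval_integral_FTC_nonneg[OF 1 2 3 4 5] by simp_all
    qed
    have ein: "einterval 0 (ereal s) = {0<..<s}" by (auto simp: einterval_def)
    have iI: "set_integrable lborel {0<..<s} ?k" using FTC(1) ein by simp
    have val: "(LINT r:{0<..<s}|lborel. ?k r) = F s - A"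
      using FTC(2) s ein by (simp add: interval_lebesgue_integral_def)
    have "sqrt ` {t. 0 < t \<and> profile u (sqrt t) \<noteq> V t} \<in> null_sets lebesgue"
      by (rule sqrt_image_null[OF null]) auto
    from AE_not_in[OF this] have "AE r in lebesgue. 0 < r \<longrightarrow> profile u r = V (r\<^sup>2)"
    proof (rule eventually_mono)
      fix r assume r: "r \<notin> sqrt ` {t. 0 < t \<and> profile u (sqrt t) \<noteq> V t}"
      show "0 < r \<longrightarrow> profile u r = V (r\<^sup>2)"
      proof (rule impI, rule ccontr)
        assume "0 < r" "profile u r \<noteq> V (r\<^sup>2)"
        then have "r \<in> sqrt ` {t. 0 < t \<and> profile u (sqrt t) \<noteq> V t}"
          by (intro image_eqI[of _ _ "r\<^sup>2"]) auto
        with r show False by simp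
      qed
    qed
    moreover have "AE r::real in lebesgue. r \<noteq> 0" "AE r::real in lebesgue. r \<noteq> s"
      using AE_not_in[of "{0::real}" lebesgue] AE_not_in[of "{s}" lebesgue] by (auto simp: null_sets_def)
    ultimately have aek: "AE r in lebesgue. indicator {0..s} r *\<^sub>R (r * (profile u r)\<^sup>2) = indicator {0<..<s} r *\<^sub>R ?k r"
      by eventually_elim (auto split: split_indicator)
    have mk: "(\<lambda>r. indicator {0<..<s} r *\<^sub>R ?k r) \<in> borel_measurable lborel"
      using iI by (simp add: set_integrable_def)
    have "hu u s = (LINT r|lebesgue. indicator {0<..<s} r *\<^sub>R ?k r)"
      unfolding hu_def set_lebesgue_integral_def
    proof (rule integral_cong_AE[OF _ _ aek])
      show m: "(\<lambda>r. indicator {0<..<s} r *\<^sub>R ?k r) \<in> borel_measurable lebesgue"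
        using mk by (rule measurable_completion)
      show "(\<lambda>r. indicator {0..s} r *\<^sub>R (r * (profile u r)\<^sup>2)) \<in> borel_measurable lebesgue"
        by (rule borel_measurable_lebesgue_AE[OF m]) (rule eventually_mono[OF aek sym])
    qed
    then show ?thesis using val mk by (simp add: integral_completion set_lebesgue_integral_def)
  qed
  have eq: "cumulative f t / (2 * pi) - A = hu u (sqrt t)" if "0 < t" for t
    using hu_eq[of "sqrt t"] that by (simp add: F_def)
  show "((\<lambda>t. hu u (sqrt t)) has_real_derivative (V t)\<^sup>2 / 2) (at t)" if "0 < t" for t
  proof -
    have "((\<lambda>t. cumulative f t / (2 * pi) - A) has_real_derivative (V t)\<^sup>2 / 2) (at t)"
      using that by (auto intro!: derivative_eq_intros D)
    then show ?thesis
      by (rule has_field_derivative_transform_within_open[of _ _ _ "{0<..}"]) (use that eq in auto)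
  qed
  show "hu u (sqrt t) \<le> (LINT x|lebesgue. (u x)\<^sup>2) / pi" if "0 < t" for t
  proof -
    \<comment> \<open>Both \<open>F\<close> and its limit \<open>A\<close> are at least -I / (2 pi),
      and \<open>F\<close> is at most I / (2 pi); this costs a factor 2 compared with the sharp
      bound, which is harmless.\<close>
    have "hu u (sqrt t) \<le> I / (2 * pi) - (- I / (2 * pi))"
      unfolding eq[OF that, symmetric] using AI bnd[of t] by (intro diff_mono divide_right_mono) auto
    then show ?thesis by (simp add: I_def field_simps)
  qed
qed

section \<open>The flux of a weak solution and its regularity\<close>

lemma integrable_of_annulus:
  fixes h :: "R2 \<Rightarrow> real"
  assumes "set_integrable lebesgue (annulus a b) h" "\<And>x. x \<bullet> x \<notin> {a<..<b} \<Longrightarrow> h x = 0"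
  shows "integrable lebesgue h"
proof -
  have "indicator (annulus a b) x *\<^sub>R h x = h x" for x
    using assms(2)[of x] by (cases "x \<in> annulus a b") (auto simp: annulus_def)
  then have "(\<lambda>x. indicator (annulus a b) x *\<^sub>R h x) = h" by (rule ext)
  with assms(1) show ?thesis unfolding set_integrable_def by (simp only:)
qed

text \<open>The weak formulation yields integrability only after multiplication by a test function.
  A bump on (a/2, 2b) is positive on [a, b], so its reciprocal is continuous there and can be
  multiplied back.\<close>

lemma annularly_integrable_of_tests:
  assumes "\<And>\<psi> a b. smooth_real \<psi> \<Longrightarrow> 0 < a \<Longrightarrow> a < b \<Longrightarrow> (\<And>t. t \<notin> {a..b} \<Longrightarrow> \<psi> t = 0) \<Longrightarrow>
    integrable lebesgue (\<lambda>x. \<psi> (x \<bullet> x) * R x)"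
  shows "annularly_integrable R"
  unfolding annularly_integrable_def
proof (intro allI impI)
  fix a b :: real assume a: "0 < a"
  show "set_integrable lebesgue (annulus a b) R"
  proof (cases "a \<le> b")
    case False
    then have "annulus a b = {}" by (auto simp: annulus_def)
    then show ?thesis by simp
  next
    case True
    let ?\<psi> = "bump 1 (a / 2) (2 * b)"
    have ab: "0 < a / 2" "a / 2 < 2 * b" using a True by auto
    have "integrable lebesgue (\<lambda>x. ?\<psi> (x \<bullet> x) * R x)"
      by (rule assms[OF smooth_bump ab]) (use ab in \<open>auto intro: bump_outside\<close>)
    from integrable_imp_annularly_integrable[OF this]
    have i: "set_integrable lebesgue (annulus a b) (\<lambda>x. ?\<psi> (x \<bullet> x) * R x)"
      using a by (simp add: annularly_integrable_def)
    have pos: "?\<psi> t \<noteq> 0" if "t \<in> {a..b}" for t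
      using bump_pos[of 1 t "a / 2" "2 * b"] that a by force
    have "continuous_on {a..b} (\<lambda>t. 1 / ?\<psi> t)"
      by (intro continuous_intros continuous_bump) (use pos in auto)
    from annulus_mult_integrable[OF i this]
    have "set_integrable lebesgue (annulus a b) (\<lambda>x. 1 / ?\<psi> (x \<bullet> x) * (?\<psi> (x \<bullet> x) * R x))" .
    moreover have "set_integrable lebesgue (annulus a b) (\<lambda>x. 1 / ?\<psi> (x \<bullet> x) * (?\<psi> (x \<bullet> x) * R x))
        \<longleftrightarrow> set_integrable lebesgue (annulus a b) R"
      by (rule set_integrable_cong) (use pos in \<open>auto simp: annulus_def\<close>)
    ultimately show ?thesis by blast
  qed
qed

text \<open>Everything in the weak formulation except the term containing \<open>grad \<phi>\<close>.\<close>

definition lower_order :: "real \<Rightarrow> real \<Rightarrow> real \<Rightarrow> real \<Rightarrow> real \<Rightarrow> (R2 \<Rightarrow> real) \<Rightarrow> R2 \<Rightarrow> real" where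
  "lower_order p \<mu> q lam \<omega> u x = 2 * \<mu> * u x * (norm (weak_gradient u x))\<^sup>2
     + \<omega> * u x
     - lam * \<bar>u x\<bar> powr (p - 1) * u x
     + q * ((hu u (norm x))\<^sup>2 / (norm x)\<^sup>2) * (1 + \<mu> * (u x)\<^sup>2) * u x
     + q * tail_potential \<mu> u (norm x) * u x"

text \<open>For the test function \<psi>(x . x) the gradient is 2 \<psi>' x, so the equation reads:
  the integral of \<psi>' f + \<psi> R vanishes. The part with \<open>f\<close> is integrable on its
  own, since u may be replaced by the continuous V in its coefficient; subtracting it gives
  integrability of \<psi> R and hence of \<open>R\<close> on annuli. Integration by parts and du
  Bois-Reymond follow.\<close>

lemma weak_solution_flux:
  assumes ws: "weak_solution p \<mu> q lam \<omega> u" and w: "has_weak_gradient u (weak_gradient u)"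
    and ae: "AE x in lebesgue. u x = V (x \<bullet> x)" and V: "continuous_on {0<..} V"
    and mu: "u \<in> borel_measurable lebesgue"
  defines "f \<equiv> \<lambda>x. 2 * (1 + 2 * \<mu> * (u x)\<^sup>2) * (weak_gradient u x \<bullet> x)"
  obtains c where "annularly_integrable f" "annularly_integrable (lower_order p \<mu> q lam \<omega> u)"
    "\<forall>a b. 0 < a \<longrightarrow> a < b \<longrightarrow> (LINT x:annulus a b|lebesgue. f x)
      = integral {a..b} (\<lambda>t. cumulative (lower_order p \<mu> q lam \<omega> u) t + c)"
proof -
  let ?g = "weak_gradient u"
  define R where "R = lower_order p \<mu> q lam \<omega> u"
  have ig: "annularly_integrable (\<lambda>x. ?g x \<bullet> x)"
    using w by (auto simp: has_weak_gradient_def locally_integrable_radial_part)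
  have i0: "annularly_integrable (\<lambda>x. 2 * (1 + 2 * \<mu> * (V (x \<bullet> x))\<^sup>2) * (?g x \<bullet> x))"
    by (rule annularly_integrable_radial_mult[OF ig, where F = "\<lambda>t. 2 * (1 + 2 * \<mu> * (V t)\<^sup>2)"])
      (intro continuous_intros V)
  have fi: "annularly_integrable f"
    unfolding annularly_integrable_def set_integrable_def
  proof (intro allI impI)
    fix a b :: real assume a: "0 < a"
    have m: "(\<lambda>x. indicator (annulus a b) x *\<^sub>R (2 * (1 + 2 * \<mu> * (V (x \<bullet> x))\<^sup>2) * (?g x \<bullet> x))) \<in> borel_measurable lebesgue"
      and i: "integrable lebesgue (\<lambda>x. indicator (annulus a b) x *\<^sub>R (2 * (1 + 2 * \<mu> * (V (x \<bullet> x))\<^sup>2) * (?g x \<bullet> x)))"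
      using i0 a by (auto simp: annularly_integrable_def set_integrable_def)
    have e: "AE x in lebesgue. indicator (annulus a b) x *\<^sub>R (2 * (1 + 2 * \<mu> * (V (x \<bullet> x))\<^sup>2) * (?g x \<bullet> x))
      = indicator (annulus a b) x *\<^sub>R f x"
      using ae by (rule eventually_mono) (simp add: f_def)
    show "integrable lebesgue (\<lambda>x. indicator (annulus a b) x *\<^sub>R f x)"
      by (rule integrable_cong_AE_imp[OF i borel_measurable_lebesgue_AE[OF m e]])
        (use e in \<open>eventually_elim, simp only:\<close>)
  qed
  have tests: "integrable lebesgue (\<lambda>x. \<psi> (x \<bullet> x) * R x)" (is ?i)
    "(LINT x:annulus a b|lebesgue. deriv \<psi> (x \<bullet> x) * f x) = - (LINT x:annulus a b|lebesgue. \<psi> (x \<bullet> x) * R x)" (is ?e)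
    if \<psi>: "smooth_real \<psi>" and ab: "0 < a" "a < b" and supp: "\<And>t. t \<notin> {a..b} \<Longrightarrow> \<psi> t = 0" for \<psi> a b
  proof -
    note z = smooth_real_support[OF \<psi> ab(2) supp]
    have ap: "annular_profile \<psi>" using \<psi> ab supp unfolding annular_profile_def by blast
    have sf: "set_integrable lebesgue (annulus a b) (\<lambda>x. deriv \<psi> (x \<bullet> x) * f x)"
      using fi ab by (intro annulus_mult_integrable smooth_real_continuous smooth_real_deriv \<psi>)
        (auto simp: annularly_integrable_def)
    have if': "integrable lebesgue (\<lambda>x. deriv \<psi> (x \<bullet> x) * f x)"
      by (rule integrable_of_annulus[OF sf]) (use z in simp)
    have "has_bochner_integral lebesgue
      (\<lambda>x. (1 + 2 * \<mu> * (u x)\<^sup>2) * (?g x \<bullet> grad (\<lambda>x. \<psi> (x \<bullet> x)) x)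
             + 2 * \<mu> * u x * (norm (?g x))\<^sup>2 * \<psi> (x \<bullet> x)
             + \<omega> * u x * \<psi> (x \<bullet> x)
             - lam * \<bar>u x\<bar> powr (p - 1) * u x * \<psi> (x \<bullet> x)
             + q * ((hu u (norm x))\<^sup>2 / (norm x)\<^sup>2) * (1 + \<mu> * (u x)\<^sup>2) * u x * \<psi> (x \<bullet> x)
             + q * tail_potential \<mu> u (norm x) * u x * \<psi> (x \<bullet> x)) 0"
      using ws test_function_radial[OF ap] radial_inner_self[of \<psi>] unfolding weak_solution_def by blast
    moreover have "(1 + 2 * \<mu> * (u x)\<^sup>2) * (?g x \<bullet> grad (\<lambda>x. \<psi> (x \<bullet> x)) x)
             + 2 * \<mu> * u x * (norm (?g x))\<^sup>2 * \<psi> (x \<bullet> x)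
             + \<omega> * u x * \<psi> (x \<bullet> x)
             - lam * \<bar>u x\<bar> powr (p - 1) * u x * \<psi> (x \<bullet> x)
             + q * ((hu u (norm x))\<^sup>2 / (norm x)\<^sup>2) * (1 + \<mu> * (u x)\<^sup>2) * u x * \<psi> (x \<bullet> x)
             + q * tail_potential \<mu> u (norm x) * u x * \<psi> (x \<bullet> x)
      = deriv \<psi> (x \<bullet> x) * f x + \<psi> (x \<bullet> x) * R x" for x
    proof -
      have "(1 + 2 * \<mu> * (u x)\<^sup>2) * (?g x \<bullet> grad (\<lambda>x. \<psi> (x \<bullet> x)) x) = deriv \<psi> (x \<bullet> x) * f x"
        by (simp add: grad_radial[OF \<psi>] f_def)
      moreover have "2 * \<mu> * u x * (norm (?g x))\<^sup>2 * \<psi> (x \<bullet> x)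
             + \<omega> * u x * \<psi> (x \<bullet> x)
             - lam * \<bar>u x\<bar> powr (p - 1) * u x * \<psi> (x \<bullet> x)
             + q * ((hu u (norm x))\<^sup>2 / (norm x)\<^sup>2) * (1 + \<mu> * (u x)\<^sup>2) * u x * \<psi> (x \<bullet> x)
             + q * tail_potential \<mu> u (norm x) * u x * \<psi> (x \<bullet> x) = \<psi> (x \<bullet> x) * R x"
        unfolding R_def lower_order_def by (simp only: ring_distribs mult_ac)
      ultimately show ?thesis by linarith
    qed
    ultimately have "has_bochner_integral lebesgue (\<lambda>x. deriv \<psi> (x \<bullet> x) * f x + \<psi> (x \<bullet> x) * R x) 0"
      by (simp only:)
    then have tot: "integrable lebesgue (\<lambda>x. deriv \<psi> (x \<bullet> x) * f x + \<psi> (x \<bullet> x) * R x)"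
      "(LINT x|lebesgue. deriv \<psi> (x \<bullet> x) * f x + \<psi> (x \<bullet> x) * R x) = 0"
      by (auto simp: has_bochner_integral_iff)
    from Bochner_Integration.integrable_diff[OF tot(1) if'] show ?i by simp
    from Bochner_Integration.integral_add[OF if' this] tot(2)
    have "(LINT x|lebesgue. deriv \<psi> (x \<bullet> x) * f x) = - (LINT x|lebesgue. \<psi> (x \<bullet> x) * R x)" by simp
    moreover have "(LINT x|lebesgue. deriv \<psi> (x \<bullet> x) * f x) = (LINT x:annulus a b|lebesgue. deriv \<psi> (x \<bullet> x) * f x)"
      by (rule integral_eq_annulus) (use z in simp)
    moreover have "(LINT x|lebesgue. \<psi> (x \<bullet> x) * R x) = (LINT x:annulus a b|lebesgue. \<psi> (x \<bullet> x) * R x)"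
      by (rule integral_eq_annulus) (use z in simp)
    ultimately show ?e by simp
  qed
  have Ri: "annularly_integrable R" by (rule annularly_integrable_of_tests) (rule tests(1))
  obtain c where c: "\<And>a b. 0 < a \<Longrightarrow> a < b \<Longrightarrow>
      (LINT x:annulus a b|lebesgue. f x) = integral {a..b} (\<lambda>t. cumulative R t + c)"
  proof (rule annulus_du_Bois_Reymond[OF fi continuous_cumulative[OF Ri]])
    fix \<psi> and a b :: real
    assume \<psi>: "smooth_real \<psi>" and ab: "0 < a" "a < b" and supp: "\<And>t. t \<notin> {a..b} \<Longrightarrow> \<psi> t = 0"
    show "(LINT x:annulus a b|lebesgue. deriv \<psi> (x \<bullet> x) * f x) = integral {a..b} (\<lambda>t. deriv \<psi> t * cumulative R t)"
      using tests(2)[OF \<psi> ab supp] annulus_by_parts_compact[OF Ri \<psi> ab supp] by linarith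
  qed blast
  show ?thesis
    by (rule that[OF fi]) (use Ri c in \<open>auto simp: R_def\<close>)
qed

text \<open>The flux has a continuous density, but V is differentiated through g . x. Passing from
  one to the other means dividing by the quasilinear coefficient, a continuous function of x . x
  that is bounded below, which \<open>annulus_orthogonal\<close> permits. Then both cumulative
  integrals in the formula for 2 pi t V are differentiable, and the quotient rule gives V'.\<close>

lemma weak_solution_C1:
  assumes w: "has_weak_gradient u g" and V: "continuous_on {0<..} V"
    and ae: "AE x in lebesgue. u x = V (x \<bullet> x)"
    and Veq: "\<forall>t>0. 2 * pi * t * V t = cumulative (\<lambda>x. 2 * u x) t + cumulative (\<lambda>x. g x \<bullet> x) t + c"
    and \<mu>: "0 < \<mu>" and W: "continuous_on {0<..} W"
    and fi: "annularly_integrable (\<lambda>x. 2 * (1 + 2 * \<mu> * (u x)\<^sup>2) * (g x \<bullet> x))"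
    and flux: "\<And>a b. 0 < a \<Longrightarrow> a < b \<Longrightarrow>
      (LINT x:annulus a b|lebesgue. 2 * (1 + 2 * \<mu> * (u x)\<^sup>2) * (g x \<bullet> x)) = integral {a..b} W"
    and t: "0 < t"
  shows "(V has_real_derivative W t / (4 * pi * t * (1 + 2 * \<mu> * (V t)\<^sup>2))) (at t)"
proof -
  define f where "f = (\<lambda>x. 2 * (1 + 2 * \<mu> * (u x)\<^sup>2) * (g x \<bullet> x))"
  \<comment> \<open>The reciprocal of the coefficient of g . x in the flux; multiplication by it
    recovers g . x from \<open>f\<close>.\<close>
  define \<theta> where "\<theta> = (\<lambda>t. 1 / (2 * (1 + 2 * \<mu> * (V t)\<^sup>2)))"
  have nz: "1 + 2 * \<mu> * (V t)\<^sup>2 > 0" for t using \<mu> by (simp add: add_pos_nonneg)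
  have nz2: "2 * (1 + 2 * \<mu> * (V t)\<^sup>2) \<noteq> 0" for t
    using mult_pos_pos[OF zero_less_numeral nz[of t]] by (rule less_imp_neq[THEN not_sym])
  have c\<theta>: "continuous_on {0<..} \<theta>"
    unfolding \<theta>_def by (intro continuous_intros V) (use nz2 in blast)
  have iu: "annularly_integrable u" and ig: "annularly_integrable (\<lambda>x. g x \<bullet> x)"
    using w by (auto simp: has_weak_gradient_def locally_integrable_radial_part
        locally_integrable_imp_annularly_integrable)
  have i2u: "annularly_integrable (\<lambda>x. 2 * u x)" using iu by (rule annularly_integrable_cmult)
  have iW: "annularly_integrable (\<lambda>x. W (x \<bullet> x) / pi)"
    by (rule annularly_integrable_radial[where F = "\<lambda>t. W t / pi"]) (intro continuous_intros W, simp)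
  have fi': "annularly_integrable f" using fi by (simp add: f_def)
  define k where "k = (\<lambda>x. f x - W (x \<bullet> x) / pi)"
  have ik: "annularly_integrable k" unfolding k_def by (rule annularly_integrable_diff[OF fi' iW])
  have k0: "(LINT x:annulus a b|lebesgue. k x) = 0" if ab: "0 < a" "a < b" for a b
  proof -
    have "(LINT x:annulus a b|lebesgue. W (x \<bullet> x) / pi) = pi * integral {a..b} (\<lambda>t. W t / pi)"
      using ab by (intro annulus_integral_radial(2) continuous_intros continuous_on_subset[OF W]) auto
    also have "\<dots> = integral {a..b} W" by simp
    finally show ?thesis unfolding k_def
      using set_integral_diff(2)[of lebesgue "annulus a b" f "\<lambda>x. W (x \<bullet> x) / pi"] fi' iW ab flux[OF ab]
      by (simp add: annularly_integrable_def f_def)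
  qed
  have cW: "continuous_on {0<..} (\<lambda>t. \<theta> t * W t)" by (intro continuous_intros c\<theta> W)
  have gk: "(LINT x:annulus a b|lebesgue. g x \<bullet> x) = integral {a..b} (\<lambda>t. \<theta> t * W t)" if ab: "0 < a" "a < b" for a b
  proof -
    have c\<theta>ab: "continuous_on {a..b} \<theta>" by (rule continuous_on_subset[OF c\<theta>]) (use ab in auto)
    have cWab: "continuous_on {a..b} W" by (rule continuous_on_subset[OF W]) (use ab in auto)
    have s1: "set_integrable lebesgue (annulus a b) (\<lambda>x. \<theta> (x \<bullet> x) * f x)"
      by (intro annulus_mult_integrable c\<theta>ab) (use fi' ab in \<open>auto simp: annularly_integrable_def\<close>)
    have s2: "set_integrable lebesgue (annulus a b) (\<lambda>x. \<theta> (x \<bullet> x) * (W (x \<bullet> x) / pi))"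
      by (intro annulus_mult_integrable c\<theta>ab) (use iW ab in \<open>auto simp: annularly_integrable_def\<close>)
    have "0 = (LINT x:annulus a b|lebesgue. \<theta> (x \<bullet> x) * k x)"
      using annulus_orthogonal[OF ik k0 ab(1) less_imp_le[OF ab(2)] c\<theta>ab] by simp
    also have "\<dots> = (LINT x:annulus a b|lebesgue. \<theta> (x \<bullet> x) * f x) - (LINT x:annulus a b|lebesgue. \<theta> (x \<bullet> x) * (W (x \<bullet> x) / pi))"
      unfolding k_def right_diff_distrib by (rule set_integral_diff(2)[OF s1 s2])
    also have "(LINT x:annulus a b|lebesgue. \<theta> (x \<bullet> x) * (W (x \<bullet> x) / pi)) = pi * integral {a..b} (\<lambda>t. \<theta> t * (W t / pi))"
      using ab by (intro annulus_integral_radial(2) continuous_intros c\<theta>ab cWab) auto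
    also have "\<dots> = integral {a..b} (\<lambda>t. \<theta> t * W t)" by simp
    also have "(LINT x:annulus a b|lebesgue. \<theta> (x \<bullet> x) * f x) = (LINT x:annulus a b|lebesgue. g x \<bullet> x)"
      unfolding set_lebesgue_integral_def
    proof (rule integral_cong_AE)
      show "(\<lambda>x. indicator (annulus a b) x *\<^sub>R (\<theta> (x \<bullet> x) * f x)) \<in> borel_measurable lebesgue"
        using s1 by (auto simp: set_integrable_def)
      show "(\<lambda>x. indicator (annulus a b) x *\<^sub>R (g x \<bullet> x)) \<in> borel_measurable lebesgue"
        using ig ab by (auto simp: annularly_integrable_def set_integrable_def)
      show "AE x in lebesgue. indicator (annulus a b) x *\<^sub>R (\<theta> (x \<bullet> x) * f x) = indicator (annulus a b) x *\<^sub>R (g x \<bullet> x)"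
        using ae
      proof (rule eventually_mono)
        fix x assume "u x = V (x \<bullet> x)"
        then show "indicator (annulus a b) x *\<^sub>R (\<theta> (x \<bullet> x) * f x) = indicator (annulus a b) x *\<^sub>R (g x \<bullet> x)"
          using nz[of "x \<bullet> x"] by (simp add: \<theta>_def f_def)
      qed
    qed
    finally show ?thesis by simp
  qed
  have dg: "(cumulative (\<lambda>x. g x \<bullet> x) has_real_derivative \<theta> t * W t) (at t)"
    by (rule cumulative_DERIV[OF ig cW gk t])
  have d2u: "(cumulative (\<lambda>x. 2 * u x) has_real_derivative (\<lambda>t. pi * (2 * V t)) t) (at t)"
  proof (rule cumulative_DERIV[OF i2u _ _ t])
    show "continuous_on {0<..} (\<lambda>t. pi * (2 * V t))" by (intro continuous_intros V)
    show "(LINT x:annulus a b|lebesgue. 2 * u x) = integral {a..b} (\<lambda>t. pi * (2 * V t))" if "0 < a" "a < b" for a b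
      by (rule annulus_integral_AE_radial[OF _ i2u]) (use ae that V in \<open>auto intro!: continuous_intros\<close>)
  qed
  define N where "N = (\<lambda>t. cumulative (\<lambda>x. 2 * u x) t + cumulative (\<lambda>x. g x \<bullet> x) t + c)"
  have dN: "(N has_real_derivative 2 * pi * V t + \<theta> t * W t) (at t)"
    unfolding N_def by (rule derivative_eq_intros dg d2u refl)+ simp
  have Nt: "N t = 2 * pi * t * V t" using Veq t by (simp add: N_def)
  have "((\<lambda>s. N s / (2 * pi * s)) has_real_derivative
      ((2 * pi * V t + \<theta> t * W t) * (2 * pi * t) - N t * (2 * pi)) / ((2 * pi * t) * (2 * pi * t))) (at t)"
    by (rule derivative_eq_intros dN refl | use t in simp)+
  moreover have "((2 * pi * V t + \<theta> t * W t) * (2 * pi * t) - N t * (2 * pi)) / ((2 * pi * t) * (2 * pi * t))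
      = W t / (4 * pi * t * (1 + 2 * \<mu> * (V t)\<^sup>2))"
  proof -
    have "(2 * pi * V t + \<theta> t * W t) * (2 * pi * t) - N t * (2 * pi) = \<theta> t * W t * (2 * pi * t)"
      unfolding Nt by (simp add: algebra_simps)
    then have "((2 * pi * V t + \<theta> t * W t) * (2 * pi * t) - N t * (2 * pi)) / ((2 * pi * t) * (2 * pi * t))
      = \<theta> t * W t / (2 * pi * t)" using t by (simp add: mult_ac)
    then show ?thesis by (simp add: \<theta>_def mult_ac)
  qed
  ultimately have "((\<lambda>s. N s / (2 * pi * s)) has_real_derivative W t / (4 * pi * t * (1 + 2 * \<mu> * (V t)\<^sup>2))) (at t)" by simp
  then show ?thesis
  proof (rule has_field_derivative_transform_within_open[of _ _ _ "{0<..}"])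
    show "N s / (2 * pi * s) = V s" if "s \<in> {0<..}" for s
      using Veq that by (simp add: N_def flip: Veq[rule_format])
  qed (use t in auto)
qed

section \<open>Nonexistence\<close>

lemma weak_gradient_has_weak_gradient:
  assumes "u \<in> H1"
  shows "has_weak_gradient u (weak_gradient u)"
proof -
  have "\<exists>g. has_weak_gradient u g" using assms by (auto simp: H1_def)
  then show ?thesis unfolding weak_gradient_def by (rule someI_ex)
qed

text \<open>Only the radial part of the weak gradient is under control, so its square is bounded below by
  expanding \<open>|g - 2 V' x|\<^sup>2 \<ge> 0\<close>.\<close>

lemma lower_order_test_bound:
  fixes u :: "R2 \<Rightarrow> real"
  assumes ux: "u x = V (x \<bullet> x)" and \<mu>: "0 < \<mu>" and q: "0 < q"
  shows "8 * \<mu> * (V (x \<bullet> x))\<^sup>2 * V' (x \<bullet> x) * (weak_gradient u x \<bullet> x)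
      + (\<omega> * (V (x \<bullet> x))\<^sup>2 - lam * \<bar>V (x \<bullet> x)\<bar> powr (p - 1) * (V (x \<bullet> x))\<^sup>2
        + q * ((hu u (sqrt (x \<bullet> x)))\<^sup>2 / (x \<bullet> x)) * (1 + \<mu> * (V (x \<bullet> x))\<^sup>2) * (V (x \<bullet> x))\<^sup>2
        - 8 * \<mu> * (x \<bullet> x) * (V (x \<bullet> x) * V' (x \<bullet> x))\<^sup>2)
    \<le> V (x \<bullet> x) * lower_order p \<mu> q lam \<omega> u x"
proof -
  define t where "t = x \<bullet> x"
  define g where "g = weak_gradient u x"
  have n: "norm x = sqrt t" "(norm x)\<^sup>2 = t" by (simp_all add: t_def norm_eq_sqrt_inner)
  have "0 \<le> (norm (g - (2 * V' t) *\<^sub>R x))\<^sup>2" by simp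
  also have "\<dots> = (norm g)\<^sup>2 - 4 * V' t * (g \<bullet> x) + 4 * (t * (V' t)\<^sup>2)"
    unfolding power2_norm_eq_inner t_def
    by (simp add: inner_diff_left inner_diff_right inner_commute power2_eq_square algebra_simps)
  finally have "2 * \<mu> * (V t)\<^sup>2 * (4 * V' t * (g \<bullet> x) - 4 * (t * (V' t)\<^sup>2)) \<le> 2 * \<mu> * (V t)\<^sup>2 * (norm g)\<^sup>2"
    using \<mu> by (intro mult_left_mono) auto
  moreover have "0 \<le> q * tail_potential \<mu> u (norm x) * (V t)\<^sup>2"
    using \<mu> q tail_potential_nonneg[of \<mu> "norm x" u] by simp
  moreover have "V t * lower_order p \<mu> q lam \<omega> u x = 2 * \<mu> * (V t)\<^sup>2 * (norm g)\<^sup>2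
      + \<omega> * (V t)\<^sup>2 - lam * \<bar>V t\<bar> powr (p - 1) * (V t)\<^sup>2
      + q * ((hu u (sqrt t))\<^sup>2 / t) * (1 + \<mu> * (V t)\<^sup>2) * (V t)\<^sup>2
      + q * tail_potential \<mu> u (norm x) * (V t)\<^sup>2"
    unfolding lower_order_def ux t_def[symmetric] g_def n(2) by (simp add: n(1) power2_eq_square algebra_simps)
  moreover have "2 * \<mu> * (V t)\<^sup>2 * (4 * V' t * (g \<bullet> x) - 4 * (t * (V' t)\<^sup>2))
    = 8 * \<mu> * (V t)\<^sup>2 * V' t * (g \<bullet> x) - 8 * \<mu> * t * (V t * V' t)\<^sup>2"
    by (simp add: power_mult_distrib algebra_simps)
  ultimately show ?thesis unfolding t_def[symmetric] g_def[symmetric] by linarith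
qed

text \<open>The pointwise domination in the hypotheses is the single place where the size of
  \<omega> is expressed; the proof derives the data of \<open>radial_profile\<close> from the weak
  solution and appeals to \<open>V_zero\<close>.\<close>

proposition weak_solution_trivial:
  fixes p \<mu> q lam \<omega> :: real
  assumes p: "1 < p" and \<mu>: "0 < \<mu>" and q: "0 < q"
    and \<omega>: "\<And>y. y\<^sup>2 + lam * \<bar>y\<bar> powr (p - 1) * y\<^sup>2 \<le> \<omega> * y\<^sup>2 + \<mu> * sqrt q * y ^ 6"
    and ws: "weak_solution p \<mu> q lam \<omega> u"
  shows "AE x in lebesgue. u x = 0"
proof -
  let ?g = "weak_gradient u"
  define R where "R = lower_order p \<mu> q lam \<omega> u"
  have X: "u \<in> X_space" using ws by (simp add: weak_solution_def)
  then have u: "u \<in> H1" "radial u" "(\<lambda>x. (u x)\<^sup>2) \<in> H1" by (auto simp: X_space_def H1_r_def)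
  have w: "has_weak_gradient u ?g" by (rule weak_gradient_has_weak_gradient[OF u(1)])
  \<comment> \<open>\<open>weak_gradient u\<close> is an arbitrary choice and is not known here to
    be square integrable. The energy bounds concern V alone, so a different weak gradient may supply
    them.\<close>
  obtain g0 where g0: "has_weak_gradient u g0" "square_integrable g0"
    using u(1) by (auto simp: H1_def)
  obtain g2 where g2: "has_weak_gradient (\<lambda>x. (u x)\<^sup>2) g2" "square_integrable g2"
    using u(3) by (auto simp: H1_def)
  have su: "square_integrable u" "square_integrable (\<lambda>x. (u x)\<^sup>2)" using u(1,3) by (auto simp: H1_def)
  have mu: "u \<in> borel_measurable lebesgue" using su by (simp add: square_integrable_def)
  have iu2: "integrable lebesgue (\<lambda>x. (u x)\<^sup>2)" and iu4: "integrable lebesgue (\<lambda>x. ((u x)\<^sup>2)\<^sup>2)"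
    using su by (auto simp: square_integrable_def)
  obtain V c where V: "continuous_on {0<..} V" "AE x in lebesgue. u x = V (x \<bullet> x)"
    "{t. 0 < t \<and> profile u (sqrt t) \<noteq> V t} \<in> null_sets lebesgue"
    "\<forall>t>0. 2 * pi * t * V t = cumulative (\<lambda>x. 2 * u x) t + cumulative (\<lambda>x. ?g x \<bullet> x) t + c"
    by (rule radial_weakly_differentiable_continuous[OF w u(2)]) (rule that; assumption)
  obtain c' where fi: "annularly_integrable (\<lambda>x. 2 * (1 + 2 * \<mu> * (u x)\<^sup>2) * (?g x \<bullet> x))"
    and Ri: "annularly_integrable R"
    and flux: "\<forall>a b. 0 < a \<longrightarrow> a < b \<longrightarrow> (LINT x:annulus a b|lebesgue. 2 * (1 + 2 * \<mu> * (u x)\<^sup>2) * (?g x \<bullet> x))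
      = integral {a..b} (\<lambda>t. cumulative R t + c')"
    by (rule weak_solution_flux[OF ws w V(2,1) mu, folded R_def]) (rule that; assumption)
  define W where "W = (\<lambda>t. cumulative R t + c')"
  have cW: "continuous_on {0<..} W"
    unfolding W_def by (intro continuous_intros continuous_cumulative Ri)
  have nz: "0 < 1 + 2 * \<mu> * y\<^sup>2" for y using \<mu> by (simp add: add_pos_nonneg)
  define V' where "V' = (\<lambda>t. W t / (4 * pi * t * (1 + 2 * \<mu> * (V t)\<^sup>2)))"
  have dV: "(V has_real_derivative V' t) (at t)" if "0 < t" for t
    unfolding V'_def
    by (rule weak_solution_C1[OF w V(1,2,4) \<mu> cW fi _ that]) (use flux in \<open>simp add: W_def\<close>)
  have cV': "continuous_on {0<..} V'"
    unfolding V'_def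
  proof (intro continuous_intros cW V)
    show "\<forall>t\<in>{0<..}. 4 * pi * t * (1 + 2 * \<mu> * (V t)\<^sup>2) \<noteq> 0"
    proof
      fix t :: real assume "t \<in> {0<..}"
      then have "0 < 4 * pi * t * (1 + 2 * \<mu> * (V t)\<^sup>2)" by (intro mult_pos_pos nz) auto
      then show "4 * pi * t * (1 + 2 * \<mu> * (V t)\<^sup>2) \<noteq> 0" by linarith
    qed
  qed
  have WV': "W t = pi * (4 * t * (1 + 2 * \<mu> * (V t)\<^sup>2) * V' t)" if "0 < t" for t
  proof -
    define d where "d = 4 * pi * t * (1 + 2 * \<mu> * (V t)\<^sup>2)"
    have "0 < d" unfolding d_def using that by (intro mult_pos_pos nz) auto
    then have "W t = d * V' t" unfolding V'_def d_def[symmetric] by simp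
    then show ?thesis by (simp add: d_def mult_ac)
  qed
  define H where "H = (\<lambda>t. hu u (sqrt t))"
  define I where "I = (LINT x|lebesgue. (u x)\<^sup>2)"
  note Hp = hu_primitive[OF iu2 V(2,1,3)]
  have dH: "(H has_real_derivative (V t)\<^sup>2 / 2) (at t)" if "0 < t" for t
    unfolding H_def by (rule Hp(1)[OF that])
  have cH: "continuous_on {0<..} H"
    using dH by (auto intro!: continuous_at_imp_continuous_on DERIV_isCont)
  \<comment> \<open>One constant for the four bounds. The divisor 4 pi is that of
    \<open>radial_energy_bound\<close>; it becomes 16 pi for u^2 because the derivative of V^2 is 2
    V V'.\<close>
  define C where "C = Max {I / pi, (LINT x|lebesgue. ((u x)\<^sup>2)\<^sup>2) / pi,
    (LINT x|lebesgue. (norm (g0 x))\<^sup>2) / (4 * pi), (LINT x|lebesgue. (norm (g2 x))\<^sup>2) / (16 * pi)}"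
  have C: "I / pi \<le> C" "(LINT x|lebesgue. ((u x)\<^sup>2)\<^sup>2) / pi \<le> C"
    "(LINT x|lebesgue. (norm (g0 x))\<^sup>2) / (4 * pi) \<le> C" "(LINT x|lebesgue. (norm (g2 x))\<^sup>2) / (16 * pi) \<le> C"
    by (auto simp: C_def)
  have RP: "radial_profile V V' H \<mu> q lam \<omega> p (I / pi) C"
  proof
    show "0 < \<mu>" "0 < q" "1 < p" by fact+
    show "(V has_real_derivative V' t) (at t)" if "0 < t" for t by (rule dV[OF that])
    show "continuous_on {0<..} V'" by (rule cV')
    show "(H has_real_derivative (V t)\<^sup>2 / 2) (at t)" if "0 < t" for t by (rule dH[OF that])
    show "0 \<le> H t" if "0 < t" for t by (simp add: H_def hu_nonneg)
    show "H t \<le> I / pi" if "0 < t" for t using Hp(2)[OF that] by (simp add: H_def I_def)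
    show "y\<^sup>2 + lam * \<bar>y\<bar> powr (p - 1) * y\<^sup>2 \<le> \<omega> * y\<^sup>2 + \<mu> * sqrt q * y ^ 6" for y by (rule \<omega>)
    fix a b :: real assume ab: "0 < a" "a \<le> b"
    have sub: "continuous_on {a..b} h" if "continuous_on {0<..} h" for h :: "real \<Rightarrow> real"
      by (rule continuous_on_subset[OF that]) (use ab in auto)
    note cs = sub[OF V(1)] sub[OF cV'] sub[OF cH] sub[OF cW]
    show "integral {a..b} (\<lambda>t. (V t)\<^sup>2) \<le> C"
    proof -
      have "integral {a..b} (\<lambda>t. (V t)\<^sup>2) \<le> I / pi" unfolding I_def
        by (rule integral_radial_bound[OF iu2 _ _ _ ab])
          (use V(2) in \<open>auto intro!: continuous_intros V(1) elim: eventually_mono\<close>)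
      then show ?thesis using C(1) by simp
    qed
    show "integral {a..b} (\<lambda>t. (V t) ^ 4) \<le> C"
    proof -
      have "integral {a..b} (\<lambda>t. (V t) ^ 4) \<le> (LINT x|lebesgue. ((u x)\<^sup>2)\<^sup>2) / pi"
        by (rule integral_radial_bound[OF iu4 _ _ _ ab])
          (use V(2) in \<open>auto intro!: continuous_intros V(1) elim!: eventually_mono simp flip: power_mult\<close>)
      then show ?thesis using C(2) by simp
    qed
    show "integral {a..b} (\<lambda>t. t * (V' t)\<^sup>2) \<le> C"
    proof -
      have "4 * pi * integral {a..b} (\<lambda>t. t * (V' t)\<^sup>2) \<le> (LINT x|lebesgue. (norm (g0 x))\<^sup>2)"
        by (rule radial_energy_bound[OF g0 u(2) V(2) dV cV' ab])
      then have "integral {a..b} (\<lambda>t. t * (V' t)\<^sup>2) \<le> (LINT x|lebesgue. (norm (g0 x))\<^sup>2) / (4 * pi)"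
        by (simp add: field_simps)
      then show ?thesis using C(3) by linarith
    qed
    show "integral {a..b} (\<lambda>t. t * (V t * V' t)\<^sup>2) \<le> C"
    proof -
      have rad2: "radial (\<lambda>x. (u x)\<^sup>2)" using u(2) unfolding radial_def by metis
      have "4 * pi * integral {a..b} (\<lambda>t. t * (2 * V t * V' t)\<^sup>2) \<le> (LINT x|lebesgue. (norm (g2 x))\<^sup>2)"
      proof (rule radial_energy_bound[OF g2 rad2 _ _ _ ab])
        show "AE x in lebesgue. (u x)\<^sup>2 = (V (x \<bullet> x))\<^sup>2" using V(2) by (rule eventually_mono) simp
        show "((\<lambda>t. (V t)\<^sup>2) has_real_derivative 2 * V t * V' t) (at t)" if "0 < t" for t
          by (rule derivative_eq_intros refl dV that)+ simp
        show "continuous_on {0<..} (\<lambda>t. 2 * V t * V' t)" by (intro continuous_intros V(1) cV')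
      qed
      moreover have "(\<lambda>t. t * (2 * V t * V' t)\<^sup>2) = (\<lambda>t. 4 * (t * (V t * V' t)\<^sup>2))"
        by (simp add: power_mult_distrib mult_ac)
      ultimately have "16 * pi * integral {a..b} (\<lambda>t. t * (V t * V' t)\<^sup>2) \<le> (LINT x|lebesgue. (norm (g2 x))\<^sup>2)"
        by simp
      then have "integral {a..b} (\<lambda>t. t * (V t * V' t)\<^sup>2) \<le> (LINT x|lebesgue. (norm (g2 x))\<^sup>2) / (16 * pi)"
        by (simp add: field_simps)
      then show ?thesis using C(4) by linarith
    qed
    \<comment> \<open>\<open>k\<close> collects the terms without V'. The quasilinear contribution
      16 \<mu> t (V V')^2 splits evenly: one half is \<open>m\<close>, from the |g|^2 term of the
      equation, the other half sits in \<open>e\<close>, from the flux.\<close>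
    define k where "k = (\<lambda>t. \<omega> * (V t)\<^sup>2 - lam * \<bar>V t\<bar> powr (p - 1) * (V t)\<^sup>2
      + q * ((H t)\<^sup>2 / t) * (1 + \<mu> * (V t)\<^sup>2) * (V t)\<^sup>2)"
    define m where "m = (\<lambda>t. 8 * \<mu> * t * (V t * V' t)\<^sup>2)"
    define e where "e = (\<lambda>t. 4 * t * (1 + 2 * \<mu> * (V t)\<^sup>2) * (V' t)\<^sup>2)"
    define \<theta> where "\<theta> = (\<lambda>t. 8 * \<mu> * (V t)\<^sup>2 * V' t)"
    have cp: "continuous_on {a..b} (\<lambda>t. \<bar>V t\<bar> powr (p - 1))"
      by (rule continuous_on_powr') (use p in \<open>auto intro!: continuous_intros cs\<close>)
    have ck: "continuous_on {a..b} k" unfolding k_def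
      by (intro continuous_on_add continuous_on_diff continuous_on_mult continuous_on_divide continuous_on_power
          continuous_on_const continuous_on_id cs cp) (use ab in auto)
    have cm: "continuous_on {a..b} m" unfolding m_def by (intro continuous_intros cs)
    have ce: "continuous_on {a..b} e" unfolding e_def by (intro continuous_intros cs)
    have c\<theta>: "continuous_on {a..b} \<theta>" unfolding \<theta>_def by (intro continuous_intros cs)
    have ig: "annularly_integrable (\<lambda>x. ?g x \<bullet> x)"
      using w by (auto simp: has_weak_gradient_def locally_integrable_radial_part)
    have s1: "set_integrable lebesgue (annulus a b) (\<lambda>x. \<theta> (x \<bullet> x) * (?g x \<bullet> x))"
      by (intro annulus_mult_integrable c\<theta>) (use ig ab in \<open>auto simp: annularly_integrable_def\<close>)
    have s2: "set_integrable lebesgue (annulus a b) (\<lambda>x. k (x \<bullet> x) - m (x \<bullet> x))"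
      using ab by (intro annulus_integral_radial(1)[where F = "\<lambda>t. k t - m t"] continuous_intros ck cm) auto
    have s3: "set_integrable lebesgue (annulus a b) (\<lambda>x. V (x \<bullet> x) * R x)"
      by (intro annulus_mult_integrable cs) (use Ri ab in \<open>auto simp: annularly_integrable_def\<close>)
    \<comment> \<open>In the lower bound for |g|^2 the part linear in g integrates to twice
      \<open>m\<close> and the quadratic correction takes one \<open>m\<close> away.\<close>
    have "pi * integral {a..b} (\<lambda>t. k t + m t)
      = 2 * pi * integral {a..b} (\<lambda>t. \<theta> t * (t * V' t)) + pi * integral {a..b} (\<lambda>t. k t - m t)"
    proof -
      have "(\<lambda>t. \<theta> t * (t * V' t)) = m" by (simp add: \<theta>_def m_def fun_eq_iff power2_eq_square)
      then show ?thesis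
        by (simp only: integral_add[OF integrable_continuous_real[OF ck] integrable_continuous_real[OF cm]]
            integral_diff[OF integrable_continuous_real[OF ck] integrable_continuous_real[OF cm]])
          (simp add: distrib_left right_diff_distrib)
    qed
    also have "\<dots> = (LINT x:annulus a b|lebesgue. \<theta> (x \<bullet> x) * (?g x \<bullet> x)) + (LINT x:annulus a b|lebesgue. k (x \<bullet> x) - m (x \<bullet> x))"
      using radial_part_of_weak_gradient[OF w u(2) V(2) dV cV' ab c\<theta>]
        annulus_integral_radial(2)[OF less_imp_le[OF ab(1)] ab(2) continuous_on_diff[OF ck cm]] by simp
    also have "\<dots> = (LINT x:annulus a b|lebesgue. \<theta> (x \<bullet> x) * (?g x \<bullet> x) + (k (x \<bullet> x) - m (x \<bullet> x)))"
      by (rule set_integral_add(2)[OF s1 s2, symmetric])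
    also have "\<dots> \<le> (LINT x:annulus a b|lebesgue. V (x \<bullet> x) * R x)"
      unfolding set_lebesgue_integral_def
    proof (rule integral_mono_AE)
      show "integrable lebesgue (\<lambda>x. indicator (annulus a b) x *\<^sub>R (\<theta> (x \<bullet> x) * (?g x \<bullet> x) + (k (x \<bullet> x) - m (x \<bullet> x))))"
        using set_integral_add(1)[OF s1 s2] by (simp only: set_integrable_def)
      show "integrable lebesgue (\<lambda>x. indicator (annulus a b) x *\<^sub>R (V (x \<bullet> x) * R x))"
        using s3 by (simp only: set_integrable_def)
      show "AE x in lebesgue. indicator (annulus a b) x *\<^sub>R (\<theta> (x \<bullet> x) * (?g x \<bullet> x) + (k (x \<bullet> x) - m (x \<bullet> x)))
        \<le> indicator (annulus a b) x *\<^sub>R (V (x \<bullet> x) * R x)"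
        using V(2)
      proof (rule eventually_mono)
        fix x assume ux: "u x = V (x \<bullet> x)"
        have "\<theta> (x \<bullet> x) * (?g x \<bullet> x) + (k (x \<bullet> x) - m (x \<bullet> x)) \<le> V (x \<bullet> x) * R x"
          using lower_order_test_bound[of u x V \<mu> q V' \<omega> lam p, OF ux \<mu> q]
          unfolding \<theta>_def k_def m_def H_def R_def by simp
        then show "indicator (annulus a b) x *\<^sub>R (\<theta> (x \<bullet> x) * (?g x \<bullet> x) + (k (x \<bullet> x) - m (x \<bullet> x)))
          \<le> indicator (annulus a b) x *\<^sub>R (V (x \<bullet> x) * R x)"
          by (simp split: split_indicator)
      qed
    qed
    also have "\<dots> = V b * cumulative R b - V a * cumulative R a - integral {a..b} (\<lambda>t. V' t * cumulative R t)"
      using ab by (intro annulus_by_parts Ri cs) (auto intro!: has_field_derivative_at_within dV)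
    \<comment> \<open>The constant c' cancels: it changes the boundary terms and the integral of V'
      by the same amount.\<close>
    also have "\<dots> = V b * W b - V a * W a - integral {a..b} (\<lambda>t. V' t * W t)"
    proof -
      have I1: "integral {a..b} V' = V b - V a"
        using ab dV by (intro integral_unique fundamental_theorem_of_calculus)
          (auto simp flip: has_real_derivative_iff_has_vector_derivative intro: has_field_derivative_at_within)
      have "integral {a..b} (\<lambda>t. V' t * W t) = integral {a..b} (\<lambda>t. V' t * cumulative R t) + integral {a..b} (\<lambda>t. V' t * c')"
        unfolding W_def distrib_left
        by (intro integral_add integrable_continuous_real continuous_intros cs continuous_on_cumulative_Icc Ri ab)
      also have "integral {a..b} (\<lambda>t. V' t * c') = (V b - V a) * c'" by (simp add: I1)
      finally have I2: "integral {a..b} (\<lambda>t. V' t * W t)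
        = integral {a..b} (\<lambda>t. V' t * cumulative R t) + (V b - V a) * c'" .
      have "W a = cumulative R a + c'" "W b = cumulative R b + c'" by (simp_all add: W_def)
      then show ?thesis unfolding I2 by (simp add: algebra_simps)
    qed
    also have "integral {a..b} (\<lambda>t. V' t * W t) = integral {a..b} (\<lambda>t. pi * e t)"
      using ab by (intro integral_cong) (simp add: WV' e_def power2_eq_square)
    finally have "pi * (integral {a..b} (\<lambda>t. k t + m t) + integral {a..b} e) \<le> V b * W b - V a * W a"
      by (simp add: algebra_simps)
    also have "V b * W b - V a * W a = pi * (V b * (4 * b * (1 + 2 * \<mu> * (V b)\<^sup>2) * V' b) - V a * (4 * a * (1 + 2 * \<mu> * (V a)\<^sup>2) * V' a))"
      using ab by (simp add: WV' algebra_simps)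
    finally have "integral {a..b} (\<lambda>t. k t + m t) + integral {a..b} e
      \<le> V b * (4 * b * (1 + 2 * \<mu> * (V b)\<^sup>2) * V' b) - V a * (4 * a * (1 + 2 * \<mu> * (V a)\<^sup>2) * V' a)"
      by (simp only: mult_le_cancel_left_pos[OF pi_gt_zero])
    moreover have "integral {a..b} (\<lambda>t. k t + m t) + integral {a..b} e = integral {a..b} (\<lambda>t. k t + m t + e t)"
      by (intro integral_add[symmetric] integrable_continuous_real continuous_intros ck cm ce)
    moreover have "(\<lambda>t. k t + m t + e t) = (\<lambda>t. 4 * t * (V' t)\<^sup>2 * (1 + 4 * \<mu> * (V t)\<^sup>2) + \<omega> * (V t)\<^sup>2
        - lam * \<bar>V t\<bar> powr (p - 1) * (V t)\<^sup>2 + q * ((H t)\<^sup>2 / t) * (1 + \<mu> * (V t)\<^sup>2) * (V t)\<^sup>2)"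
      by (simp add: k_def m_def e_def fun_eq_iff power_mult_distrib algebra_simps)
    ultimately show "integral {a..b} (\<lambda>t. 4 * t * (V' t)\<^sup>2 * (1 + 4 * \<mu> * (V t)\<^sup>2) + \<omega> * (V t)\<^sup>2
        - lam * \<bar>V t\<bar> powr (p - 1) * (V t)\<^sup>2 + q * ((H t)\<^sup>2 / t) * (1 + \<mu> * (V t)\<^sup>2) * (V t)\<^sup>2)
    \<le> V b * (4 * b * (1 + 2 * \<mu> * (V b)\<^sup>2) * V' b) - V a * (4 * a * (1 + 2 * \<mu> * (V a)\<^sup>2) * V' a)"
      by simp
  qed
  have V0: "V t = 0" if "0 < t" for t using that by (rule radial_profile.V_zero[OF RP])
  from AE_not_in[OF circle_null[of 0]] V(2) show ?thesis
    by eventually_elim (use V0 in auto)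
qed

text \<open>\<open>Y\<close> is the point where lam |y|^(p-1) and c y^4 coincide. Below it the power
  is at most its value at \<open>Y\<close>; beyond it the quartic wins since p - 1 < 4. Multiplying
  by y^2 gives the claim, and the summand 1 in the threshold pays for the extra y^2 on the
  left.\<close>

lemma powr_domination:
  fixes p c lam :: real
  assumes p: "1 < p" "p < 5" and c: "0 < c" and lam: "0 < lam"
  obtains \<omega>\<^sub>0 where "0 < \<omega>\<^sub>0"
    "\<forall>\<omega>\<ge>\<omega>\<^sub>0. \<forall>y. y\<^sup>2 + lam * \<bar>y\<bar> powr (p - 1) * y\<^sup>2 \<le> \<omega> * y\<^sup>2 + c * y ^ 6"
proof -
  define Y where "Y = (lam / c) powr (1 / (5 - p))"
  have bound: "lam * \<bar>y\<bar> powr (p - 1) \<le> lam * Y powr (p - 1) + c * \<bar>y\<bar> ^ 4" for y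
  proof (cases "\<bar>y\<bar> \<le> Y")
    case True
    then have "\<bar>y\<bar> powr (p - 1) \<le> Y powr (p - 1)" using p by (intro powr_mono2) auto
    then have "lam * \<bar>y\<bar> powr (p - 1) \<le> lam * Y powr (p - 1)" using lam by simp
    then show ?thesis using c by (simp add: add_increasing2)
  next
    case False
    then have y: "0 < \<bar>y\<bar>" "Y \<le> \<bar>y\<bar>" by (auto simp: Y_def)
    have "lam / c = Y powr (5 - p)" using p c lam by (simp add: Y_def powr_powr)
    also have "\<dots> \<le> \<bar>y\<bar> powr (5 - p)" using y p by (intro powr_mono2) (auto simp: Y_def)
    finally have "lam \<le> c * \<bar>y\<bar> powr (5 - p)" using c by (simp add: field_simps)
    then have "lam * \<bar>y\<bar> powr (p - 1) \<le> c * \<bar>y\<bar> powr (5 - p) * \<bar>y\<bar> powr (p - 1)"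
      by (intro mult_right_mono) auto
    also have "\<dots> = c * \<bar>y\<bar> powr 4" by (simp add: mult.assoc flip: powr_add)
    also have "\<bar>y\<bar> powr 4 = \<bar>y\<bar> ^ 4" using y by (simp add: powr_numeral)
    finally show ?thesis using lam by (simp add: add_increasing)
  qed
  show ?thesis
  proof (rule that[of "1 + lam * Y powr (p - 1)"])
    show "0 < 1 + lam * Y powr (p - 1)" using lam by (simp add: add_pos_nonneg)
    show "\<forall>\<omega>\<ge>1 + lam * Y powr (p - 1). \<forall>y. y\<^sup>2 + lam * \<bar>y\<bar> powr (p - 1) * y\<^sup>2 \<le> \<omega> * y\<^sup>2 + c * y ^ 6"
    proof (intro allI impI)
      fix \<omega> y :: real assume \<omega>: "1 + lam * Y powr (p - 1) \<le> \<omega>"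
      have "(1 + lam * \<bar>y\<bar> powr (p - 1)) * y\<^sup>2 \<le> (\<omega> + c * \<bar>y\<bar> ^ 4) * y\<^sup>2"
        using bound[of y] \<omega> by (intro mult_right_mono) auto
      moreover have "\<bar>y\<bar> ^ 4 * y\<^sup>2 = y ^ 6" by (simp add: power_even_abs flip: power_add)
      ultimately show "y\<^sup>2 + lam * \<bar>y\<bar> powr (p - 1) * y\<^sup>2 \<le> \<omega> * y\<^sup>2 + c * y ^ 6"
        by (simp add: distrib_right mult.assoc)
    qed
  qed
qed

theorem theorem1p2:
  fixes p \<mu> q lam :: real
  assumes "1 < p" and "p < 5" and "\<mu> > 0" and "q > 0" and "lam > 0"
  shows "\<exists>\<omega>\<^sub>0 > 0. \<forall>\<omega> \<ge> \<omega>\<^sub>0.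
           \<not> (\<exists>u \<in> X_space. weak_solution p \<mu> q lam \<omega> u \<and> \<not> (AE x in lebesgue. u x = 0))"
proof -
  have "0 < \<mu> * sqrt q" using assms by simp
  then obtain \<omega>\<^sub>0 where \<omega>\<^sub>0: "0 < \<omega>\<^sub>0"
    "\<forall>\<omega>\<ge>\<omega>\<^sub>0. \<forall>y. y\<^sup>2 + lam * \<bar>y\<bar> powr (p - 1) * y\<^sup>2 \<le> \<omega> * y\<^sup>2 + \<mu> * sqrt q * y ^ 6"
    by (rule powr_domination[OF assms(1,2) _ assms(5)])
  then show ?thesis
    using weak_solution_trivial[OF assms(1,3,4)] by blast
qed

end
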